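(* Consider, in the setting of the context, conforming tensor cells with parent cube $[-1,1]^3$, reference maps $X_e\in\mathbb Q_2^3$, and full local variation spaces $\widehat V_e=\mathbb Q_{p_e}^3$, $p_e\ge2$, assembled into a conforming global space $V_h$; the orders may differ between cells and between meshes. On cell $e$, coordinate $i$ uses $n_{e,i}\ge p_e+1$ Gauss--Legendre points, with the (positive) tensor-product weights. Let the global linear candidate space $\mathcal Z_h$ contain the physical identity $\iota(X)=X$. Assume that throughout every parent cell $$\|J_{X,e}\|_2\le b\,h_e,\qquad\|J_{X,e}^{-1}\|_2\le(a\,h_e)^{-1},\qquad\det J_{X,e}>0,$$ where $h_e>0$ is a cell size and $0<a\le b$ are independent of mesh size and all cell orders. Assume the admissible conforming variation spaces satisfy the Poincaré inequality $\|u_h\|_{L^2(\Omega_h)}\le C_P\|\nabla_Xu_h\|_{L^2(\Omega_h)}$ with the same constant $C_P$. Let $c_{1,e},c_{2,e}\ge0$ and choose one coefficient $c_*$ with $$c_*\ge c_0>0,\qquad c_*\le\min_e(c_{1,e}+c_{2,e}),$$ with $c_0$ independent of mesh size and all cell orders. Then at the stress-free identity deformation $y_{\rm ref}(X)=X$ and for arbitrary nonnegative cell bulk moduli $\kappa_e$, the potential $z_h=2c_*\iota$ belongs to $\mathcal Z_h^0$ and, for all $u_h\in V_h$, $$G_{z,h}(y_{\rm ref})[u_h,u_h]\ge\frac{2c_0}{1+C_P^2}\left(\frac ab\right)^5\|u_h\|_{H^1(\Omega_h)}^2 .$$ Moreover the exact boundary representation $K_h(y_h)=G_{z,h}(y_h)-R_\Gamma^TB_\Gamma[z_h]R_\Gamma$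 of the complete tangent holds.
   Context: Matrices: $A:B=\operatorname{tr}(A^TB)$; $\operatorname{cof}A$ is the matrix of signed $2\times2$ minors; $A\times B=\operatorname{cof}(A+B)-\operatorname{cof}A-\operatorname{cof}B$; $\|\cdot\|_2$ is the spectral norm. $\mathbb Q_p$ is the space of polynomials on $[-1,1]^3$ of degree at most $p$ in each coordinate. Setting: $\Omega_h\subset\mathbb R^3$ is a connected bounded Lipschitz domain partitioned into finitely many conforming cells $K_e=X_e([-1,1]^3)$, with $X_e$ orientation-preserving, one-to-one, agreeing on shared faces. A subscript $e$ denotes pullback by $X_e$; $D_\xi$ is the parent derivative (rows are components), $J_{X,e}=D_\xi X_e$, $J_{y,e}=D_\xi y_e$, $J_{z,e}=D_\xi z_e$; $F=\nabla_Xy_h=J_yJ_X^{-1}$. $V_h\subset H^1(\Omega_h;\mathbb R^3)$ is the finite-dimensional space of admissible continuous variations, with pullbacks in $\widehat V_e$, vanishing on the essential boundary part $\Gamma_D$. $\|u\|_{H^1}^2=\int_{\Omega_h}(|u|^2+\|\nabla_Xu\|_F^2)\,dX$. $\mathcal Z_h$ is a finite-dimensional linear space of continuous piecewise differentiable potentials. $\mathcal I_e$ is exact integration on the parent cell, $\mathcal Q_e$ the stated tensor Gauss rule, $\mathcal T_e(z;u,v)=(\mathcal Q_e-\mathcal I_e)[D_\xi z:(D_\xi u\times D_\xi v)]$, and $\mathcal Z_h^0=\{z_h\in\mathcal Z_h:\mathcal T_e(z_e;u,v)=0\ \forall e,\ \forall u,v\in\widehat V_e\}$. Energy: $W_{\mathrm{iso},e}(F)=c_{1,e}(J^{-2/3}F:F-3)+c_{2,e}(J^{-4/3}\operatorname{cof}F:\operatorname{cof}F-3)$,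 $J=\det F>0$; $V_e^Q=\mathcal Q_e[\det J_{X,e}]$, $c_e(y_h)=\mathcal Q_e[\det J_{y,e}-\det J_{X,e}]$; $$E_h(y_h)=\sum_e\mathcal Q_e[\det J_{X,e}W_{\mathrm{iso},e}(F)]+\sum_e\frac{\kappa_e}{2V_e^Q}c_e(y_h)^2,\qquad K_h(y_h)=D^2E_h(y_h)\text{ along }V_h.$$ Reference form: $\mathcal C_h^Q[z_h]$ is the Hessian on $V_h$, with $z_h$ fixed, of $y_h\mapsto\sum_e\mathcal Q_e[J_{z,e}:\operatorname{cof}J_{y,e}]$, and $G_{z,h}(y_h)=K_h(y_h)+\mathcal C_h^Q[z_h]$. $R_\Gamma$ extracts the free external boundary trace of a variation, and $B_\Gamma[z_h]$ is the symmetric, $y_h$-independent matrix in trace coordinates such that $R_\Gamma^TB_\Gamma[z_h]R_\Gamma$ is the Hessian on $V_h$ of $y_h\mapsto\int_{\partial\Omega_h}z_h\cdot\{\operatorname{cof}(\nabla_Xy_h)n_X\}\,dS$ ($n_X$ the outward unit normal). *)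

theory Defs
  imports "HOL-Analysis.Analysis" "HOL-Computational_Algebra.Polynomial"
begin

section \<open>Matrices\<close>

definition frob :: "real^3^3 \<Rightarrow> real^3^3 \<Rightarrow> real" where
  "frob A B = trace (transpose A ** B)"

text \<open>Index arithmetic in the type \<^typ>\<open>3\<close> is modulo 3, so taking the two remaining rows and
  columns in cyclic order already produces the sign of the minor.\<close>

definition cof :: "real^3^3 \<Rightarrow> real^3^3" where
  "cof A = (\<chi> i j. A $ (i+1) $ (j+1) * A $ (i+2) $ (j+2) - A $ (i+1) $ (j+2) * A $ (i+2) $ (j+1))"

definition mcross :: "real^3^3 \<Rightarrow> real^3^3 \<Rightarrow> real^3^3" where
  "mcross A B = cof (A + B) - cof A - cof B"

definition spectral_norm :: "real^3^3 \<Rightarrow> real" where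
  "spectral_norm A = onorm ((*v) A)"

section \<open>Parent cell: polynomials, derivatives and Gauss--Legendre quadrature\<close>

definition cube :: "(real^3) set" where
  "cube = {\<xi>. \<forall>i. \<bar>\<xi> $ i\<bar> \<le> 1}"

text \<open>Vector fields on the parent cube whose components are polynomials of degree at most \<open>p\<close> in
  each coordinate; values outside the cube are irrelevant.\<close>

definition tensor_poly :: "nat \<Rightarrow> (real^3 \<Rightarrow> real^3) set" where
  "tensor_poly p = {f. \<forall>k. \<exists>c :: (3 \<Rightarrow> nat) \<Rightarrow> real. \<forall>\<xi>\<in>cube.
      f \<xi> $ k = (\<Sum>\<alpha> | \<forall>i. \<alpha> i \<le> p. c \<alpha> * (\<Prod>i\<in>UNIV. (\<xi> $ i) ^ \<alpha> i))}"

text \<open>Derivatives are taken within the cube, hence one-sided at its boundary (where they are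
  still unique).\<close>

definition parent_jac :: "(real^3 \<Rightarrow> real^3) \<Rightarrow> real^3 \<Rightarrow> real^3^3" where
  "parent_jac f \<xi> = matrix (frechet_derivative f (at \<xi> within cube))"

definition legendre :: "nat \<Rightarrow> real poly" where
  "legendre n = smult (1 / (2 ^ n * fact n)) ((pderiv ^^ n) ([:-1, 0, 1:] ^ n))"

definition gauss_nodes :: "nat \<Rightarrow> real set" where
  "gauss_nodes n = {x. poly (legendre n) x = 0}"

definition gauss_weight :: "nat \<Rightarrow> real \<Rightarrow> real" where
  "gauss_weight n x = integral {-1..1} (\<lambda>t. \<Prod>y\<in>gauss_nodes n - {x}. (t - y) / (x - y))"

definition tensor_nodes :: "(3 \<Rightarrow> nat) \<Rightarrow> (real^3) set" where
  "tensor_nodes n = {\<xi>. \<forall>i. \<xi> $ i \<in> gauss_nodes (n i)}"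

definition tensor_gauss :: "(3 \<Rightarrow> nat) \<Rightarrow> (real^3 \<Rightarrow> real) \<Rightarrow> real" where
  "tensor_gauss n f = (\<Sum>\<xi>\<in>tensor_nodes n. (\<Prod>i\<in>UNIV. gauss_weight (n i) (\<xi> $ i)) * f \<xi>)"

section \<open>Discretization data and conforming partitions\<close>

record 'e discretization =
  dom :: "(real^3) set"
  cells :: "'e set"
  geo :: "'e \<Rightarrow> real^3 \<Rightarrow> real^3"
  degree_of :: "'e \<Rightarrow> nat"
  points :: "'e \<Rightarrow> 3 \<Rightarrow> nat"
  dirichlet :: "(real^3) set"
  c1 :: "'e \<Rightarrow> real"
  c2 :: "'e \<Rightarrow> real"
  kappa :: "'e \<Rightarrow> real"

definition lipschitz_domain :: "(real^3) set \<Rightarrow> bool" where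
  "lipschitz_domain S \<longleftrightarrow> open S \<and> connected S \<and> bounded S \<and> S \<noteq> {} \<and>
    (\<forall>x\<in>frontier S. \<exists>r>0. \<exists>A :: real^3 \<Rightarrow> real^3. \<exists>\<gamma> :: real^2 \<Rightarrow> real. \<exists>L.
       orthogonal_transformation A \<and> L-lipschitz_on UNIV \<gamma> \<and>
       (\<forall>y\<in>ball x r. y \<in> S \<longleftrightarrow> \<gamma> (vector [A y $ 1, A y $ 2]) < A y $ 3))"

text \<open>A face, edge or vertex of the cube, according to whether \<open>I\<close> has 1, 2 or 3 elements.\<close>

definition cube_face :: "3 set \<Rightarrow> (3 \<Rightarrow> real) \<Rightarrow> (real^3) set" where
  "cube_face I \<sigma> = {\<xi>\<in>cube. \<forall>i\<in>I. \<xi> $ i = \<sigma> i}"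

text \<open>The linear maps \<open>g\<close> preserving the cube are the signed coordinate permutations; they account
  for the relative orientation of the parent coordinates of two neighbouring cells.\<close>

definition conforming_mesh :: "'e discretization \<Rightarrow> bool" where
  "conforming_mesh M \<longleftrightarrow>
     lipschitz_domain (dom M) \<and> finite (cells M) \<and>
     dirichlet M \<subseteq> frontier (dom M) \<and>
     (\<forall>e\<in>cells M. inj_on (geo M e) cube) \<and>
     closure (dom M) = (\<Union>e\<in>cells M. geo M e ` cube) \<and>
     (\<forall>e\<in>cells M. \<forall>e'\<in>cells M. e \<noteq> e' \<longrightarrow> geo M e ` cube \<inter> geo M e' ` cube \<noteq> {} \<longrightarrow>
        (\<exists>I \<sigma> g. I \<noteq> {} \<and> (\<forall>i\<in>I. \<bar>\<sigma> i\<bar> = 1) \<and> linear g \<and> g ` cube = cube \<and>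
           geo M e ` cube \<inter> geo M e' ` cube = geo M e ` cube_face I \<sigma> \<and>
           (\<forall>\<xi>\<in>cube_face I \<sigma>. geo M e' (g \<xi>) = geo M e \<xi>)))"

abbreviation quad :: "'e discretization \<Rightarrow> 'e \<Rightarrow> (real^3 \<Rightarrow> real) \<Rightarrow> real" where
  "quad M e \<equiv> tensor_gauss (points M e)"

abbreviation pullback :: "'e discretization \<Rightarrow> 'e \<Rightarrow> (real^3 \<Rightarrow> real^3) \<Rightarrow> real^3 \<Rightarrow> real^3" where
  "pullback M e u \<equiv> u \<circ> geo M e"

abbreviation jac :: "'e discretization \<Rightarrow> 'e \<Rightarrow> (real^3 \<Rightarrow> real^3) \<Rightarrow> real^3 \<Rightarrow> real^3^3" where
  "jac M e u \<equiv> parent_jac (pullback M e u)"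

abbreviation geo_jac :: "'e discretization \<Rightarrow> 'e \<Rightarrow> real^3 \<Rightarrow> real^3^3" where
  "geo_jac M e \<equiv> parent_jac (geo M e)"

section \<open>Function spaces and norms\<close>

definition conforming_fields :: "'e discretization \<Rightarrow> (real^3 \<Rightarrow> real^3) set" where
  "conforming_fields M = {y. continuous_on (closure (dom M)) y \<and>
     (\<forall>e\<in>cells M. pullback M e y \<in> tensor_poly (degree_of M e))}"

text \<open>The extension by zero only makes a field on \<^term>\<open>closure (dom M)\<close> a uniquely
  determined total function.\<close>

definition variations :: "'e discretization \<Rightarrow> (real^3 \<Rightarrow> real^3) set" where
  "variations M = {u \<in> conforming_fields M. (\<forall>X\<in>dirichlet M. u X = 0) \<and>
     (\<forall>X. X \<notin> closure (dom M) \<longrightarrow> u X = 0)}"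

text \<open>The energy and its Hessian are defined only where the deformation has positive Jacobian at
  the quadrature points.\<close>

definition deformations :: "'e discretization \<Rightarrow> (real^3 \<Rightarrow> real^3) set" where
  "deformations M = {y \<in> conforming_fields M.
     \<forall>e\<in>cells M. \<forall>\<xi>\<in>tensor_nodes (points M e). det (jac M e y \<xi>) > 0}"

text \<open>In the cell interiors this is the ordinary derivative, so for a continuous cellwise polynomial
  field it represents the weak gradient; on external faces it is the one-sided derivative. Its
  values on the inter-element faces, where the derivative need not exist, are immaterial.\<close>

definition grad :: "'e discretization \<Rightarrow> (real^3 \<Rightarrow> real^3) \<Rightarrow> real^3 \<Rightarrow> real^3^3" where
  "grad M u X = matrix (frechet_derivative u (at X within closure (dom M)))"

definition l2_norm :: "'e discretization \<Rightarrow> (real^3 \<Rightarrow> 'a::real_normed_vector) \<Rightarrow> real" where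
  "l2_norm M f = sqrt (integral (dom M) (\<lambda>X. (norm (f X))\<^sup>2))"

text \<open>The norm of the type \<^typ>\<open>real^3^3\<close> is the Frobenius norm.\<close>

definition h1_norm :: "'e discretization \<Rightarrow> (real^3 \<Rightarrow> real^3) \<Rightarrow> real" where
  "h1_norm M u = sqrt (integral (dom M) (\<lambda>X. (norm (u X))\<^sup>2 + (norm (grad M u X))\<^sup>2))"

definition potential_space :: "'e discretization \<Rightarrow> (real^3 \<Rightarrow> real^3) set \<Rightarrow> bool" where
  "potential_space M Z \<longleftrightarrow>
     (\<lambda>X. 0) \<in> Z \<and> (\<forall>z\<in>Z. \<forall>w\<in>Z. (\<lambda>X. z X + w X) \<in> Z) \<and> (\<forall>z\<in>Z. \<forall>r. (\<lambda>X. r *\<^sub>R z X) \<in> Z) \<and>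
     (\<exists>(m::nat) \<psi>. \<forall>z\<in>Z. \<exists>c. \<forall>X\<in>closure (dom M). z X = (\<Sum>i<m. c i *\<^sub>R \<psi> i X)) \<and>
     (\<forall>z\<in>Z. continuous_on (closure (dom M)) z \<and>
        (\<forall>e\<in>cells M. pullback M e z differentiable_on cube))"

definition quad_defect :: "'e discretization \<Rightarrow> 'e \<Rightarrow> (real^3 \<Rightarrow> real^3) \<Rightarrow>
    (real^3 \<Rightarrow> real^3) \<Rightarrow> (real^3 \<Rightarrow> real^3) \<Rightarrow> real" where
  "quad_defect M e z u v =
     (let f = (\<lambda>\<xi>. frob (parent_jac z \<xi>) (mcross (parent_jac u \<xi>) (parent_jac v \<xi>)))
      in quad M e f - integral cube f)"

definition exact_potentials ::
    "'e discretization \<Rightarrow> (real^3 \<Rightarrow> real^3) set \<Rightarrow> (real^3 \<Rightarrow> real^3) set" where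
  "exact_potentials M Z = {z\<in>Z. \<forall>e\<in>cells M.
     \<forall>u\<in>tensor_poly (degree_of M e). \<forall>v\<in>tensor_poly (degree_of M e). quad_defect M e (pullback M e z) u v = 0}"

section \<open>Energy, tangent and reference form\<close>

definition defgrad :: "'e discretization \<Rightarrow> 'e \<Rightarrow> (real^3 \<Rightarrow> real^3) \<Rightarrow> real^3 \<Rightarrow> real^3^3" where
  "defgrad M e y \<xi> = jac M e y \<xi> ** matrix_inv (geo_jac M e \<xi>)"

definition W_iso :: "'e discretization \<Rightarrow> 'e \<Rightarrow> real^3^3 \<Rightarrow> real" where
  "W_iso M e F =
     c1 M e * (det F powr (- 2 / 3) * frob F F - 3) +
     c2 M e * (det F powr (- 4 / 3) * frob (cof F) (cof F) - 3)"

definition quad_volume :: "'e discretization \<Rightarrow> 'e \<Rightarrow> real" where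
  "quad_volume M e = quad M e (\<lambda>\<xi>. det (geo_jac M e \<xi>))"

definition volume_change :: "'e discretization \<Rightarrow> 'e \<Rightarrow> (real^3 \<Rightarrow> real^3) \<Rightarrow> real" where
  "volume_change M e y = quad M e (\<lambda>\<xi>. det (jac M e y \<xi>) - det (geo_jac M e \<xi>))"

definition energy :: "'e discretization \<Rightarrow> (real^3 \<Rightarrow> real^3) \<Rightarrow> real" where
  "energy M y =
     (\<Sum>e\<in>cells M. quad M e (\<lambda>\<xi>. det (geo_jac M e \<xi>) * W_iso M e (defgrad M e y \<xi>))) +
     (\<Sum>e\<in>cells M. kappa M e / (2 * quad_volume M e) * (volume_change M e y)\<^sup>2)"

definition hessian :: "((real^3 \<Rightarrow> real^3) \<Rightarrow> real) \<Rightarrow> (real^3 \<Rightarrow> real^3) \<Rightarrow>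
    (real^3 \<Rightarrow> real^3) \<Rightarrow> (real^3 \<Rightarrow> real^3) \<Rightarrow> real" where
  "hessian E y u v =
     deriv (\<lambda>s. deriv (\<lambda>t. E (\<lambda>X. y X + s *\<^sub>R u X + t *\<^sub>R v X)) 0) 0"

definition tangent :: "'e discretization \<Rightarrow> (real^3 \<Rightarrow> real^3) \<Rightarrow>
    (real^3 \<Rightarrow> real^3) \<Rightarrow> (real^3 \<Rightarrow> real^3) \<Rightarrow> real" where
  "tangent M = hessian (energy M)"

text \<open>The functional is quadratic in the deformation, so the base point \<open>y\<close> of its Hessian is
  immaterial.\<close>

definition reference_form :: "'e discretization \<Rightarrow> (real^3 \<Rightarrow> real^3) \<Rightarrow> (real^3 \<Rightarrow> real^3) \<Rightarrow>
    (real^3 \<Rightarrow> real^3) \<Rightarrow> (real^3 \<Rightarrow> real^3) \<Rightarrow> real" where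
  "reference_form M z =
     hessian (\<lambda>y. \<Sum>e\<in>cells M. quad M e (\<lambda>\<xi>. frob (jac M e z \<xi>) (cof (jac M e y \<xi>))))"

definition lifted_tangent :: "'e discretization \<Rightarrow> (real^3 \<Rightarrow> real^3) \<Rightarrow> (real^3 \<Rightarrow> real^3) \<Rightarrow>
    (real^3 \<Rightarrow> real^3) \<Rightarrow> (real^3 \<Rightarrow> real^3) \<Rightarrow> real" where
  "lifted_tangent M z y u v = tangent M y u v + reference_form M z y u v"

section \<open>Boundary integrals and traces\<close>

text \<open>The unit vector \<open>\<nu>\<close> for which \<open>S\<close> is, to first order at \<open>x\<close>, the half-space
  \<open>(y - x) \<bullet> \<nu> < 0\<close>. There is at most one such vector, and it is the usual outward normal
  wherever the boundary is smooth.\<close>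

definition outward_normal :: "(real^3) set \<Rightarrow> real^3 \<Rightarrow> real^3" where
  "outward_normal S x = (THE \<nu>. norm \<nu> = 1 \<and>
     (\<forall>\<epsilon>>0. \<forall>\<^sub>F y in at x.
        ((y - x) \<bullet> \<nu> > \<epsilon> * norm (y - x) \<longrightarrow> y \<notin> S) \<and>
        ((y - x) \<bullet> \<nu> < - \<epsilon> * norm (y - x) \<longrightarrow> y \<in> S)))"

definition boundary_faces :: "'e discretization \<Rightarrow> ('e \<times> 3 \<times> real) set" where
  "boundary_faces M = {(e, k, s). e \<in> cells M \<and> s \<in> {-1, 1} \<and>
     geo M e ` cube_face {k} (\<lambda>_. s) \<subseteq> frontier (dom M)}"

definition face_point :: "3 \<Rightarrow> real \<Rightarrow> real \<times> real \<Rightarrow> real^3" where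
  "face_point k s q = (\<chi> i. if i = k then s else if i = k + 1 then fst q else snd q)"

text \<open>Surface integral over the boundary of the domain. The external faces are parametrized by
  the cell maps; the columns of the Jacobian are the two tangent vectors of the parametrization.\<close>

definition boundary_integral :: "'e discretization \<Rightarrow> (real^3 \<Rightarrow> real) \<Rightarrow> real" where
  "boundary_integral M g = (\<Sum>(e, k, s)\<in>boundary_faces M.
     integral (cbox (-1, -1) (1, 1)) (\<lambda>q.
       g (geo M e (face_point k s q)) *
       norm (cross3 (column (k + 1) (geo_jac M e (face_point k s q)))
                    (column (k + 2) (geo_jac M e (face_point k s q))))))"

definition boundary_functional ::
    "'e discretization \<Rightarrow> (real^3 \<Rightarrow> real^3) \<Rightarrow> (real^3 \<Rightarrow> real^3) \<Rightarrow> real" where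
  "boundary_functional M z y =
     boundary_integral M (\<lambda>X. z X \<bullet> (cof (grad M y X) *v outward_normal (dom M) X))"

text \<open>The traces of \<open>\<tau> 0, \<dots>, \<tau> (m - 1)\<close> form a basis of the space of boundary traces of
  variations, and \<open>R\<close> extracts the coordinates of a trace in this basis (\<open>m = 0\<close> is
  possible).\<close>

definition trace_extraction :: "'e discretization \<Rightarrow> nat \<Rightarrow> (nat \<Rightarrow> real^3 \<Rightarrow> real^3) \<Rightarrow>
    ((real^3 \<Rightarrow> real^3) \<Rightarrow> nat \<Rightarrow> real) \<Rightarrow> bool" where
  "trace_extraction M m \<tau> R \<longleftrightarrow>
     (\<forall>i<m. \<tau> i \<in> variations M) \<and>
     (\<forall>c. (\<forall>X\<in>frontier (dom M). (\<Sum>i<m. c i *\<^sub>R \<tau> i X) = 0) \<longrightarrow> (\<forall>i<m. c i = 0)) \<and>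
     (\<forall>u\<in>variations M. \<forall>X\<in>frontier (dom M). u X = (\<Sum>i<m. R u i *\<^sub>R \<tau> i X))"

text \<open>The bilinear form with matrix \<open>R\<^sup>T B R\<close>.\<close>

definition trace_form :: "nat \<Rightarrow> ((real^3 \<Rightarrow> real^3) \<Rightarrow> nat \<Rightarrow> real) \<Rightarrow> (nat \<Rightarrow> nat \<Rightarrow> real) \<Rightarrow>
    (real^3 \<Rightarrow> real^3) \<Rightarrow> (real^3 \<Rightarrow> real^3) \<Rightarrow> real" where
  "trace_form m R B u v = (\<Sum>i<m. \<Sum>j<m. R u i * B i j * R v j)"

text \<open>\<open>B\<close> does not depend on the deformation at which the Hessian is taken.\<close>

definition boundary_matrix :: "'e discretization \<Rightarrow> nat \<Rightarrow>
    ((real^3 \<Rightarrow> real^3) \<Rightarrow> nat \<Rightarrow> real) \<Rightarrow> (real^3 \<Rightarrow> real^3) \<Rightarrow> (nat \<Rightarrow> nat \<Rightarrow> real) \<Rightarrow> bool" where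
  "boundary_matrix M m R z B \<longleftrightarrow>
     (\<forall>i<m. \<forall>j<m. B i j = B j i) \<and>
     (\<forall>y\<in>conforming_fields M. \<forall>u\<in>variations M. \<forall>v\<in>variations M.
        hessian (boundary_functional M z) y u v = trace_form m R B u v)"

end

theory Submission
  imports Defs
begin

text \<open>Let \<open>H\<close> be the displacement gradient at a quadrature point. At the identity the isotropic
  energy contributes \<open>4 (c\<^sub>1 + c\<^sub>2) |dev sym H|\<^sup>2\<close> and the reference form \<open>4 c\<^sub>* tr cof H\<close>, both weighted
  with \<open>det J\<^sub>X\<close>; their sum dominates \<open>2 c\<^sub>* |H|\<^sup>2\<close>. The volumetric term is a nonnegative square
  because the volume change vanishes at the identity. With \<open>p + 1\<close> points the quadrature of
  \<open>|D\<^sub>\<xi> u|\<^sup>2\<close> is exact, and comparing \<open>|H|\<close> with \<open>|D\<^sub>\<xi> u|\<close> once at the nodes and once under the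
  integral costs the factor \<open>(a/b)\<^sup>5\<close>.

  In \<open>J\<^sub>z : (J\<^sub>u \<times> J\<^sub>v)\<close> every coordinate is differentiated exactly once in each term, so its degree
  in each coordinate is at most \<open>2p + 1\<close> and it is integrated exactly. By the Piola identity it is a
  divergence; the resulting face fluxes involve only tangential derivatives. They cancel on faces
  shared by two cells, which lie on opposite sides, and on the boundary they add up to the Hessian
  of the boundary functional, which therefore depends on the boundary traces alone.\<close>

section \<open>Gauss--Legendre quadrature\<close>

text \<open>The coercivity is pointwise. The isotropic second variation vanishes on infinitesimal
  rotations and dilations. Adding 4 c_* tr cof H to c_* \<open>dev_form H\<close> cancels its only
  indefinite term and leaves c_* (2/3 (tr H)^2 + 2 |H|^2); this is the origin of the factor 2 in the
  potential and of the constant 2 c_0. Since tr cof is a null Lagrangian, what was added can be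
  recovered from the boundary.

  The main obstacle is geometric. \<open>outward_normal\<close> and \<open>grad\<close> are limits
  relative to the whole domain, while \<open>conforming_mesh\<close> only says that the intersection
  of two cells is the image of a common face. The inverse function theorem on each cell shows that
  the cell is a half-space to first order at a point inside a face. Together with the exterior cones
  of a Lipschitz domain this settles on which side a neighbour lies, that neighbours pair off the
  interior faces, and that boundary faces have none. Everything else about faces is integration of
  polynomials, done monomial by monomial.\<close>

text \<open>Rolle with counting. The largest zero is split off, so the critical point found between
  the two largest zeros lies to the right of those from the induction hypothesis and is therefore
  new. The bounds by \<open>Min S\<close> and \<open>Max S\<close> are carried along to keep the
  zeros inside (-1, 1) later.\<close>

lemma pderiv_roots_between:
  fixes p :: "real poly"
  assumes "finite S" "card S = Suc m" "\<forall>x\<in>S. poly p x = 0"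
  shows "\<exists>T. finite T \<and> card T = m \<and> (\<forall>x\<in>T. poly (pderiv p) x = 0 \<and> Min S < x \<and> x < Max S)"
  using assms
proof (induction m arbitrary: S)
  case 0
  then show ?case by (intro exI[of _ "{}"]) auto
next
  case (Suc m)
  define S0 where "S0 = S - {Max S}"
  have ne: "S \<noteq> {}" using Suc.prems by auto
  have cS0: "card S0 = Suc m" and fS0: "finite S0"
    using Suc.prems ne by (auto simp: S0_def)
  have ne0: "S0 \<noteq> {}" using cS0 by auto
  obtain T0 where T0: "finite T0" "card T0 = m"
    "\<forall>x\<in>T0. poly (pderiv p) x = 0 \<and> Min S0 < x \<and> x < Max S0"
    using Suc.IH[OF fS0 cS0] Suc.prems by (auto simp: S0_def)
  have b: "Max S0 \<in> S0" using fS0 ne0 by simp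
  then have bM: "Max S0 < Max S" using Suc.prems(1)
    by (metis DiffE Max_ge S0_def insertI1 less_eq_real_def)
  have MS: "Max S \<in> S" using Suc.prems ne by simp
  obtain c where c: "Max S0 < c" "c < Max S" "poly p (Max S) - poly p (Max S0) = (Max S - Max S0) * poly (pderiv p) c"
    using poly_MVT[OF bM] by blast
  have pc: "poly (pderiv p) c = 0"
    using c(3) bM b MS Suc.prems(3) by (auto simp: S0_def)
  have min: "Min S \<le> Min S0" using ne0 Suc.prems(1) by (simp add: Min.subset_imp S0_def Min_antimono)
  have minmax: "Min S0 \<le> Max S0" using ne0 fS0 by simp
  show ?case
  proof (intro exI conjI)
    show "finite (insert c T0)" using T0 by simp
    have "c \<notin> T0" using T0(3) c(1) by auto
    then show "card (insert c T0) = Suc m" using T0 by simp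
    show "\<forall>x\<in>insert c T0. poly (pderiv p) x = 0 \<and> Min S < x \<and> x < Max S"
    proof (intro ballI)
      fix x assume "x \<in> insert c T0"
      then consider "x = c" | "x \<in> T0" by auto
      then show "poly (pderiv p) x = 0 \<and> Min S < x \<and> x < Max S"
      proof cases
        case 1 then show ?thesis using c pc min minmax by auto
      next
        case 2 then have "poly (pderiv p) x = 0" "Min S0 < x" "x < Max S0" using T0(3) by auto
        then show ?thesis using min bM by auto
      qed
    qed
  qed
qed

section \<open>Derivatives of (x^2 - 1)^n: zeros and orthogonality\<close>

lemma power_dvd_higher_pderiv:
  fixes p :: "real poly"
  shows "k \<le> n \<Longrightarrow> p ^ (n - k) dvd (pderiv ^^ k) (p ^ n)"
proof (induction k)
  case (Suc k)
  then obtain r where r: "(pderiv ^^ k) (p ^ n) = p ^ (n - k) * r" by (auto elim: dvdE)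
  have e: "n - k = Suc (n - Suc k)" using Suc.prems by simp
  have "pderiv (p ^ (n - k) * r) = p ^ (n - Suc k) * (p * pderiv r + r * smult (of_nat (n - k)) (pderiv p))"
    unfolding e pderiv_mult pderiv_power_Suc by (simp add: algebra_simps)
  then show ?case using r by simp
qed simp

text \<open>For k = n this is the Legendre polynomial up to its normalization. The intermediate
  derivatives are kept because both the location of the zeros and the orthogonality are proved by
  induction on k.\<close>

definition rodrigues :: "nat \<Rightarrow> nat \<Rightarrow> real poly" where
  "rodrigues n k = (pderiv ^^ k) ([:-1, 0, 1:] ^ n)"

lemma rodrigues_Suc: "rodrigues n (Suc k) = pderiv (rodrigues n k)"
  by (simp add: rodrigues_def)

lemma rodrigues_ends:
  assumes "k < n" shows "poly (rodrigues n k) 1 = 0" "poly (rodrigues n k) (-1) = 0"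
proof -
  have "[:-1, 0, 1:] ^ (n - k) dvd rodrigues n k"
    using power_dvd_higher_pderiv[of k n "[:-1,0,1:]"] assms by (simp add: rodrigues_def)
  then have d: "[:-1, 0, 1:] dvd rodrigues n k"
    using assms by (meson dvd_power dvd_trans zero_less_diff)
  then show "poly (rodrigues n k) 1 = 0" "poly (rodrigues n k) (-1) = 0"
    by (auto elim!: dvdE)
qed

lemma rodrigues_roots:
  "k \<le> n \<Longrightarrow> \<exists>S. finite S \<and> card S = k \<and> (\<forall>x\<in>S. poly (rodrigues n k) x = 0 \<and> -1 < x \<and> x < 1)"
proof (induction k)
  case 0 then show ?case by (intro exI[of _ "{}"]) auto
next
  case (Suc k)
  then obtain S where S: "finite S" "card S = k" "\<forall>x\<in>S. poly (rodrigues n k) x = 0 \<and> -1 < x \<and> x < 1"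
    by auto
  \<comment> \<open>As long as k < n the end points are still zeros, so k interior zeros become k +
    2 zeros and Rolle returns k + 1 interior ones.\<close>
  define S' where "S' = insert (-1) (insert 1 S)"
  have "1 \<notin> S" "-1 \<notin> S" using S(3) by auto
  then have "finite S'" "card S' = Suc (Suc k)" using S by (auto simp: S'_def)
  moreover have "\<forall>x\<in>S'. poly (rodrigues n k) x = 0"
    using S rodrigues_ends[of k n] Suc.prems by (auto simp: S'_def)
  moreover have "Min S' = -1"
    by (rule Min_eqI) (use S in \<open>auto simp: S'_def intro: less_imp_le\<close>)
  moreover have "Max S' = 1"
    by (rule Max_eqI) (use S in \<open>auto simp: S'_def intro: less_imp_le\<close>)
  ultimately show ?case using pderiv_roots_between[of S' "Suc k" "rodrigues n k"]
    by (auto simp: rodrigues_Suc)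
qed

definition poly_int :: "real poly \<Rightarrow> real" where
  "poly_int p = integral {-1..1} (poly p)"

lemma poly_integrable: "poly p integrable_on {-1..1::real}"
  by (intro integrable_continuous_real continuous_intros)

lemma poly_int_add: "poly_int (p + q) = poly_int p + poly_int q"
proof -
  have "poly (p + q) = (\<lambda>t. poly p t + poly q t)" by (simp add: fun_eq_iff)
  then show ?thesis by (simp add: poly_int_def integral_add poly_integrable)
qed

lemma poly_int_smult: "poly_int (smult c p) = c * poly_int p"
proof -
  have "poly (smult c p) = (\<lambda>t. c * poly p t)" by (simp add: fun_eq_iff)
  then show ?thesis by (simp add: poly_int_def)
qed

lemma poly_int_0 [simp]: "poly_int 0 = 0"
  by (simp add: poly_int_def poly_0[abs_def])

lemma poly_int_sum: "poly_int (sum f A) = (\<Sum>x\<in>A. poly_int (f x))"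
proof (induction A rule: infinite_finite_induct)
  case (insert x F) then show ?case by (simp add: poly_int_add)
qed simp_all

lemma poly_int_pderiv: "poly_int (pderiv p) = poly p 1 - poly p (-1)"
proof -
  have "(poly (pderiv p) has_integral (poly p 1 - poly p (-1))) {-1..1}"
    by (rule fundamental_theorem_of_calculus)
       (auto intro!: DERIV_subset[OF poly_DERIV] simp flip: has_real_derivative_iff_has_vector_derivative)
  then show ?thesis unfolding poly_int_def by (rule integral_unique)
qed

text \<open>Repeated integration by parts: the boundary terms vanish by
  \<open>rodrigues_ends\<close>, and each step lowers both k and the degree of r by one until r has
  been differentiated away.\<close>

lemma rodrigues_orthogonal:
  assumes "k \<le> n" "degree r < k" shows "poly_int (rodrigues n k * r) = 0"
  using assms
proof (induction k arbitrary: r)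
  case (Suc k)
  have "rodrigues n (Suc k) * r = pderiv (rodrigues n k * r) + smult (-1) (rodrigues n k * pderiv r)"
    by (simp add: rodrigues_Suc pderiv_mult algebra_simps)
  then have "poly_int (rodrigues n (Suc k) * r) = poly_int (pderiv (rodrigues n k * r)) + (-1) * poly_int (rodrigues n k * pderiv r)"
    by (simp only: poly_int_add poly_int_smult)
  also have "poly_int (pderiv (rodrigues n k * r)) = 0"
    using Suc.prems rodrigues_ends[of k n] by (simp only: poly_int_pderiv) simp
  also have "poly_int (rodrigues n k * pderiv r) = 0"
  proof (cases "pderiv r = 0")
    case False
    then have "degree (pderiv r) < k"
      using Suc.prems by (simp add: degree_pderiv pderiv_eq_0_iff)
    then show ?thesis using Suc.IH[of "pderiv r"] Suc.prems by (simp del: poly_mult)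
  qed simp
  finally show ?case by simp
qed simp

lemma degree_rodrigues: "degree (rodrigues n n) = n"
proof -
  have "degree ([:-1, 0, 1:] ^ n :: real poly) = 2 * n"
    by (simp add: degree_power_eq)
  then show ?thesis by (simp add: rodrigues_def degree_higher_pderiv)
qed

lemma gauss_nodes_rodrigues: "gauss_nodes n = {x. poly (rodrigues n n) x = 0}"
  by (auto simp: gauss_nodes_def legendre_def rodrigues_def)

text \<open>Rolle provides n distinct zeros inside the interval, and the degree permits no
  more.\<close>

lemma gauss_nodes_basic:
  assumes "n > 0"
  shows "finite (gauss_nodes n)" "card (gauss_nodes n) = n" "gauss_nodes n \<subseteq> {-1<..<1}"
proof -
  obtain S where S: "finite S" "card S = n" "\<forall>x\<in>S. poly (rodrigues n n) x = 0 \<and> -1 < x \<and> x < 1"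
    using rodrigues_roots[of n n] by auto
  have nz: "rodrigues n n \<noteq> 0" using degree_rodrigues[of n] assms by auto
  show f: "finite (gauss_nodes n)" unfolding gauss_nodes_rodrigues using nz by (rule poly_roots_finite)
  have sub: "S \<subseteq> gauss_nodes n" using S by (auto simp: gauss_nodes_rodrigues)
  have "card (gauss_nodes n) \<le> n"
    using card_poly_roots_bound[OF nz] degree_rodrigues[of n] by (simp add: gauss_nodes_rodrigues)
  then have "gauss_nodes n = S" using sub S f by (metis card_seteq)
  then show "card (gauss_nodes n) = n" "gauss_nodes n \<subseteq> {-1<..<1}" using S by auto
qed

section \<open>Interpolation at the Gauss nodes\<close>

definition lagrange :: "nat \<Rightarrow> real \<Rightarrow> real poly" where
  "lagrange n x = (\<Prod>y\<in>gauss_nodes n - {x}. smult (1 / (x - y)) [:-y, 1:])"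

lemma poly_lagrange: "poly (lagrange n x) t = (\<Prod>y\<in>gauss_nodes n - {x}. (t - y) / (x - y))"
  by (simp add: lagrange_def poly_prod diff_divide_distrib)

lemma gauss_weight_lagrange: "gauss_weight n x = poly_int (lagrange n x)"
  by (simp add: gauss_weight_def poly_int_def poly_lagrange[abs_def])

lemma degree_lagrange:
  assumes "n > 0" "x \<in> gauss_nodes n" shows "degree (lagrange n x) < n"
proof -
  have "degree (lagrange n x) \<le> (\<Sum>y\<in>gauss_nodes n - {x}. degree (smult (1 / (x - y)) [:-y, 1:]))"
    unfolding lagrange_def using gauss_nodes_basic[OF assms(1)]
    by (intro order.trans[OF degree_prod_sum_le]) (auto simp: o_def)
  also have "\<dots> \<le> (\<Sum>y\<in>gauss_nodes n - {x}. 1)"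
    by (intro sum_mono) auto
  also have "\<dots> < n" using gauss_nodes_basic[OF assms(1)] assms by simp
  finally show ?thesis .
qed

lemma lagrange_node:
  assumes "n > 0" "x \<in> gauss_nodes n" "t \<in> gauss_nodes n"
  shows "poly (lagrange n x) t = (if t = x then 1 else 0)"
  using gauss_nodes_basic[OF assms(1)] assms by (auto simp: poly_lagrange)

text \<open>Divide p by the Legendre polynomial. The multiple of it integrates to 0 by orthogonality
  and vanishes at every node; the remainder has degree below n and so equals its own interpolant,
  whose integral is the quadrature sum.\<close>

lemma gauss_exact:
  assumes "n > 0" "degree p \<le> 2 * n - 1"
  shows "(\<Sum>x\<in>gauss_nodes n. gauss_weight n x * poly p x) = poly_int p"
proof -
  let ?L = "rodrigues n n"
  note gn = gauss_nodes_basic[OF assms(1)]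
  have nz: "?L \<noteq> 0" using degree_rodrigues[of n] assms(1) by auto
  define d r where "d = p div ?L" and "r = p mod ?L"
  have p: "p = ?L * d + r" by (simp add: d_def r_def)
  have dr: "degree r < n"
    using degree_mod_less[OF nz, of p] degree_rodrigues[of n] assms(1) by (auto simp: r_def)
  have dd: "degree d < n"
  proof (cases "d = 0")
    case False
    then have "degree (?L * d) = n + degree d" using nz by (simp add: degree_mult_eq degree_rodrigues)
    moreover have "degree (?L * d) \<le> 2 * n - 1"
    proof -
      have "?L * d = p - r" using p by simp
      then show ?thesis using degree_diff_le_max[of p r] assms dr by simp
    qed
    ultimately show ?thesis using assms(1) by simp
  qed (use assms in auto)
  have "poly_int p = poly_int (?L * d) + poly_int r" by (simp only: p poly_int_add)
  then have I: "poly_int p = poly_int r" using rodrigues_orthogonal[of n n d] dd by simp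
  have pr: "poly p x = poly r x" if "x \<in> gauss_nodes n" for x
    using that by (simp add: p gauss_nodes_rodrigues)
  define l where "l = (\<Sum>x\<in>gauss_nodes n. smult (poly r x) (lagrange n x))"
  have dl: "degree l < n" unfolding l_def using assms(1) degree_lagrange[OF assms(1)]
    by (intro degree_sum_less) (auto intro: le_less_trans[OF degree_smult_le])
  have "r = l"
  proof (rule poly_eqI_degree[of "gauss_nodes n"])
    fix t assume t: "t \<in> gauss_nodes n"
    have "poly l t = (\<Sum>x\<in>gauss_nodes n. if x = t then poly r x else 0)"
      unfolding l_def poly_sum poly_smult
      by (intro sum.cong) (auto simp: lagrange_node[OF assms(1) _ t])
    then show "poly r t = poly l t" using t gn by simp
  qed (use gn dl dr in auto)
  then have "poly_int r = (\<Sum>x\<in>gauss_nodes n. poly r x * gauss_weight n x)"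
    by (rule trans[OF arg_cong]) (simp only: l_def poly_int_sum poly_int_smult gauss_weight_lagrange)
  then show ?thesis using I pr by (simp add: mult.commute)
qed

text \<open>The square of a cardinal polynomial has degree at most 2n - 2, so the rule is exact for
  it and the sum reduces to the single weight.\<close>

lemma gauss_weight_nonneg:
  assumes "n > 0" "x \<in> gauss_nodes n" shows "gauss_weight n x \<ge> 0"
proof -
  note gn = gauss_nodes_basic[OF assms(1)]
  let ?p = "lagrange n x * lagrange n x"
  have "degree ?p \<le> 2 * n - 1"
    using degree_mult_le[of "lagrange n x" "lagrange n x"] degree_lagrange[OF assms] by simp
  then have "(\<Sum>t\<in>gauss_nodes n. gauss_weight n t * poly ?p t) = poly_int ?p"
    by (rule gauss_exact[OF assms(1)])
  moreover have "(\<Sum>t\<in>gauss_nodes n. gauss_weight n t * poly ?p t) = (\<Sum>t\<in>gauss_nodes n. if t = x then gauss_weight n t else 0)"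
    by (intro sum.cong) (auto simp: lagrange_node[OF assms])
  moreover have "poly_int ?p \<ge> 0" unfolding poly_int_def by (intro integral_nonneg poly_integrable) auto
  ultimately show ?thesis using gn assms by simp
qed

section \<open>Polynomials on the parent cube\<close>

lemma distinct_3_cyclic: "k + 1 \<noteq> (k::3)" "k + 2 \<noteq> k" "k + 1 \<noteq> k + 2"
  by simp_all

text \<open>Naming the coordinates relative to k lets one argument serve for all three face
  directions, in the same cyclic order as in \<open>cof\<close>.\<close>

lemma UNIV_3_cyclic: "UNIV = {k, k + 1, k + 2 :: 3}"
  by (rule card_subset_eq[symmetric]) simp_all

lemma prod_3_cyclic: "prod f UNIV = f (k::3) * f (k + 1) * (f (k + 2) :: 'a::comm_monoid_mult)"
  unfolding UNIV_3_cyclic[of k] using distinct_3_cyclic[of k] by (simp add: ac_simps)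

definition monom3 :: "(3 \<Rightarrow> nat) \<Rightarrow> real^3 \<Rightarrow> real" where
  "monom3 \<alpha> \<xi> = (\<Prod>i\<in>UNIV. (\<xi> $ i) ^ \<alpha> i)"

text \<open>The degree bound is kept separately for each coordinate because a derivative lowers only
  one of the three; the exactness count for the mixed integrand lives on this. With just monomials
  and sums as generators, every linear identity has to be checked on monomials only.\<close>

inductive_set tpol :: "(3 \<Rightarrow> nat) \<Rightarrow> (real^3 \<Rightarrow> real) set" for d where
  tpol_monom: "\<alpha> \<le> d \<Longrightarrow> (\<lambda>\<xi>. c * monom3 \<alpha> \<xi>) \<in> tpol d"
| tpol_add: "f \<in> tpol d \<Longrightarrow> g \<in> tpol d \<Longrightarrow> (\<lambda>\<xi>. f \<xi> + g \<xi>) \<in> tpol d"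

lemma tpol_const: "(\<lambda>_. c) \<in> tpol d"
  using tpol_monom[of "\<lambda>_. 0" d c] by (simp add: monom3_def le_fun_def)

lemma tpol_mono: "f \<in> tpol d \<Longrightarrow> d \<le> d' \<Longrightarrow> f \<in> tpol d'"
  by (induction rule: tpol.induct) (auto intro: tpol_monom tpol_add order.trans)

lemma tpol_scale: "f \<in> tpol d \<Longrightarrow> (\<lambda>\<xi>. c * f \<xi>) \<in> tpol d"
proof (induction rule: tpol.induct)
  case (tpol_monom \<alpha> c')
  then show ?case using tpol.tpol_monom[of \<alpha> d "c * c'"] by (simp add: mult.assoc)
next
  case (tpol_add f g)
  then show ?case using tpol.tpol_add[of "\<lambda>\<xi>. c * f \<xi>" d "\<lambda>\<xi>. c * g \<xi>"] by (simp add: distrib_left)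
qed

lemma tpol_diff: "f \<in> tpol d \<Longrightarrow> g \<in> tpol d \<Longrightarrow> (\<lambda>\<xi>. f \<xi> - g \<xi>) \<in> tpol d"
  using tpol_add[of f d "\<lambda>\<xi>. (-1) * g \<xi>"] tpol_scale[of g d "-1"] by simp

lemma tpol_sum: "(\<And>x. x \<in> A \<Longrightarrow> f x \<in> tpol d) \<Longrightarrow> (\<lambda>\<xi>. \<Sum>x\<in>A. f x \<xi>) \<in> tpol d"
  by (induction A rule: infinite_finite_induct) (auto intro: tpol_add tpol_const)

lemma monom3_mult: "monom3 \<alpha> \<xi> * monom3 \<beta> \<xi> = monom3 (\<lambda>i. \<alpha> i + \<beta> i) \<xi>"
  by (simp add: monom3_def power_add prod.distrib)

lemma tpol_mult: "f \<in> tpol d \<Longrightarrow> g \<in> tpol d' \<Longrightarrow> (\<lambda>\<xi>. f \<xi> * g \<xi>) \<in> tpol (\<lambda>i. d i + d' i)"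
proof (induction rule: tpol.induct)
  case (tpol_monom \<alpha> c)
  note \<alpha> = tpol_monom(1)
  from \<open>g \<in> tpol d'\<close> show ?case
  proof (induction rule: tpol.induct)
    case (tpol_monom \<beta> c')
    have "(\<lambda>i. \<alpha> i + \<beta> i) \<le> (\<lambda>i. d i + d' i)" using \<alpha> tpol_monom by (simp add: le_fun_def add_mono)
    from tpol.tpol_monom[OF this, of "c * c'"] show ?case
      by (simp add: monom3_mult[symmetric] algebra_simps)
  next
    case (tpol_add f' g')
    then show ?case using tpol.tpol_add by (simp add: distrib_left)
  qed
next
  case (tpol_add f' g')
  then show ?case using tpol.tpol_add by (simp add: distrib_right)
qed

lemma monom3_split: "monom3 \<alpha> \<xi> = (\<xi> $ k) ^ \<alpha> k * (\<Prod>i\<in>UNIV - {k}. (\<xi> $ i) ^ \<alpha> i)"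
  unfolding monom3_def by (rule prod.remove) auto

lemma monom3_upd: "monom3 (\<alpha>(k := m)) \<xi> = (\<xi> $ k) ^ m * (\<Prod>i\<in>UNIV - {k}. (\<xi> $ i) ^ \<alpha> i)"
  unfolding monom3_split[of _ _ k] by simp

text \<open>An unrestricted derivative, in contrast to \<open>parent_jac\<close>: members of
  \<open>tpol\<close> are polynomials on the whole space, so no boundary of the cube
  interferes.\<close>

definition pd :: "3 \<Rightarrow> (real^3 \<Rightarrow> real) \<Rightarrow> real^3 \<Rightarrow> real" where
  "pd k f \<xi> = frechet_derivative f (at \<xi>) (axis k 1)"

lemma pd_eqI:
  assumes "(f has_derivative (\<lambda>h. \<Sum>k\<in>UNIV. h $ k * D k)) (at \<xi>)"
  shows "pd k f \<xi> = D k"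
proof -
  have "frechet_derivative f (at \<xi>) = (\<lambda>h. \<Sum>k\<in>UNIV. h $ k * D k)"
    using frechet_derivative_at[OF assms] by simp
  then have "pd k f \<xi> = (\<Sum>j\<in>UNIV. axis k 1 $ j * D j)" by (simp add: pd_def)
  also have "\<dots> = (\<Sum>j\<in>UNIV. if j = k then D j else 0)"
    by (intro sum.cong) (auto simp: axis_def)
  finally show ?thesis by simp
qed

text \<open>For \<alpha> k = 0 the truncated exponent \<alpha> k - 1 is harmless, since the factor
  \<alpha> k in front is 0.\<close>

lemma monom3_has_derivative:
  "((\<lambda>\<xi>. c * monom3 \<alpha> \<xi>) has_derivative
     (\<lambda>h. \<Sum>k\<in>UNIV. h $ k * (c * \<alpha> k * monom3 (\<alpha>(k := \<alpha> k - 1)) \<xi>))) (at \<xi>)"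
proof -
  have "((\<lambda>\<xi>. c * monom3 \<alpha> \<xi>) has_derivative
     (\<lambda>h. c * (\<Sum>k\<in>UNIV. (\<alpha> k * (h $ k) * (\<xi> $ k) ^ (\<alpha> k - 1)) * (\<Prod>i\<in>UNIV - {k}. (\<xi> $ i) ^ \<alpha> i)))) (at \<xi>)"
    unfolding monom3_def
    by (intro has_derivative_mult_right has_derivative_prod)
       (auto intro!: derivative_eq_intros bounded_linear_vec_nth bounded_linear_imp_has_derivative)
  moreover have "(\<lambda>h::real^3. c * (\<Sum>k\<in>UNIV. (\<alpha> k * (h $ k) * (\<xi> $ k) ^ (\<alpha> k - 1)) * (\<Prod>i\<in>UNIV - {k}. (\<xi> $ i) ^ \<alpha> i)))
     = (\<lambda>h. \<Sum>k\<in>UNIV. h $ k * (c * \<alpha> k * monom3 (\<alpha>(k := \<alpha> k - 1)) \<xi>))"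
    by (simp add: monom3_upd sum_distrib_left algebra_simps)
  ultimately show ?thesis by simp
qed

lemma pd_monom3: "pd k (\<lambda>\<xi>. c * monom3 \<alpha> \<xi>) = (\<lambda>\<xi>. c * \<alpha> k * monom3 (\<alpha>(k := \<alpha> k - 1)) \<xi>)"
  by (rule ext, rule pd_eqI, rule monom3_has_derivative)

lemma has_derivative_pd_add:
  assumes "(f has_derivative (\<lambda>h. \<Sum>k\<in>UNIV. h $ k * pd k f \<xi>)) (at \<xi>)"
    "(g has_derivative (\<lambda>h. \<Sum>k\<in>UNIV. h $ k * pd k g \<xi>)) (at \<xi>)"
  shows "((\<lambda>\<xi>. f \<xi> + g \<xi>) has_derivative (\<lambda>h. \<Sum>k\<in>UNIV. h $ k * (pd k f \<xi> + pd k g \<xi>))) (at \<xi>)"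
  using has_derivative_add[OF assms] by (simp add: sum.distrib distrib_left)

lemma tpol_derivative:
  "f \<in> tpol d \<Longrightarrow> (f has_derivative (\<lambda>h. \<Sum>k\<in>UNIV. h $ k * pd k f \<xi>)) (at \<xi>)"
proof (induction rule: tpol.induct)
  case (tpol_monom \<alpha> c)
  show ?case unfolding pd_monom3 by (rule monom3_has_derivative)
next
  case (tpol_add f g)
  note h = has_derivative_pd_add[OF tpol_add.IH]
  show ?case using h unfolding pd_eqI[OF h] .
qed

lemma pd_add: "f \<in> tpol d \<Longrightarrow> g \<in> tpol d' \<Longrightarrow> pd k (\<lambda>\<xi>. f \<xi> + g \<xi>) = (\<lambda>\<xi>. pd k f \<xi> + pd k g \<xi>)"
  by (rule ext, rule pd_eqI, rule has_derivative_pd_add) (auto intro: tpol_derivative)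

lemma pd_diff:
  assumes "f \<in> tpol d" "g \<in> tpol d'"
  shows "pd k (\<lambda>\<xi>. f \<xi> - g \<xi>) = (\<lambda>\<xi>. pd k f \<xi> - pd k g \<xi>)"
proof (rule ext, rule pd_eqI)
  fix \<xi>
  show "((\<lambda>\<xi>. f \<xi> - g \<xi>) has_derivative (\<lambda>h. \<Sum>k\<in>UNIV. h $ k * (pd k f \<xi> - pd k g \<xi>))) (at \<xi>)"
    using has_derivative_diff[OF tpol_derivative[OF assms(1)] tpol_derivative[OF assms(2)]]
    by (simp add: sum_subtractf right_diff_distrib)
qed

lemma pd_mult:
  assumes "f \<in> tpol d" "g \<in> tpol d'"
  shows "pd k (\<lambda>\<xi>. f \<xi> * g \<xi>) = (\<lambda>\<xi>. f \<xi> * pd k g \<xi> + pd k f \<xi> * g \<xi>)"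
proof (rule ext, rule pd_eqI)
  fix \<xi>
  show "((\<lambda>\<xi>. f \<xi> * g \<xi>) has_derivative (\<lambda>h. \<Sum>k\<in>UNIV. h $ k * (f \<xi> * pd k g \<xi> + pd k f \<xi> * g \<xi>))) (at \<xi>)"
    using has_derivative_mult[OF tpol_derivative[OF assms(1)] tpol_derivative[OF assms(2)]]
    by (simp add: sum.distrib distrib_left sum_distrib_left sum_distrib_right algebra_simps)
qed

lemma tpol_pd: "f \<in> tpol d \<Longrightarrow> pd k f \<in> tpol (d(k := d k - 1))"
proof (induction rule: tpol.induct)
  case (tpol_monom \<alpha> c)
  then show ?case unfolding pd_monom3
    by (intro tpol.tpol_monom) (auto simp: le_fun_def diff_le_mono)
next
  case (tpol_add f g)
  then show ?case using tpol.tpol_add by (simp add: pd_add)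
qed

lemma tpol_pd': "f \<in> tpol d \<Longrightarrow> pd k f \<in> tpol d"
  by (rule tpol_mono[OF tpol_pd]) (auto simp: le_fun_def)

lemma pd_commute: "f \<in> tpol d \<Longrightarrow> pd j (pd k f) = pd k (pd j f)"
proof (induction rule: tpol.induct)
  case (tpol_monom \<alpha> c)
  show ?case
  proof (cases "j = k")
    case False
    then have "(\<alpha>(k := \<alpha> k - 1))(j := \<alpha> j - 1) = (\<alpha>(j := \<alpha> j - 1))(k := \<alpha> k - 1)"
      by (auto simp: fun_eq_iff)
    then show ?thesis unfolding pd_monom3 using False by (simp del: fun_upd_apply add: fun_upd_same fun_upd_other mult.assoc mult.left_commute[of "real (\<alpha> k)"])
  qed simp
next
  case (tpol_add f g)
  then show ?case by (simp add: pd_add[OF tpol_pd' tpol_pd'] pd_add)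
qed

lemma tpol_continuous: "f \<in> tpol d \<Longrightarrow> continuous_on S f"
  by (meson tpol_derivative continuous_at_imp_continuous_on has_derivative_continuous)

subsection \<open>Integrals over the cube and its faces\<close>

lemma cube_cbox: "cube = cbox (vec (-1)) (vec 1)"
  by (auto simp: cube_def mem_box_cart abs_le_iff minus_le_iff)

abbreviation ocube :: "(real^3) set" where "ocube \<equiv> box (vec (-1)) (vec 1)"

lemma ocube_iff: "\<xi> \<in> ocube \<longleftrightarrow> (\<forall>i. \<bar>\<xi> $ i\<bar> < 1)"
  by (auto simp: mem_box_cart abs_less_iff minus_less_iff)

text \<open>Fubini for a product of three one-dimensional factors, through the representation of
  \<open>lborel\<close> as an image of a product measure indexed by \<open>Basis\<close>.\<close>

lemma integral_cube_prod:
  fixes g :: "3 \<Rightarrow> real \<Rightarrow> real"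
  assumes "\<And>i. continuous_on UNIV (g i)"
  shows "integral cube (\<lambda>\<xi>. \<Prod>i\<in>UNIV. g i (\<xi> $ i)) = (\<Prod>i\<in>UNIV. integral {-1..1} (g i))"
proof -
  interpret product_sigma_finite "\<lambda>_::real^3. lborel :: real measure" by standard
  define G where "G i t = indicator {-1..1} t * g i t" for i t
  have Bi: "(Basis :: (real^3) set) = range (\<lambda>i. axis i 1)" by (auto simp: Basis_vec_def)
  have inj: "inj (\<lambda>i::3. axis i (1::real))" by (auto simp: inj_on_def axis_eq_axis)
  \<comment> \<open>The product measure is indexed by basis vectors, the factors by coordinates;
    \<open>ix\<close> translates back.\<close>
  define ix :: "real^3 \<Rightarrow> 3" where "ix b = (THE i. b = axis i 1)" for b
  have ix: "ix (axis i 1) = i" for i by (auto simp: ix_def axis_eq_axis)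
  have int1: "integrable lborel (G i)" and I1: "integral\<^sup>L lborel (G i) = integral {-1..1} (g i)" for i
  proof -
    have "set_integrable lborel {-1..1} (g i)"
      unfolding set_integrable_def
      by (rule borel_integrable_compact[OF compact_Icc continuous_on_subset[OF assms]]) simp
    then show "integrable lborel (G i)" "integral\<^sup>L lborel (G i) = integral {-1..1} (g i)"
      using set_borel_integral_eq_integral[of "{-1..1}" "g i"]
      by (simp_all add: G_def[abs_def] set_integrable_def set_lebesgue_integral_def)
  qed
  have comp: "(\<Sum>b\<in>Basis. f b *\<^sub>R b) $ i = f (axis i 1)" for f :: "real^3 \<Rightarrow> real" and i
  proof -
    have "axis i 1 \<in> (Basis :: (real^3) set)" by (auto simp: Basis_vec_def)
    then have "(\<Sum>b\<in>Basis. f b *\<^sub>R b) \<bullet> axis i 1 = f (axis i 1)"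
      by (rule inner_sum_left_Basis)
    then show ?thesis by (simp add: inner_axis)
  qed
  have gm[measurable]: "g i \<in> borel_measurable borel" for i
    by (intro borel_measurable_continuous_onI assms)
  have set_int: "set_integrable lborel cube (\<lambda>\<xi>. \<Prod>i\<in>UNIV. g i (\<xi> $ i))"
  proof -
    have "continuous_on cube (\<lambda>\<xi>::real^3. \<Prod>i\<in>UNIV. g i (\<xi> $ i))"
      by (intro continuous_intros continuous_on_compose2[OF assms]) auto
    then show ?thesis unfolding set_integrable_def cube_cbox
      by (rule borel_integrable_compact[OF compact_cbox])
  qed
  have "integral cube (\<lambda>\<xi>. \<Prod>i\<in>UNIV. g i (\<xi> $ i)) = (LINT \<xi>|lborel. indicator cube \<xi> * (\<Prod>i\<in>UNIV. g i (\<xi> $ i)))"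
    using set_borel_integral_eq_integral(2)[OF set_int] by (simp add: set_lebesgue_integral_def)
  also have "\<dots> = (LINT \<xi>|lborel. (\<Prod>i\<in>UNIV. G i (\<xi> $ i)))"
  proof (rule Bochner_Integration.integral_cong)
    fix \<xi> :: "real^3"
    have "(\<Prod>i\<in>UNIV. indicator {-1..1} (\<xi> $ i) :: real) = indicator cube \<xi>"
    proof (cases "\<xi> \<in> cube")
      case True
      then have "indicator {-1..1} (\<xi> $ i) = (1::real)" for i
        by (auto simp: cube_def indicator_def abs_le_iff)
      then show ?thesis using True by simp
    next
      case False
      then obtain i where "\<xi> $ i \<notin> {-1..1}"
        by (auto simp: cube_def indicator_def abs_le_iff)
      then have "(\<Prod>i\<in>UNIV. indicator {-1..1} (\<xi> $ i) :: real) = 0"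
        by (intro prod_zero) (auto intro!: exI[of _ i])
      then show ?thesis using False by simp
    qed
    then show "indicator cube \<xi> * (\<Prod>i\<in>UNIV. g i (\<xi> $ i)) = (\<Prod>i\<in>UNIV. G i (\<xi> $ i))"
      by (simp add: G_def prod.distrib)
  qed simp
  also have "\<dots> = (LINT f|(\<Pi>\<^sub>M b\<in>Basis. lborel). (\<Prod>i\<in>UNIV. G i ((\<Sum>b\<in>Basis. f b *\<^sub>R b :: real^3) $ i)))"
    by (subst lborel_eq, subst integral_distr) (simp_all add: G_def)
  also have "\<dots> = (LINT f|(\<Pi>\<^sub>M b\<in>Basis. lborel). (\<Prod>b\<in>Basis. G (ix b) (f b)))"
  proof -
    have "(\<Prod>b\<in>Basis. G (ix b) (f b)) = (\<Prod>i\<in>UNIV. G i (f (axis i 1)))" for f :: "real^3 \<Rightarrow> real"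
      unfolding Bi by (subst prod.reindex[OF inj]) (simp add: ix)
    then show ?thesis by (simp only: comp)
  qed
  also have "\<dots> = (\<Prod>b\<in>(Basis::(real^3) set). integral\<^sup>L lborel (G (ix b)))"
    by (rule product_integral_prod) (auto intro: int1)
  also have "\<dots> = (\<Prod>i\<in>UNIV. integral {-1..1} (g i))"
    unfolding Bi by (subst prod.reindex[OF inj]) (simp add: ix I1)
  finally show ?thesis .
qed

section \<open>Moments, and integrals of polynomials over the cube and its faces\<close>

definition moment :: "nat \<Rightarrow> real" where "moment m = integral {-1..1} (\<lambda>t. t ^ m)"

lemma moment_poly: "moment m = poly_int (monom 1 m)"
  by (simp add: moment_def poly_int_def poly_monom[abs_def])

lemma moment_Suc: "Suc m * moment m = 1 - (-1) ^ Suc m"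
proof -
  have "poly_int (pderiv (monom 1 (Suc m))) = 1 - (-1) ^ Suc m"
    by (simp add: poly_int_pderiv poly_monom)
  moreover have "pderiv (monom (1::real) (Suc m)) = smult (Suc m) (monom 1 m)"
    by (simp add: pderiv_monom smult_monom)
  ultimately show ?thesis by (simp add: poly_int_smult moment_poly)
qed

lemma moment_0 [simp]: "moment 0 = 2" using moment_Suc[of 0] by simp

text \<open>Odd moments vanish, so reflecting a coordinate cannot be seen in an integral over the
  symmetric interval.\<close>

lemma moment_sign: assumes "\<bar>s::real\<bar> = 1" shows "s ^ m * moment m = moment m"
proof (cases "even m")
  case True then have "s ^ m = 1" using assms by (metis power_even_abs power_one)
  then show ?thesis by simp
next
  case False then have "moment m = 0" using moment_Suc[of m] by simp
  then show ?thesis by simp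
qed

lemma integral_monom3: "integral cube (\<lambda>\<xi>. c * monom3 \<alpha> \<xi>) = c * (\<Prod>i\<in>UNIV. moment (\<alpha> i))"
  using integral_cube_prod[of "\<lambda>i t. t ^ \<alpha> i"]
  by (simp add: monom3_def moment_def continuous_on_power)

lemma cube_integrable: "continuous_on cube f \<Longrightarrow> f integrable_on cube" for f :: "real^3 \<Rightarrow> real"
  unfolding cube_cbox by (rule integrable_continuous)

lemma tpol_integrable: "f \<in> tpol d \<Longrightarrow> f integrable_on cube"
  by (intro cube_integrable tpol_continuous)

definition face_proj :: "3 \<Rightarrow> real \<Rightarrow> real^3 \<Rightarrow> real^3" where
  "face_proj k s \<xi> = (\<chi> i. if i = k then s else \<xi> $ i)"

lemma face_proj_continuous: "continuous_on S (face_proj k s)"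
proof -
  have "continuous_on S (\<lambda>\<xi>. if i = k then s else \<xi> $ i)" for i
    by (cases "i = k") (auto intro: continuous_intros)
  then show ?thesis unfolding face_proj_def by (intro continuous_on_vec_lambda) 
qed

lemma tpol_face_continuous: "f \<in> tpol d \<Longrightarrow> continuous_on S (\<lambda>\<xi>. f (face_proj k s \<xi>))"
  by (rule continuous_on_compose2[OF tpol_continuous[of f d UNIV] face_proj_continuous]) auto

lemma monom3_face: "monom3 \<alpha> (face_proj k s \<xi>) = s ^ \<alpha> k * monom3 (\<alpha>(k := 0)) \<xi>"
  unfolding monom3_split[of _ _ k] by (simp add: face_proj_def cong: prod.cong_simp)

lemma integral_face_monom3:
  "integral cube (\<lambda>\<xi>. c * monom3 \<alpha> (face_proj k s \<xi>)) = 2 * c * s ^ \<alpha> k * (\<Prod>i\<in>UNIV - {k}. moment (\<alpha> i))"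
proof -
  have "(\<Prod>i\<in>UNIV. moment ((\<alpha>(k := 0)) i)) = 2 * (\<Prod>i\<in>UNIV - {k}. moment (\<alpha> i))"
    by (subst prod.remove[of _ k]) auto
  then show ?thesis
    using integral_monom3[of "c * s ^ \<alpha> k" "\<alpha>(k := 0)"] by (simp add: monom3_face mult_ac)
qed

text \<open>Averaging over the cube instead of integrating over the two-dimensional face keeps all integrals
  on one domain; the factor 2 is the length of the discarded edge.\<close>

lemma integral_cube_pd:
  assumes "f \<in> tpol d"
  shows "2 * integral cube (pd k f) =
    integral cube (\<lambda>\<xi>. f (face_proj k 1 \<xi>)) - integral cube (\<lambda>\<xi>. f (face_proj k (-1) \<xi>))"
  using assms
proof (induction rule: tpol.induct)
  case (tpol_monom \<alpha> c)
  have "(\<Prod>i\<in>UNIV. moment ((\<alpha>(k := \<alpha> k - 1)) i)) = moment (\<alpha> k - 1) * (\<Prod>i\<in>UNIV - {k}. moment (\<alpha> i))"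
    by (subst prod.remove[of _ k]) auto
  moreover have "\<alpha> k * moment (\<alpha> k - 1) = 1 - (-1) ^ \<alpha> k"
    using moment_Suc[of "\<alpha> k - 1"] by (cases "\<alpha> k") auto
  moreover have "integral cube (pd k (\<lambda>\<xi>. c * monom3 \<alpha> \<xi>)) = c * \<alpha> k * (\<Prod>i\<in>UNIV. moment ((\<alpha>(k := \<alpha> k - 1)) i))"
    unfolding pd_monom3 by (rule integral_monom3)
  ultimately have "integral cube (pd k (\<lambda>\<xi>. c * monom3 \<alpha> \<xi>)) = c * (1 - (-1) ^ \<alpha> k) * (\<Prod>i\<in>UNIV - {k}. moment (\<alpha> i))"
    by (simp only: mult.assoc flip: \<open>\<alpha> k * moment (\<alpha> k - 1) = 1 - (-1) ^ \<alpha> k\<close>)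
  then show ?case by (simp only: integral_face_monom3) (simp add: algebra_simps)
next
  case (tpol_add f g)
  have "f \<in> tpol d" "g \<in> tpol d" by fact+
  then show ?case using tpol_add.IH
    by (simp add: pd_add integral_add tpol_integrable[OF tpol_pd] cube_integrable tpol_face_continuous)
qed

lemma face_point_continuous: "continuous_on S (face_point k s)"
proof -
  have "continuous_on S (\<lambda>q. if i = k then s else if i = k + 1 then fst q else snd q)" for i
    by (cases "i = k"; cases "i = k + 1") (auto intro: continuous_intros)
  then show ?thesis unfolding face_point_def by (intro continuous_on_vec_lambda)
qed

text \<open>Connects the two-dimensional parametrization used by \<open>boundary_integral\<close>
  with the face averages over the cube used for the fluxes.\<close>

lemma integral_square_face:
  assumes "f \<in> tpol d"
  shows "2 * integral (cbox (-1, -1) (1, 1)) (\<lambda>q. f (face_point k s q)) = integral cube (\<lambda>\<xi>. f (face_proj k s \<xi>))"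
  using assms
proof (induction rule: tpol.induct)
  case (tpol_monom \<alpha> c)
  have m: "monom3 \<alpha> (face_point k s (x, y)) = s ^ \<alpha> k * (x ^ \<alpha> (k + 1) * y ^ \<alpha> (k + 2))" for x y
    unfolding monom3_def prod_3_cyclic[of _ k] using distinct_3_cyclic[of k] by (auto simp: face_point_def)
  have "integral (cbox (-1, -1) (1, 1)) (\<lambda>q. c * monom3 \<alpha> (face_point k s q))
     = integral {-1..1} (\<lambda>x. integral {-1..1} (\<lambda>y. c * monom3 \<alpha> (face_point k s (x, y))))"
    using integral_prod_continuous[of "-1" "-1" 1 1 "\<lambda>q. c * monom3 \<alpha> (face_point k s q)"]
      continuous_on_compose2[OF tpol_continuous[OF tpol.tpol_monom[of \<alpha> \<alpha> c], of UNIV] face_point_continuous]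
    by auto
  also have "\<dots> = c * s ^ \<alpha> k * (moment (\<alpha> (k + 1)) * moment (\<alpha> (k + 2)))"
    by (simp add: m moment_def mult_ac)
  also have "moment (\<alpha> (k + 1)) * moment (\<alpha> (k + 2)) = (\<Prod>i\<in>UNIV - {k}. moment (\<alpha> i))"
  proof -
    have "UNIV - {k} = {k + 1, k + 2}" using UNIV_3_cyclic[of k] distinct_3_cyclic[of k] by auto
    then show ?thesis using distinct_3_cyclic[of k] by simp
  qed
  finally show ?case by (simp only: integral_face_monom3 mult_ac)
next
  case (tpol_add f g)
  have fg: "f \<in> tpol d" "g \<in> tpol d" by fact+
  have "continuous_on S (\<lambda>q. h (face_point k s q))" if "h \<in> tpol d" for h S
    by (rule continuous_on_compose2[OF tpol_continuous[OF that, of UNIV] face_point_continuous]) auto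
  then show ?case using tpol_add.IH fg
    by (simp add: integral_add cube_integrable tpol_face_continuous integrable_continuous)
qed

text \<open>The change of variables for a gluing map. On a monomial the permutation only relabels
  exponents, and the signs are absorbed by \<open>moment_sign\<close>.\<close>

lemma integral_cube_signed_perm:
  assumes "f \<in> tpol d" and g: "\<And>\<xi> i. g \<xi> $ i = \<epsilon> i * \<xi> $ \<pi> i" "bij \<pi>" "\<And>i. \<bar>\<epsilon> i\<bar> = 1"
    and gc: "continuous_on UNIV g"
  shows "integral cube (\<lambda>\<xi>. f (g \<xi>)) = integral cube f"
  using assms(1)
proof (induction rule: tpol.induct)
  case (tpol_monom \<alpha> c)
  have 1: "(\<Prod>i\<in>UNIV. h (\<pi> i) (\<alpha> i)) = (\<Prod>j\<in>UNIV. h j (\<alpha> (inv \<pi> j)))" for h :: "3 \<Rightarrow> nat \<Rightarrow> real"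
    by (rule prod.reindex_bij_betw[OF bij_imp_bij_inv[OF g(2)], symmetric, THEN trans])
       (simp add: surj_f_inv_f bij_is_surj g(2))
  have 2: "monom3 \<alpha> (g \<xi>) = (\<Prod>i\<in>UNIV. \<epsilon> i ^ \<alpha> i) * monom3 (\<lambda>j. \<alpha> (inv \<pi> j)) \<xi>" for \<xi>
    using 1[of "\<lambda>j m. (\<xi> $ j) ^ m"] by (simp add: monom3_def g power_mult_distrib prod.distrib)
  have "integral cube (\<lambda>\<xi>. c * monom3 \<alpha> (g \<xi>)) = c * (\<Prod>i\<in>UNIV. \<epsilon> i ^ \<alpha> i) * (\<Prod>i\<in>UNIV. moment (\<alpha> (inv \<pi> i)))"
    unfolding 2 using integral_monom3[of "c * (\<Prod>i\<in>UNIV. \<epsilon> i ^ \<alpha> i)"] by (simp add: mult_ac)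
  also have "\<dots> = c * (\<Prod>i\<in>UNIV. \<epsilon> i ^ \<alpha> i * moment (\<alpha> i))"
    using 1[of "\<lambda>_. moment"] by (simp add: prod.distrib)
  finally show ?case by (simp only: integral_monom3 moment_sign g(3))
next
  case (tpol_add f' g')
  have fg: "f' \<in> tpol d" "g' \<in> tpol d" by fact+
  have "continuous_on S (\<lambda>q. h (g q))" if "h \<in> tpol d" for h S
    by (rule continuous_on_compose2[OF tpol_continuous[OF that, of UNIV] continuous_on_subset[OF gc]]) auto
  then show ?case using tpol_add.IH fg
    by (simp add: integral_add cube_integrable tpol_integrable)
qed

subsection \<open>Exactness of the tensor rule\<close>

lemma tensor_nodes_subset:
  assumes "\<And>i. n i > 0" "\<xi> \<in> tensor_nodes n" shows "\<xi> \<in> ocube"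
  using assms gauss_nodes_basic(3)[OF assms(1)] unfolding ocube_iff tensor_nodes_def
  by (fastforce simp: abs_less_iff)

lemma tensor_gauss_cong: "(\<And>\<xi>. \<xi> \<in> tensor_nodes n \<Longrightarrow> f \<xi> = g \<xi>) \<Longrightarrow> tensor_gauss n f = tensor_gauss n g"
  unfolding tensor_gauss_def by (rule sum.cong) auto

lemma tensor_gauss_add: "tensor_gauss n (\<lambda>\<xi>. f \<xi> + g \<xi>) = tensor_gauss n f + tensor_gauss n g"
  by (simp add: tensor_gauss_def distrib_left sum.distrib)

lemma tensor_gauss_scale: "tensor_gauss n (\<lambda>\<xi>. c * f \<xi>) = c * tensor_gauss n f"
  by (simp add: tensor_gauss_def sum_distrib_left algebra_simps)

lemma tensor_gauss_mono:
  assumes "\<And>i. n i > 0" "\<And>\<xi>. \<xi> \<in> tensor_nodes n \<Longrightarrow> f \<xi> \<le> g \<xi>"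
  shows "tensor_gauss n f \<le> tensor_gauss n g"
  unfolding tensor_gauss_def
  by (intro sum_mono mult_left_mono prod_nonneg assms) (auto simp: tensor_nodes_def assms gauss_weight_nonneg)

lemma tensor_gauss_monom3:
  assumes n: "\<And>i. n i > 0" and \<alpha>: "\<And>i. \<alpha> i \<le> 2 * n i - 1"
  shows "tensor_gauss n (\<lambda>\<xi>. c * monom3 \<alpha> \<xi>) = c * (\<Prod>i\<in>UNIV. moment (\<alpha> i))"
proof -
  have "(\<Prod>i\<in>UNIV. moment (\<alpha> i)) = (\<Prod>i\<in>UNIV. \<Sum>x\<in>gauss_nodes (n i). gauss_weight (n i) x * x ^ \<alpha> i)"
    using gauss_exact[OF n order.trans[OF degree_monom_le[of "1::real"] \<alpha>]]
    by (intro prod.cong) (auto simp: moment_poly poly_monom)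
  also have "\<dots> = (\<Sum>g\<in>PiE UNIV (\<lambda>i. gauss_nodes (n i)). \<Prod>i\<in>UNIV. gauss_weight (n i) (g i) * g i ^ \<alpha> i)"
    by (rule prod_sum_PiE) (auto simp: gauss_nodes_basic n)
  also have "\<dots> = (\<Sum>\<xi>\<in>tensor_nodes n. \<Prod>i\<in>UNIV. gauss_weight (n i) (\<xi> $ i) * (\<xi> $ i) ^ \<alpha> i)"
    by (rule sum.reindex_bij_witness[of _ "\<lambda>\<xi> i. \<xi> $ i" "\<lambda>g. \<chi> i. g i"])
       (auto simp: tensor_nodes_def PiE_def Pi_def)
  also have "\<dots> = tensor_gauss n (monom3 \<alpha>)"
    by (simp add: tensor_gauss_def monom3_def prod.distrib)
  finally show ?thesis by (simp add: tensor_gauss_scale)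
qed

lemma tensor_gauss_exact:
  assumes "f \<in> tpol d" and n: "\<And>i. n i > 0" and d: "\<And>i. d i \<le> 2 * n i - 1"
  shows "tensor_gauss n f = integral cube f"
  using assms(1)
proof (induction rule: tpol.induct)
  case (tpol_monom \<alpha> c)
  have "\<alpha> i \<le> 2 * n i - 1" for i using le_funD[OF tpol_monom(1), of i] d[of i] by linarith
  then show ?case by (simp only: tensor_gauss_monom3 n integral_monom3)
next
  case (tpol_add f g)
  have fg: "f \<in> tpol d" "g \<in> tpol d" by fact+
  then show ?case using tpol_add.IH
    by (simp add: tensor_gauss_add integral_add tpol_integrable)
qed

subsection \<open>Jacobians of polynomial fields\<close>

definition pfield :: "(3 \<Rightarrow> real^3 \<Rightarrow> real) \<Rightarrow> real^3 \<Rightarrow> real^3" where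
  "pfield U \<xi> = (\<chi> k. U k \<xi>)"

definition pjac :: "(3 \<Rightarrow> real^3 \<Rightarrow> real) \<Rightarrow> real^3 \<Rightarrow> real^3^3" where
  "pjac U \<xi> = (\<chi> k j. pd j (U k) \<xi>)"

text \<open>Membership in \<open>tensor_poly\<close> concerns values on the cube only. Here a field
  is traded for globally defined polynomial components, which have ordinary derivatives up to and
  beyond the faces.\<close>

lemma tensor_poly_pfield:
  "u \<in> tensor_poly p \<longleftrightarrow> (\<exists>U. (\<forall>k. U k \<in> tpol (\<lambda>_. p)) \<and> (\<forall>\<xi>\<in>cube. u \<xi> = pfield U \<xi>))"
proof
  assume "u \<in> tensor_poly p"
  then have "\<forall>k. \<exists>c :: (3 \<Rightarrow> nat) \<Rightarrow> real. \<forall>\<xi>\<in>cube. u \<xi> $ k = (\<Sum>\<alpha> | \<forall>i. \<alpha> i \<le> p. c \<alpha> * monom3 \<alpha> \<xi>)"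
    by (simp add: tensor_poly_def monom3_def)
  then obtain c :: "3 \<Rightarrow> (3 \<Rightarrow> nat) \<Rightarrow> real" where
    c: "\<And>k \<xi>. \<xi> \<in> cube \<Longrightarrow> u \<xi> $ k = (\<Sum>\<alpha> | \<forall>i. \<alpha> i \<le> p. c k \<alpha> * monom3 \<alpha> \<xi>)"
    unfolding choice_iff by blast
  show "\<exists>U. (\<forall>k. U k \<in> tpol (\<lambda>_. p)) \<and> (\<forall>\<xi>\<in>cube. u \<xi> = pfield U \<xi>)"
  proof (intro exI[of _ "\<lambda>k \<xi>. \<Sum>\<alpha> | \<forall>i. \<alpha> i \<le> p. c k \<alpha> * monom3 \<alpha> \<xi>"] conjI allI ballI)
    show "(\<lambda>\<xi>. \<Sum>\<alpha> | \<forall>i. \<alpha> i \<le> p. c k \<alpha> * monom3 \<alpha> \<xi>) \<in> tpol (\<lambda>_. p)" for k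
      by (intro tpol_sum tpol_monom) (auto simp: le_fun_def)
  qed (simp add: pfield_def vec_eq_iff c)
next
  assume "\<exists>U. (\<forall>k. U k \<in> tpol (\<lambda>_. p)) \<and> (\<forall>\<xi>\<in>cube. u \<xi> = pfield U \<xi>)"
  then obtain U where U: "\<And>k. U k \<in> tpol (\<lambda>_. p)" "\<And>\<xi>. \<xi> \<in> cube \<Longrightarrow> u \<xi> = pfield U \<xi>" by blast
  have fin: "finite {\<alpha> :: 3 \<Rightarrow> nat. \<forall>i. \<alpha> i \<le> p}"
  proof -
    have "{\<alpha> :: 3 \<Rightarrow> nat. \<forall>i. \<alpha> i \<le> p} = PiE UNIV (\<lambda>_. {..p})" by (auto simp: PiE_def Pi_def)
    then show ?thesis by (simp add: finite_PiE)
  qed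
  have "\<exists>c. \<forall>\<xi>. f \<xi> = (\<Sum>\<alpha> | \<forall>i. \<alpha> i \<le> p. c \<alpha> * monom3 \<alpha> \<xi>)" if "f \<in> tpol (\<lambda>_. p)" for f
    using that
  proof (induction rule: tpol.induct)
    case (tpol_monom \<beta> c)
    have "(\<Sum>\<alpha> | \<forall>i. \<alpha> i \<le> p. (if \<alpha> = \<beta> then c else 0) * monom3 \<alpha> \<xi>) = c * monom3 \<beta> \<xi>" for \<xi>
      using tpol_monom fin by (simp add: if_distrib[of "\<lambda>x. x * _"] le_fun_def cong: if_cong)
    then show ?case by (intro exI[of _ "\<lambda>\<alpha>. if \<alpha> = \<beta> then c else 0"]) simp
  next
    case (tpol_add f g)
    then obtain c c' where "\<And>\<xi>. f \<xi> = (\<Sum>\<alpha> | \<forall>i. \<alpha> i \<le> p. c \<alpha> * monom3 \<alpha> \<xi>)"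
      "\<And>\<xi>. g \<xi> = (\<Sum>\<alpha> | \<forall>i. \<alpha> i \<le> p. c' \<alpha> * monom3 \<alpha> \<xi>)" by blast
    then show ?case
      by (intro exI[of _ "\<lambda>\<alpha>. c \<alpha> + c' \<alpha>"]) (simp add: sum.distrib distrib_right)
  qed
  then have "\<exists>c. \<forall>\<xi>. U k \<xi> = (\<Sum>\<alpha> | \<forall>i. \<alpha> i \<le> p. c \<alpha> * monom3 \<alpha> \<xi>)" for k using U(1) .
  then show "u \<in> tensor_poly p"
    using U(2) by (simp add: tensor_poly_def pfield_def flip: monom3_def) meson
qed

lemma pfield_has_derivative:
  assumes "\<And>k. U k \<in> tpol (d k)"
  shows "(pfield U has_derivative (\<lambda>h. pjac U \<xi> *v h)) (at \<xi> within S)"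
proof -
  have "((\<lambda>\<xi>. pfield U \<xi> \<bullet> axis k 1) has_derivative (\<lambda>h. (pjac U \<xi> *v h) \<bullet> axis k 1)) (at \<xi>)" for k
    using tpol_derivative[OF assms, of k \<xi>]
    by (simp add: pfield_def pjac_def inner_axis matrix_vector_mult_def mult.commute)
  then have "(pfield U has_derivative (\<lambda>h. pjac U \<xi> *v h)) (at \<xi>)"
    unfolding has_derivative_componentwise_within[of "pfield U"] by (auto simp: Basis_vec_def)
  then show ?thesis by (rule has_derivative_at_withinI)
qed

lemma parent_jac_eqI:
  assumes "(f has_derivative (\<lambda>h. A *v h)) (at \<xi> within cube)" "\<xi> \<in> cube"
  shows "parent_jac f \<xi> = A"
proof -
  have w: "(f has_derivative frechet_derivative f (at \<xi> within cube)) (at \<xi> within cube)"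
    using assms frechet_derivative_works Derivative.differentiableI by blast
  have "(\<lambda>h. A *v h) = frechet_derivative f (at \<xi> within cube)"
    by (rule frechet_derivative_unique_within_closed_interval[of "vec (-1)" "vec 1" \<xi> f])
       (use assms w in \<open>simp_all only: cube_cbox\<close>, auto simp: Basis_vec_def inner_axis)
  then show ?thesis unfolding parent_jac_def by (metis matrix_of_matrix_vector_mul)
qed

lemma parent_jac_pfield:
  assumes "\<And>k. U k \<in> tpol (d k)" "\<And>\<xi>. \<xi> \<in> cube \<Longrightarrow> u \<xi> = pfield U \<xi>" "\<xi> \<in> cube"
  shows "parent_jac u \<xi> = pjac U \<xi>"
    and "(u has_derivative (\<lambda>h. parent_jac u \<xi> *v h)) (at \<xi> within cube)"
proof -
  have d: "(u has_derivative (\<lambda>h. pjac U \<xi> *v h)) (at \<xi> within cube)"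
    by (rule has_derivative_transform[OF assms(3) _ pfield_has_derivative[of U d]]) (use assms in auto)
  show e: "parent_jac u \<xi> = pjac U \<xi>" by (rule parent_jac_eqI[OF d assms(3)])
  show "(u has_derivative (\<lambda>h. parent_jac u \<xi> *v h)) (at \<xi> within cube)" using d e by simp
qed

section \<open>Algebra of three-by-three matrices\<close>

lemma frob_sum: "frob A B = (\<Sum>i\<in>UNIV. \<Sum>j\<in>UNIV. A $ i $ j * B $ i $ j)"
  unfolding frob_def trace_def matrix_matrix_mult_def transpose_def
  by (subst sum.swap) simp

lemma frob_norm: "frob A A = (norm A)\<^sup>2"
  by (simp add: frob_sum norm_vec_def L2_set_def sum_nonneg flip: power2_eq_square)

lemma frob_add: "frob A (B + C) = frob A B + frob A C"
  by (simp add: frob_sum distrib_left sum.distrib)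

lemma frob_add_left: "frob (B + C) A = frob B A + frob C A"
  by (simp add: frob_sum distrib_right sum.distrib)

lemma frob_diff: "frob A (B - C) = frob A B - frob A C"
  by (simp add: frob_sum right_diff_distrib sum_subtractf)

lemma frob_scale: "frob A (c *\<^sub>R B) = c * frob A B" "frob (c *\<^sub>R A) B = c * frob A B"
  by (simp_all add: frob_sum sum_distrib_left mult_ac)

lemma frob_commute: "frob A B = frob B A"
  by (simp add: frob_sum mult.commute)

lemma frob_mat1: "frob (mat 1) A = trace A" "frob A (mat 1) = trace A"
  by (simp_all add: frob_sum trace_def sum_3 mat_def)

lemma frob_transpose: "frob (transpose A) (transpose B) = frob A B"
  unfolding frob_sum by (subst sum.swap) (simp add: transpose_def)

lemma numeral_3_mod: "(4::3) = 1" "(5::3) = 2"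
  by simp_all

lemma matrix_add_rdistrib: "(A + B) ** C = A ** C + B ** (C :: real^'n^'m)" for A B :: "real^'m^'k"
  by (simp add: vec_eq_iff matrix_matrix_mult_def distrib_right sum.distrib)

lemma matrix_diff_rdistrib: "(A - B) ** C = A ** C - B ** (C :: real^'n^'m)" for A B :: "real^'m^'k"
  by (simp add: vec_eq_iff matrix_matrix_mult_def left_diff_distrib sum_subtractf)

lemma cof_nth: "cof A $ i $ j = A $ (i+1) $ (j+1) * A $ (i+2) $ (j+2) - A $ (i+1) $ (j+2) * A $ (i+2) $ (j+1)"
  by (simp add: cof_def)

lemma mcross_nth:
  "mcross A B $ i $ j = A $ (i+1) $ (j+1) * B $ (i+2) $ (j+2) - A $ (i+1) $ (j+2) * B $ (i+2) $ (j+1)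
     + (B $ (i+1) $ (j+1) * A $ (i+2) $ (j+2) - B $ (i+1) $ (j+2) * A $ (i+2) $ (j+1))"
  by (simp add: mcross_def cof_nth algebra_simps)

lemma mcross_commute: "mcross A B = mcross B A"
  by (simp add: mcross_def add.commute)

lemma mcross_add: "mcross (A + B) C = mcross A C + mcross B C"
  by (simp add: vec_eq_iff mcross_nth algebra_simps)

lemma mcross_scale: "mcross (c *\<^sub>R A) C = c *\<^sub>R mcross A C"
  by (simp add: vec_eq_iff mcross_nth algebra_simps)

lemma mcross_0: "mcross 0 C = 0"
  by (simp add: vec_eq_iff mcross_nth)

lemma mcross_sum: "mcross (\<Sum>i\<in>I. A i) C = (\<Sum>i\<in>I. mcross (A i) C)"
  by (induction I rule: infinite_finite_induct) (auto simp: mcross_add mcross_0)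

lemma mcross_self: "mcross A A = 2 *\<^sub>R cof A"
  by (simp add: vec_eq_iff mcross_nth cof_nth algebra_simps)

text \<open>The cofactor is quadratic, so this expansion is exact; its six terms are arranged to fit
  \<open>hessian_quadratic\<close>.\<close>

lemma cof_polar:
  "cof (A + s *\<^sub>R U + t *\<^sub>R V) = cof A + s *\<^sub>R mcross A U + t *\<^sub>R mcross A V
     + (s * t) *\<^sub>R mcross U V + s\<^sup>2 *\<^sub>R cof U + t\<^sup>2 *\<^sub>R cof V"
  by (simp add: vec_eq_iff mcross_nth cof_nth power2_eq_square algebra_simps)

text \<open>In the k-th column of a mixed cofactor only the other two columns of each matrix occur.
  For Jacobians on a face with constant k-th coordinate these are the tangential derivatives; the
  cancellation between cells and the dependence on traces both rest on this.\<close>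

lemma mcross_column_cong:
  assumes "\<And>j. j \<noteq> k \<Longrightarrow> column j A = column j A'" "\<And>j. j \<noteq> k \<Longrightarrow> column j B = column j B'"
  shows "column k (mcross A B) = column k (mcross A' B')"
proof -
  have "A $ i $ j = A' $ i $ j" "B $ i $ j = B' $ i $ j" if "j \<noteq> k" for i j
    using assms[OF that] by (auto simp: column_def vec_eq_iff)
  then show ?thesis by (simp add: column_def mcross_nth)
qed

lemma cof_column: "column k (cof A) = cross3 (column (k+1) A) (column (k+2) A)"
  by (simp add: column_def cross3_def vec_eq_iff forall_3 cof_nth vector_3 numeral_3_mod algebra_simps)

lemma cof_mult: "cof (A ** B) = cof A ** cof B"
  unfolding vec_eq_iff forall_3 cof_nth matrix_matrix_mult_def
  by (simp add: sum_3 cof_nth numeral_3_mod algebra_simps)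

lemma mcross_mult: "mcross (A ** G) (B ** G) = mcross A B ** cof G"
  unfolding mcross_def matrix_add_rdistrib[symmetric] cof_mult
  by (simp add: matrix_diff_rdistrib)

lemma cof_transpose_mult: "transpose (cof A) ** A = det A *\<^sub>R mat 1" "A ** transpose (cof A) = det A *\<^sub>R mat 1"
  unfolding vec_eq_iff forall_3 matrix_matrix_mult_def transpose_def det_3
  by (simp_all add: sum_3 cof_nth mat_def numeral_3_mod algebra_simps)

lemma matrix_inv_both:
  fixes A :: "real^3^3"
  assumes "det A \<noteq> 0" shows "A ** matrix_inv A = mat 1" "matrix_inv A ** A = mat 1"
proof -
  have "\<exists>B. A ** B = mat 1 \<and> B ** A = mat 1"
    using assms by (simp add: invertible_def flip: invertible_det_nz)
  then have "A ** matrix_inv A = mat 1 \<and> matrix_inv A ** A = mat 1"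
    unfolding matrix_inv_def by (rule someI_ex)
  then show "A ** matrix_inv A = mat 1" "matrix_inv A ** A = mat 1" by auto
qed

lemma matrix_inv_cof:
  assumes "det A \<noteq> 0" shows "matrix_inv A = inverse (det A) *\<^sub>R transpose (cof A)"
proof -
  have "(inverse (det A) *\<^sub>R transpose (cof A)) ** A = mat 1"
    using assms by (simp add: cof_transpose_mult scalar_matrix_assoc[symmetric])
  then have "(inverse (det A) *\<^sub>R transpose (cof A)) ** A ** matrix_inv A = matrix_inv A" by simp
  then show ?thesis unfolding matrix_mul_assoc[symmetric] matrix_inv_both(1)[OF assms] by simp
qed

lemma det_cross3: "det A = column k A \<bullet> cross3 (column (k+1) A) (column (k+2) A)"
  using exhaust_3[of k]
  by (auto simp: column_def cross3_def det_3 inner_vec_def sum_3 vector_3 numeral_3_mod algebra_simps)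

text \<open>With \<open>H\<close> the physical gradient and \<open>J\<close> the geometry Jacobian,
  this converts the parent integrand into tr cof H with the volume weight det J. After a cyclic
  shift under the trace, \<open>cof J ** transpose J\<close> collapses to a multiple of the
  identity.\<close>

lemma frob_cof_mult: "frob J (cof (H ** J)) = det J * trace (cof H)"
proof -
  have "frob J (cof (H ** J)) = trace (transpose J ** (cof H ** cof J))" by (simp add: frob_def cof_mult)
  also have "\<dots> = trace (cof H ** (cof J ** transpose J))"
    by (metis matrix_mul_assoc trace_mul_sym)
  also have "cof J ** transpose J = transpose (J ** transpose (cof J))"
    by (simp add: matrix_transpose_mul)
  also have "\<dots> = det J *\<^sub>R mat 1"
    by (simp add: cof_transpose_mult) (simp add: vec_eq_iff transpose_def mat_def)
  finally show ?thesis by (simp add: matrix_scalar_ac trace_def sum_distrib_left)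
qed

subsection \<open>Norm estimates\<close>

lemma spectral_bound: "norm (A *v x) \<le> spectral_norm A * norm x"
  unfolding spectral_norm_def by (rule onorm) (rule matrix_vector_mul_bounded_linear)

lemma spectral_norm_nonneg: "spectral_norm A \<ge> 0"
  unfolding spectral_norm_def by (rule onorm_pos_le) (rule matrix_vector_mul_bounded_linear)

text \<open>Transposition preserves the spectral norm: test \<open>A\<close> on the vector
  \<open>x v* A\<close> itself, use Cauchy-Schwarz and cancel one factor.\<close>

lemma spectral_bound_transpose: "norm (x v* A) \<le> spectral_norm A * norm x"
proof (cases "x v* A = 0")
  case False
  have "(norm (x v* A))\<^sup>2 = x \<bullet> (A *v (x v* A))"
    by (simp add: dot_lmul_matrix power2_norm_eq_inner)
  also have "\<dots> \<le> norm x * (spectral_norm A * norm (x v* A))"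
    by (rule order.trans[OF norm_cauchy_schwarz]) (intro mult_left_mono spectral_bound norm_ge_zero)
  finally show ?thesis using False by (simp add: power2_eq_square mult_ac)
qed (simp add: spectral_norm_nonneg)

text \<open>Right multiplication acts on the rows of \<open>A\<close> one at a time, which is why
  the bound for the transposed action is used.\<close>

lemma norm_mult_spectral: "norm (A ** B) \<le> norm A * spectral_norm (B :: real^3^3)" for A :: "real^3^3"
proof -
  have row: "(A ** B) $ i = (A $ i) v* B" for i
    by (simp add: vec_eq_iff matrix_matrix_mult_def vector_matrix_mult_def mult.commute)
  have "norm (A ** B) = L2_set (\<lambda>i. norm ((A $ i) v* B)) UNIV" by (simp add: norm_vec_def row)
  also have "\<dots> \<le> L2_set (\<lambda>i. norm (A $ i) * spectral_norm B) UNIV"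
    by (intro L2_set_mono) (auto simp: mult.commute spectral_bound_transpose)
  also have "\<dots> = norm A * spectral_norm B"
    by (simp add: L2_set_left_distrib spectral_norm_nonneg norm_vec_def[of A])
  finally show ?thesis .
qed

lemma norm_cross3_le: "norm (cross3 x y) \<le> norm x * norm y"
proof -
  have "(norm (cross3 x y))\<^sup>2 \<le> (norm x * norm y)\<^sup>2"
    using norm_cross[of x y] by (simp add: power_mult_distrib)
  then show ?thesis by (rule power2_le_imp_le) simp
qed

text \<open>Hadamard's bound: the determinant is the triple product of the columns, and every column
  is the image of a unit vector.\<close>

lemma det_le_spectral: "\<bar>det A\<bar> \<le> spectral_norm A ^ 3"
proof -
  have col: "norm (column j A) \<le> spectral_norm A" for j
    using spectral_bound[of A "axis j 1"] by (simp add: matrix_vector_mul_component matrix_vector_mult_basis)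
  have "\<bar>det A\<bar> \<le> norm (column 1 A) * norm (cross3 (column (1+1) A) (column (1+2) A))"
    unfolding det_cross3[of A 1] by (rule Cauchy_Schwarz_ineq2)
  also have "\<dots> \<le> spectral_norm A * (spectral_norm A * spectral_norm A)"
    by (intro mult_mono col order.trans[OF norm_cross3_le] spectral_norm_nonneg mult_nonneg_nonneg norm_ge_zero)
  finally show ?thesis by (simp add: power3_eq_cube mult.assoc)
qed

section \<open>Second derivatives along a line\<close>

lemma hessian_quadratic:
  assumes "\<And>s t. E (\<lambda>X. y X + s *\<^sub>R u X + t *\<^sub>R v X) = a + s * b + t * c + s * t * d + s\<^sup>2 * e + t\<^sup>2 * f"
  shows "hessian E y u v = d"
proof -
  have "deriv (\<lambda>t. E (\<lambda>X. y X + s *\<^sub>R u X + t *\<^sub>R v X)) 0 = c + s * d" for s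
    unfolding assms by (rule DERIV_imp_deriv) (auto intro!: derivative_eq_intros)
  moreover have "deriv (\<lambda>s. c + s * d) 0 = d"
    by (rule DERIV_imp_deriv) (auto intro!: derivative_eq_intros)
  ultimately show ?thesis by (simp add: hessian_def)
qed

text \<open>A first derivative is required only near 0, because powers of the determinant are
  differentiable only while it is positive. Being a relation, it combines under sums and multiples
  without separate differentiability side conditions.\<close>

definition second_deriv0 :: "(real \<Rightarrow> real) \<Rightarrow> real \<Rightarrow> bool" where
  "second_deriv0 \<phi> d \<longleftrightarrow> (\<exists>\<phi>'. (\<forall>\<^sub>F r in nhds 0. (\<phi> has_real_derivative \<phi>' r) (at r)) \<and> (\<phi>' has_real_derivative d) (at 0))"

lemma second_deriv0I:
  assumes "\<forall>\<^sub>F r in nhds 0. (\<phi> has_real_derivative \<phi>' r) (at r)" "(\<phi>' has_real_derivative d) (at 0)"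
  shows "second_deriv0 \<phi> d"
  using assms by (auto simp: second_deriv0_def)

lemma second_deriv0_add:
  assumes "second_deriv0 f a" "second_deriv0 g b" shows "second_deriv0 (\<lambda>r. f r + g r) (a + b)"
proof -
  obtain f' g' where f: "\<forall>\<^sub>F r in nhds 0. (f has_real_derivative f' r) (at r)" "(f' has_real_derivative a) (at 0)"
    and g: "\<forall>\<^sub>F r in nhds 0. (g has_real_derivative g' r) (at r)" "(g' has_real_derivative b) (at 0)"
    using assms by (auto simp: second_deriv0_def)
  show ?thesis
  proof (rule second_deriv0I)
    show "\<forall>\<^sub>F r in nhds 0. ((\<lambda>r. f r + g r) has_real_derivative f' r + g' r) (at r)"
      using f(1) g(1) by eventually_elim (rule DERIV_add)
  qed (intro DERIV_add f g)
qed

lemma second_deriv0_const: "second_deriv0 (\<lambda>_. c) 0"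
  by (rule second_deriv0I[of _ "\<lambda>_. 0"]) auto

lemma second_deriv0_cmult:
  assumes "second_deriv0 f a" shows "second_deriv0 (\<lambda>r. c * f r) (c * a)"
proof -
  obtain f' where f: "\<forall>\<^sub>F r in nhds 0. (f has_real_derivative f' r) (at r)" "(f' has_real_derivative a) (at 0)"
    using assms by (auto simp: second_deriv0_def)
  show ?thesis
  proof (rule second_deriv0I)
    show "\<forall>\<^sub>F r in nhds 0. ((\<lambda>r. c * f r) has_real_derivative c * f' r) (at r)"
      using f(1) by eventually_elim (rule DERIV_cmult)
  qed (intro DERIV_cmult f)
qed

lemma second_deriv0_sum:
  "(\<And>x. x \<in> A \<Longrightarrow> second_deriv0 (f x) (d x)) \<Longrightarrow> second_deriv0 (\<lambda>r. \<Sum>x\<in>A. f x r) (\<Sum>x\<in>A. d x)"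
  by (induction A rule: infinite_finite_induct) (auto intro: second_deriv0_add second_deriv0_const)

text \<open>The contribution of the second derivative \<open>d\<close> carries the factor f 0 = 0.
  Applied to the volume change, this leaves only the square of its first variation.\<close>

lemma second_deriv0_square:
  assumes "\<And>r. (f has_real_derivative f' r) (at r)" "(f' has_real_derivative d) (at 0)" "f 0 = 0"
  shows "second_deriv0 (\<lambda>r. (f r)\<^sup>2) (2 * (f' 0)\<^sup>2)"
proof (rule second_deriv0I)
  show "\<forall>\<^sub>F r in nhds 0. ((\<lambda>r. (f r)\<^sup>2) has_real_derivative 2 * f r * f' r) (at r)"
    using assms by (intro always_eventually) (auto intro!: derivative_eq_intros)
  show "((\<lambda>r. 2 * f r * f' r) has_real_derivative 2 * (f' 0)\<^sup>2) (at 0)"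
    using assms by (auto intro!: derivative_eq_intros simp: power2_eq_square)
qed

text \<open>On the diagonal the two-parameter family depends on s + t alone, so the nested
  derivatives reduce to a one-dimensional second derivative.\<close>

lemma hessian_radial:
  assumes E: "\<And>r. E (\<lambda>X. y X + r *\<^sub>R u X) = \<phi> r" and "second_deriv0 \<phi> d"
  shows "hessian E y u u = d"
proof -
  obtain \<phi>' where f: "\<forall>\<^sub>F r in nhds 0. (\<phi> has_real_derivative \<phi>' r) (at r)" "(\<phi>' has_real_derivative d) (at 0)"
    using assms by (auto simp: second_deriv0_def)
  have Es: "E (\<lambda>X. y X + s *\<^sub>R u X + t *\<^sub>R u X) = \<phi> (t + s)" for s t
    using E[of "s + t"] by (simp add: scaleR_left_distrib add.assoc add.commute[of t])
  have "\<forall>\<^sub>F s in nhds 0. deriv (\<lambda>t. E (\<lambda>X. y X + s *\<^sub>R u X + t *\<^sub>R u X)) 0 = \<phi>' s"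
    using f(1)
  proof eventually_elim
    case (elim s)
    have "((\<lambda>t. \<phi> (t + s)) has_real_derivative \<phi>' s) (at 0)"
      using DERIV_shift[of \<phi> "\<phi>' s" 0 s] elim by simp
    then show ?case unfolding Es by (rule DERIV_imp_deriv)
  qed
  \<comment> \<open>The inner derivative is identified only for s near 0, hence the local congruence
    rule.\<close>
  then have "hessian E y u u = deriv \<phi>' 0"
    unfolding hessian_def by (rule deriv_cong_ev) simp
  then show ?thesis using DERIV_imp_deriv[OF f(2)] by simp
qed

text \<open>One formula for both isotropic terms: \<open>D\<close> plays det (I + r H), with value 1
  at r = 0, and \<open>N\<close> the squared norm of I + r H or of its cofactor. Coefficients beyond
  the quadratic ones drop out.\<close>

lemma second_deriv0_powr:
  fixes q T C \<Delta> n0 n1 n2 n3 n4 :: real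
  defines "D \<equiv> \<lambda>r. 1 + r * T + r\<^sup>2 * C + r ^ 3 * \<Delta>"
    and "N \<equiv> \<lambda>r. n0 + r * n1 + r\<^sup>2 * n2 + r ^ 3 * n3 + r ^ 4 * n4"
  shows "second_deriv0 (\<lambda>r. D r powr q * N r)
    (q * (q - 1) * T\<^sup>2 * n0 + 2 * q * C * n0 + 2 * q * T * n1 + 2 * n2)"
proof (rule second_deriv0I)
  define D' where "D' r = T + 2 * r * C + 3 * r\<^sup>2 * \<Delta>" for r
  define N' where "N' r = n1 + 2 * r * n2 + 3 * r\<^sup>2 * n3 + 4 * r ^ 3 * n4" for r
  have D: "(D has_real_derivative D' r) (at r)" for r
    unfolding D_def D'_def by (auto intro!: derivative_eq_intros)
  have N: "(N has_real_derivative N' r) (at r)" for r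
    unfolding N_def N'_def by (auto intro!: derivative_eq_intros)
  have D2: "(D' has_real_derivative 2 * C) (at 0)"
    unfolding D'_def by (auto intro!: derivative_eq_intros)
  have N2: "(N' has_real_derivative 2 * n2) (at 0)"
    unfolding N'_def by (auto intro!: derivative_eq_intros)
  have "isCont D 0" using D DERIV_isCont by blast
  moreover have "D 0 > 0" by (simp add: D_def)
  ultimately have pos: "\<forall>\<^sub>F r in nhds 0. D r > 0"
    by (metis isCont_def order_tendsto_iff tendsto_at_iff_tendsto_nhds)
  show "\<forall>\<^sub>F r in nhds 0. ((\<lambda>r. D r powr q * N r) has_real_derivative
          q * D r powr (q - 1) * D' r * N r + D r powr q * N' r) (at r)"
    using pos
  proof eventually_elim
    case (elim r)
    show ?case using elim by (auto intro!: derivative_eq_intros D N)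
  qed
  have v: "D 0 = 1" "D' 0 = T" "N 0 = n0" "N' 0 = n1" by (auto simp: D_def D'_def N_def N'_def)
  show "((\<lambda>r. q * D r powr (q - 1) * D' r * N r + D r powr q * N' r) has_real_derivative
      q * (q - 1) * T\<^sup>2 * n0 + 2 * q * C * n0 + 2 * q * T * n1 + 2 * n2) (at 0)"
    by (auto intro!: derivative_eq_intros D N D2 N2 simp: v power2_eq_square algebra_simps)
qed

section \<open>Expansion of the isotropic energy around the identity\<close>

lemma det_line: "det (mat 1 + r *\<^sub>R H) = 1 + r * trace H + r\<^sup>2 * trace (cof H) + r ^ 3 * det H" for H :: "real^3^3"
  by (simp add: det_3 trace_def sum_3 cof_nth mat_def numeral_3_mod power2_eq_square power3_eq_cube algebra_simps)

lemma trace_mat1: "trace (mat 1 :: real^3^3) = 3"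
  by (simp add: trace_def sum_3 mat_def)

lemma trace_scaleR: "trace (c *\<^sub>R A) = c * trace (A :: real^3^3)"
  by (simp add: trace_def sum_distrib_left)

lemma frob_line: "frob (mat 1 + r *\<^sub>R H) (mat 1 + r *\<^sub>R H) = 3 + r * (2 * trace H) + r\<^sup>2 * frob H H"
  by (simp add: frob_add frob_add_left frob_scale frob_mat1 trace_mat1 trace_add trace_sub trace_scaleR power2_eq_square algebra_simps)

text \<open>The coefficients of r^3 and r^4 are left existential, as they do not influence the
  second derivative at 0.\<close>

lemma frob_cof_line: "\<exists>n3 n4. \<forall>r. frob (cof (mat 1 + r *\<^sub>R H)) (cof (mat 1 + r *\<^sub>R H)) =
   3 + r * (4 * trace H) + r\<^sup>2 * ((trace H)\<^sup>2 + frob H H + 2 * trace (cof H)) + r ^ 3 * n3 + r ^ 4 * n4"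
proof (intro exI allI)
  fix r
  let ?M = "mcross (mat 1) H"
  have c: "cof (mat 1 + r *\<^sub>R H) = mat 1 + r *\<^sub>R ?M + r\<^sup>2 *\<^sub>R cof H"
    using cof_polar[of "mat 1" r H 0 0] by (simp add: vec_eq_iff forall_3 cof_nth mat_def numeral_3_mod)
  have f: "frob (mat 1 + r *\<^sub>R A + r\<^sup>2 *\<^sub>R B) (mat 1 + r *\<^sub>R A + r\<^sup>2 *\<^sub>R B) =
      3 + r * (2 * trace A) + r\<^sup>2 * (frob A A + 2 * trace B) + r ^ 3 * (2 * frob A B) + r ^ 4 * frob B B" for A B
    by (simp add: frob_add frob_add_left frob_scale frob_mat1 trace_mat1 trace_add trace_sub trace_scaleR frob_commute[of B A]
        eval_nat_numeral algebra_simps)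
  \<comment> \<open>The linearization of the cofactor at the identity; its trace and norm supply the
    linear and quadratic coefficients.\<close>
  have m: "?M = trace H *\<^sub>R mat 1 - transpose H"
    by (simp add: vec_eq_iff forall_3 trace_def transpose_def sum_3 mcross_nth mat_def numeral_3_mod)
  have tT: "trace (transpose H) = trace H" by (simp add: trace_def transpose_def)
  have t: "trace ?M = 2 * trace H"
    unfolding frob_mat1(1)[symmetric] m by (simp add: frob_diff frob_scale frob_mat1 trace_mat1 trace_add trace_sub trace_scaleR tT)
  have "frob ?M ?M = trace H * trace ?M - frob ?M (transpose H)"
    by (subst (2) m) (simp add: frob_diff frob_scale frob_mat1)
  also have "frob ?M (transpose H) = trace H * trace H - frob H H"
    by (subst frob_commute, subst m) (simp add: frob_diff frob_scale frob_mat1 frob_transpose tT)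
  finally have n: "frob ?M ?M = (trace H)\<^sup>2 + frob H H" by (simp add: t power2_eq_square)
  show "frob (cof (mat 1 + r *\<^sub>R H)) (cof (mat 1 + r *\<^sub>R H)) =
   3 + r * (4 * trace H) + r\<^sup>2 * ((trace H)\<^sup>2 + frob H H + 2 * trace (cof H)) +
     r ^ 3 * (2 * frob ?M (cof H)) + r ^ 4 * frob (cof H) (cof H)"
    unfolding c f t n by simp
qed

text \<open>At the identity the isotropic energy only feels the deviatoric symmetric part of \<open>H\<close>: the
  quantity below is \<open>4 |dev sym H|\<^sup>2\<close>, written with \<open>2 tr cof H = (tr H)\<^sup>2 - H\<^sup>T : H\<close>.\<close>

definition dev_form :: "real^3^3 \<Rightarrow> real" where
  "dev_form H = 2 / 3 * (trace H)\<^sup>2 - 4 * trace (cof H) + 2 * frob H H"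

lemma dev_form_nonneg: "dev_form H \<ge> 0"
proof -
  \<comment> \<open>A sum of squares: differences of diagonal entries for the deviator and
    symmetrized off-diagonal entries for the shear. The subtracted product at the end is 0.\<close>
  have "dev_form H = 4 / 3 * ((H$1$1 - H$2$2)\<^sup>2 + (H$2$2 - H$3$3)\<^sup>2 + (H$3$3 - H$1$1)\<^sup>2)
     + 2 * ((H$1$2 + H$2$1)\<^sup>2 + (H$2$3 + H$3$2)\<^sup>2 + (H$3$1 + H$1$3)\<^sup>2) - 
      (2 / 3 * ((H$1$1 - H$2$2)\<^sup>2 + (H$2$2 - H$3$3)\<^sup>2 + (H$3$3 - H$1$1)\<^sup>2)) * 0"
    by (simp add: dev_form_def frob_sum trace_def sum_3 cof_nth numeral_3_mod power2_eq_square field_simps)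
  then show ?thesis by simp
qed

text \<open>The exponents -2/3 and -4/3 make the two invariants insensitive to dilations, and both
  then have the same second variation at the identity; therefore only the sum of the coefficients
  survives.\<close>

lemma second_deriv0_W_iso:
  "second_deriv0 (\<lambda>r. W_iso M e (mat 1 + r *\<^sub>R H)) ((c1 M e + c2 M e) * dev_form H)"
proof -
  obtain n3 n4 where n: "\<And>r. frob (cof (mat 1 + r *\<^sub>R H)) (cof (mat 1 + r *\<^sub>R H)) =
   3 + r * (4 * trace H) + r\<^sup>2 * ((trace H)\<^sup>2 + frob H H + 2 * trace (cof H)) + r ^ 3 * n3 + r ^ 4 * n4"
    using frob_cof_line by metis
  have 1: "second_deriv0 (\<lambda>r. det (mat 1 + r *\<^sub>R H) powr (-2/3) * frob (mat 1 + r *\<^sub>R H) (mat 1 + r *\<^sub>R H)) (dev_form H)"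
    using second_deriv0_powr[of "trace H" "trace (cof H)" "det H" "-2/3" 3 "2 * trace H" "frob H H" 0 0]
    by (simp add: det_line frob_line dev_form_def power2_eq_square)
  have 2: "second_deriv0 (\<lambda>r. det (mat 1 + r *\<^sub>R H) powr (-4/3) * frob (cof (mat 1 + r *\<^sub>R H)) (cof (mat 1 + r *\<^sub>R H))) (dev_form H)"
    using second_deriv0_powr[of "trace H" "trace (cof H)" "det H" "-4/3" 3 "4 * trace H" "(trace H)\<^sup>2 + frob H H + 2 * trace (cof H)" n3 n4]
    by (simp add: det_line n dev_form_def power2_eq_square algebra_simps)
  show ?thesis
    using second_deriv0_add[OF second_deriv0_cmult[OF second_deriv0_add[OF 1 second_deriv0_const[of "-3"]], of "c1 M e"]
        second_deriv0_cmult[OF second_deriv0_add[OF 2 second_deriv0_const[of "-3"]], of "c2 M e"]]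
    by (simp add: W_iso_def algebra_simps)
qed

section \<open>Exactness of the quadrature for the two quadratic integrands\<close>

lemma tpol_norm_pjac:
  assumes "\<And>k. U k \<in> tpol (\<lambda>_. p)"
  shows "(\<lambda>\<xi>. (norm (pjac U \<xi>))\<^sup>2) \<in> tpol (\<lambda>_. p + p)"
proof -
  have "(\<lambda>\<xi>. \<Sum>i\<in>UNIV. \<Sum>j\<in>UNIV. pd j (U i) \<xi> * pd j (U i) \<xi>) \<in> tpol (\<lambda>_. p + p)"
    by (intro tpol_sum tpol_mult tpol_pd' assms)
  then show ?thesis by (simp add: frob_norm[symmetric] frob_sum pjac_def)
qed

lemma tpol_frob_mcross:
  assumes G: "\<And>k. G k \<in> tpol (\<lambda>_. 2)" and U: "\<And>k. U k \<in> tpol (\<lambda>_. p)" and V: "\<And>k. V k \<in> tpol (\<lambda>_. p)"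
    and "p \<ge> 1"
  shows "(\<lambda>\<xi>. frob (pjac G \<xi>) (mcross (pjac U \<xi>) (pjac V \<xi>))) \<in> tpol (\<lambda>_. 2 * p + 1)"
proof -
  let ?d = "\<lambda>i. ((\<lambda>_. 2)(i := 2 - 1)) :: 3 \<Rightarrow> nat"
  let ?p = "\<lambda>i. ((\<lambda>_. p)(i := p - 1)) :: 3 \<Rightarrow> nat"
  have t: "(\<lambda>\<xi>. pd j (G a) \<xi> * (pd k (A b) \<xi> * pd l (B c) \<xi>)) \<in> tpol (\<lambda>_. 2 * p + 1)"
    if A: "\<And>k. A k \<in> tpol (\<lambda>_. p)" and B: "\<And>k. B k \<in> tpol (\<lambda>_. p)" and d: "j \<noteq> k" "k \<noteq> l" "j \<noteq> l"
    for j k l a b c A B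
  proof (rule tpol_mono)
    show "(\<lambda>\<xi>. pd j (G a) \<xi> * (pd k (A b) \<xi> * pd l (B c) \<xi>)) \<in> tpol (\<lambda>i. ?d j i + (?p k i + ?p l i))"
      by (intro tpol_mult tpol_pd G A B)
    have "i = j \<or> i = k \<or> i = l" for i
      using d exhaust_3[of i] exhaust_3[of j] exhaust_3[of k] exhaust_3[of l] by auto
    \<comment> \<open>Without derivatives the bound would be 2 + 2p. As j, k, l exhaust the
      coordinates, exactly one factor is lowered in coordinate i, and p \<ge> 1 makes the truncated
      p - 1 a genuine decrease.\<close>
    then show "(\<lambda>i. ?d j i + (?p k i + ?p l i)) \<le> (\<lambda>_. 2 * p + 1)"
      using \<open>p \<ge> 1\<close> d by (fastforce simp: le_fun_def)
  qed
  have e: "frob (pjac G \<xi>) (mcross (pjac U \<xi>) (pjac V \<xi>)) =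
    (\<Sum>i\<in>UNIV. \<Sum>j\<in>UNIV. pd j (G i) \<xi> * (pd (j+1) (U (i+1)) \<xi> * pd (j+2) (V (i+2)) \<xi>)
      - pd j (G i) \<xi> * (pd (j+2) (U (i+1)) \<xi> * pd (j+1) (V (i+2)) \<xi>)
      + (pd j (G i) \<xi> * (pd (j+1) (V (i+1)) \<xi> * pd (j+2) (U (i+2)) \<xi>)
      - pd j (G i) \<xi> * (pd (j+2) (V (i+1)) \<xi> * pd (j+1) (U (i+2)) \<xi>)))" for \<xi>
    by (simp add: frob_sum mcross_nth pjac_def algebra_simps)
  show ?thesis unfolding e
    by (intro tpol_sum tpol_add tpol_diff t U V distinct_3_cyclic distinct_3_cyclic[symmetric])
qed

lemma second_deriv0_tensor_gauss:
  assumes "\<And>\<xi>. \<xi> \<in> tensor_nodes n \<Longrightarrow> second_deriv0 (\<lambda>r. f r \<xi>) (d \<xi>)"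
  shows "second_deriv0 (\<lambda>r. tensor_gauss n (f r)) (tensor_gauss n d)"
  unfolding tensor_gauss_def by (intro second_deriv0_sum second_deriv0_cmult assms)

lemma det_pencil: "det (A + r *\<^sub>R B) = det A + r * frob (cof A) B + r\<^sup>2 * frob A (cof B) + r ^ 3 * det B"
  for A B :: "real^3^3"
  by (simp add: det_3 frob_sum sum_3 cof_nth numeral_3_mod power2_eq_square power3_eq_cube algebra_simps)

lemma tensor_poly_mono: "p \<le> q \<Longrightarrow> tensor_poly p \<subseteq> tensor_poly q"
proof
  fix u assume "p \<le> q" "u \<in> tensor_poly p"
  then obtain U where "\<And>k. U k \<in> tpol (\<lambda>_. p)" "\<And>\<xi>. \<xi> \<in> cube \<Longrightarrow> u \<xi> = pfield U \<xi>"
    unfolding tensor_poly_pfield by blast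
  moreover from this(1) have "U k \<in> tpol (\<lambda>_. q)" for k
    by (rule tpol_mono) (use \<open>p \<le> q\<close> in \<open>auto simp: le_fun_def\<close>)
  ultimately show "u \<in> tensor_poly q" unfolding tensor_poly_pfield by blast
qed

section \<open>The tangent at the identity\<close>

locale fe_mesh =
  fixes M :: "'e discretization"
  assumes mesh: "conforming_mesh M"
    and geometry: "\<And>e. e \<in> cells M \<Longrightarrow> geo M e \<in> tensor_poly 2"
    and orders: "\<And>e. e \<in> cells M \<Longrightarrow> degree_of M e \<ge> 2"
    and gauss_points: "\<And>e i. e \<in> cells M \<Longrightarrow> points M e i \<ge> degree_of M e + 1"
    and jac_pos: "\<And>e \<xi>. e \<in> cells M \<Longrightarrow> \<xi> \<in> cube \<Longrightarrow> det (geo_jac M e \<xi>) > 0"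
begin

text \<open>A fixed choice of polynomial components, so that flux densities become honest
  polynomials determined by cell and fields. They describe the cell map on the cube only, but extend
  it past the faces, where charts need room.\<close>

definition geo_rep :: "'e \<Rightarrow> 3 \<Rightarrow> real^3 \<Rightarrow> real" where
  "geo_rep e = (SOME G. (\<forall>k. G k \<in> tpol (\<lambda>_. 2)) \<and> (\<forall>\<xi>\<in>cube. geo M e \<xi> = pfield G \<xi>))"

lemma geo_rep:
  assumes "e \<in> cells M"
  shows "geo_rep e k \<in> tpol (\<lambda>_. 2)" "\<xi> \<in> cube \<Longrightarrow> geo M e \<xi> = pfield (geo_rep e) \<xi>"
    "\<xi> \<in> cube \<Longrightarrow> geo_jac M e \<xi> = pjac (geo_rep e) \<xi>"
    "\<xi> \<in> cube \<Longrightarrow> (geo M e has_derivative (\<lambda>h. geo_jac M e \<xi> *v h)) (at \<xi> within cube)"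
proof -
  have "(\<forall>k. geo_rep e k \<in> tpol (\<lambda>_. 2)) \<and> (\<forall>\<xi>\<in>cube. geo M e \<xi> = pfield (geo_rep e) \<xi>)"
    using geometry[OF assms] unfolding tensor_poly_pfield geo_rep_def by (rule someI_ex)
  then have g: "\<And>k. geo_rep e k \<in> tpol (\<lambda>_. 2)" "\<And>\<xi>. \<xi> \<in> cube \<Longrightarrow> geo M e \<xi> = pfield (geo_rep e) \<xi>" by auto
  show "geo_rep e k \<in> tpol (\<lambda>_. 2)" "\<xi> \<in> cube \<Longrightarrow> geo M e \<xi> = pfield (geo_rep e) \<xi>" by (fact g)+
  show "\<xi> \<in> cube \<Longrightarrow> geo_jac M e \<xi> = pjac (geo_rep e) \<xi>"
    "\<xi> \<in> cube \<Longrightarrow> (geo M e has_derivative (\<lambda>h. geo_jac M e \<xi> *v h)) (at \<xi> within cube)"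
    using parent_jac_pfield[of "geo_rep e" "\<lambda>_ _. 2" "geo M e" \<xi>] g by auto
qed

definition field_rep :: "'e \<Rightarrow> (real^3 \<Rightarrow> real^3) \<Rightarrow> 3 \<Rightarrow> real^3 \<Rightarrow> real" where
  "field_rep e u = (SOME U. (\<forall>k. U k \<in> tpol (\<lambda>_. degree_of M e)) \<and> (\<forall>\<xi>\<in>cube. pullback M e u \<xi> = pfield U \<xi>))"

lemma field_rep:
  assumes "e \<in> cells M" "u \<in> conforming_fields M"
  shows "field_rep e u k \<in> tpol (\<lambda>_. degree_of M e)" "\<xi> \<in> cube \<Longrightarrow> u (geo M e \<xi>) = pfield (field_rep e u) \<xi>"
    "\<xi> \<in> cube \<Longrightarrow> jac M e u \<xi> = pjac (field_rep e u) \<xi>"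
    "\<xi> \<in> cube \<Longrightarrow> (pullback M e u has_derivative (\<lambda>h. jac M e u \<xi> *v h)) (at \<xi> within cube)"
proof -
  have "pullback M e u \<in> tensor_poly (degree_of M e)" using assms by (auto simp: conforming_fields_def)
  then have "(\<forall>k. field_rep e u k \<in> tpol (\<lambda>_. degree_of M e)) \<and> (\<forall>\<xi>\<in>cube. pullback M e u \<xi> = pfield (field_rep e u) \<xi>)"
    unfolding tensor_poly_pfield field_rep_def by (rule someI_ex)
  then have g: "\<And>k. field_rep e u k \<in> tpol (\<lambda>_. degree_of M e)" "\<And>\<xi>. \<xi> \<in> cube \<Longrightarrow> u (geo M e \<xi>) = pfield (field_rep e u) \<xi>" by auto
  show "field_rep e u k \<in> tpol (\<lambda>_. degree_of M e)" "\<xi> \<in> cube \<Longrightarrow> u (geo M e \<xi>) = pfield (field_rep e u) \<xi>" by (fact g)+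
  show "\<xi> \<in> cube \<Longrightarrow> jac M e u \<xi> = pjac (field_rep e u) \<xi>"
    "\<xi> \<in> cube \<Longrightarrow> (pullback M e u has_derivative (\<lambda>h. jac M e u \<xi> *v h)) (at \<xi> within cube)"
    using parent_jac_pfield[of "field_rep e u" "\<lambda>_ _. degree_of M e" "pullback M e u" \<xi>] g by auto
qed

lemma points_pos: "e \<in> cells M \<Longrightarrow> points M e i > 0"
  using gauss_points[of e i] by simp

lemma nodes_cube: "e \<in> cells M \<Longrightarrow> \<xi> \<in> tensor_nodes (points M e) \<Longrightarrow> \<xi> \<in> cube"
  using tensor_nodes_subset[of "points M e" \<xi>] points_pos box_subset_cbox
  unfolding cube_cbox by blast

lemma finite_cells: "finite (cells M)"
  using mesh by (simp add: conforming_mesh_def)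

lemma geo_in_closure: "e \<in> cells M \<Longrightarrow> \<xi> \<in> cube \<Longrightarrow> geo M e \<xi> \<in> closure (dom M)"
  using mesh by (auto simp: conforming_mesh_def)

lemma conforming_comb:
  assumes "u \<in> conforming_fields M" "v \<in> conforming_fields M"
  shows "(\<lambda>X. u X + s *\<^sub>R v X) \<in> conforming_fields M"
  unfolding conforming_fields_def
proof (intro CollectI conjI ballI)
  show "continuous_on (closure (dom M)) (\<lambda>X. u X + s *\<^sub>R v X)"
    using assms by (auto simp: conforming_fields_def intro!: continuous_intros)
  fix e assume e: "e \<in> cells M"
  show "pullback M e (\<lambda>X. u X + s *\<^sub>R v X) \<in> tensor_poly (degree_of M e)"
    unfolding tensor_poly_pfield
  proof (intro exI conjI allI ballI)
    show "(\<lambda>\<xi>. field_rep e u k \<xi> + s * field_rep e v k \<xi>) \<in> tpol (\<lambda>_. degree_of M e)" for k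
      by (intro tpol_add tpol_scale field_rep e assms)
    show "pullback M e (\<lambda>X. u X + s *\<^sub>R v X) \<xi> = pfield (\<lambda>k \<xi>. field_rep e u k \<xi> + s * field_rep e v k \<xi>) \<xi>"
      if "\<xi> \<in> cube" for \<xi>
      using that by (simp add: field_rep e assms pfield_def vec_eq_iff)
  qed
qed

lemma jac_comb:
  assumes "e \<in> cells M" "u \<in> conforming_fields M" "v \<in> conforming_fields M" "\<xi> \<in> cube"
  shows "jac M e (\<lambda>X. u X + s *\<^sub>R v X) \<xi> = jac M e u \<xi> + s *\<^sub>R jac M e v \<xi>"
proof (rule parent_jac_eqI)
  have "((\<lambda>\<xi>. pullback M e u \<xi> + s *\<^sub>R pullback M e v \<xi>) has_derivative
    (\<lambda>h. jac M e u \<xi> *v h + s *\<^sub>R (jac M e v \<xi> *v h))) (at \<xi> within cube)"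
    by (intro has_derivative_add has_derivative_scaleR_right field_rep(4) assms)
  then show "(pullback M e (\<lambda>X. u X + s *\<^sub>R v X) has_derivative (\<lambda>h. (jac M e u \<xi> + s *\<^sub>R jac M e v \<xi>) *v h)) (at \<xi> within cube)"
    by (simp add: o_def matrix_vector_mult_add_rdistrib scaleR_matrix_vector_assoc)
qed (fact assms)

text \<open>The identity pulls back to the cell map, which has degree 2 and so belongs to every
  local space of order p \<ge> 2.\<close>

lemma id_conforming: "(\<lambda>X. X) \<in> conforming_fields M"
  using geometry tensor_poly_mono[OF orders] by (auto simp: conforming_fields_def o_def)

lemma jac_scaled_id: "e \<in> cells M \<Longrightarrow> \<xi> \<in> cube \<Longrightarrow> jac M e (\<lambda>X. c *\<^sub>R X) \<xi> = c *\<^sub>R geo_jac M e \<xi>"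
  by (rule parent_jac_eqI)
     (use has_derivative_scaleR_right[OF geo_rep(4)] in \<open>simp_all add: o_def scaleR_matrix_vector_assoc\<close>)

lemma reference_form_eq:
  assumes "y \<in> conforming_fields M" "u \<in> conforming_fields M" "v \<in> conforming_fields M"
  shows "reference_form M z y u v =
    (\<Sum>e\<in>cells M. quad M e (\<lambda>\<xi>. frob (jac M e z \<xi>) (mcross (jac M e u \<xi>) (jac M e v \<xi>))))"
proof -
  define q where "q f = (\<Sum>e\<in>cells M. quad M e (\<lambda>\<xi>. frob (jac M e z \<xi>) (f e \<xi>)))" for f
  have "q (\<lambda>e. \<lambda>\<xi>. cof (jac M e (\<lambda>X. y X + s *\<^sub>R u X + t *\<^sub>R v X) \<xi>)) =
     q (\<lambda>e \<xi>. cof (jac M e y \<xi>)) + s * q (\<lambda>e \<xi>. mcross (jac M e y \<xi>) (jac M e u \<xi>))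
     + t * q (\<lambda>e \<xi>. mcross (jac M e y \<xi>) (jac M e v \<xi>))
     + s * t * q (\<lambda>e \<xi>. mcross (jac M e u \<xi>) (jac M e v \<xi>))
     + s\<^sup>2 * q (\<lambda>e \<xi>. cof (jac M e u \<xi>)) + t\<^sup>2 * q (\<lambda>e \<xi>. cof (jac M e v \<xi>))" for s t
  proof -
    have "q (\<lambda>e. \<lambda>\<xi>. cof (jac M e (\<lambda>X. y X + s *\<^sub>R u X + t *\<^sub>R v X) \<xi>)) =
      q (\<lambda>e \<xi>. cof (jac M e y \<xi> + s *\<^sub>R jac M e u \<xi> + t *\<^sub>R jac M e v \<xi>))"
      unfolding q_def
      by (intro sum.cong tensor_gauss_cong)
         (auto simp del: o_apply simp: jac_comb conforming_comb assms nodes_cube)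
    then show ?thesis
      unfolding cof_polar q_def
      by (simp add: frob_add frob_scale tensor_gauss_add tensor_gauss_scale sum.distrib sum_distrib_left)
  qed
  then show ?thesis
    unfolding reference_form_def q_def by (rule hessian_quadratic)
qed

lemma quad_nonneg:
  assumes "e \<in> cells M" "\<And>\<xi>. \<xi> \<in> cube \<Longrightarrow> f \<xi> \<ge> 0" shows "quad M e f \<ge> 0"
proof -
  have "quad M e (\<lambda>_. 0) \<le> quad M e f"
    by (intro tensor_gauss_mono points_pos assms) (auto intro: assms(2) nodes_cube[OF assms(1)])
  then show ?thesis by (simp add: tensor_gauss_def)
qed

text \<open>The physical gradient seen from one cell. Unlike \<open>grad\<close> it is continuous up
  to all faces of that cell.\<close>

definition disp_grad :: "'e \<Rightarrow> (real^3 \<Rightarrow> real^3) \<Rightarrow> real^3 \<Rightarrow> real^3^3" where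
  "disp_grad e u \<xi> = jac M e u \<xi> ** matrix_inv (geo_jac M e \<xi>)"

lemma disp_grad_mult: "e \<in> cells M \<Longrightarrow> \<xi> \<in> cube \<Longrightarrow> disp_grad e u \<xi> ** geo_jac M e \<xi> = jac M e u \<xi>"
  unfolding disp_grad_def matrix_mul_assoc[symmetric]
  using matrix_inv_both(2)[of "geo_jac M e \<xi>"] jac_pos[of e \<xi>] by simp

text \<open>Of the volumetric contribution only its sign matters later, so it is hidden in
  \<open>R\<close>, which is the squared first variation of the cell volume divided by the
  quadrature volume.\<close>

lemma tangent_id:
  assumes u: "u \<in> conforming_fields M"
  obtains R where "\<And>e. e \<in> cells M \<Longrightarrow> R e \<ge> 0"
    "tangent M (\<lambda>X. X) u u =
      (\<Sum>e\<in>cells M. quad M e (\<lambda>\<xi>. det (geo_jac M e \<xi>) * ((c1 M e + c2 M e) * dev_form (disp_grad e u \<xi>))))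
      + (\<Sum>e\<in>cells M. kappa M e * R e)"
proof -
  let ?J = "geo_jac M" and ?H = "\<lambda>e. disp_grad e u"
  let ?Ju = "\<lambda>e \<xi>. jac M e u \<xi>"
  define \<alpha> where "\<alpha> e = quad M e (\<lambda>\<xi>. frob (cof (?J e \<xi>)) (?Ju e \<xi>))" for e
  define \<beta> where "\<beta> e = quad M e (\<lambda>\<xi>. frob (?J e \<xi>) (cof (?Ju e \<xi>)))" for e
  define \<gamma> where "\<gamma> e = quad M e (\<lambda>\<xi>. det (?Ju e \<xi>))" for e
  define w where "w e r = r * \<alpha> e + r\<^sup>2 * \<beta> e + r ^ 3 * \<gamma> e" for e and r :: real
  have jl: "jac M e (\<lambda>X. X + r *\<^sub>R u X) \<xi> = ?J e \<xi> + r *\<^sub>R ?Ju e \<xi>" if "e \<in> cells M" "\<xi> \<in> cube" for e r \<xi>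
    using jac_comb[OF that(1) id_conforming u that(2), of r] by (simp add: o_def)
  have dl: "defgrad M e (\<lambda>X. X + r *\<^sub>R u X) \<xi> = mat 1 + r *\<^sub>R ?H e \<xi>" if "e \<in> cells M" "\<xi> \<in> cube" for e r \<xi>
    using jac_pos[OF that]
    by (simp add: defgrad_def jl[OF that] matrix_add_rdistrib matrix_inv_both disp_grad_def flip: scalar_matrix_assoc)
  have vl: "volume_change M e (\<lambda>X. X + r *\<^sub>R u X) = w e r" if "e \<in> cells M" for e r
  proof -
    have "volume_change M e (\<lambda>X. X + r *\<^sub>R u X) =
      quad M e (\<lambda>\<xi>. r * frob (cof (?J e \<xi>)) (?Ju e \<xi>) + r\<^sup>2 * frob (?J e \<xi>) (cof (?Ju e \<xi>)) + r ^ 3 * det (?Ju e \<xi>))"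
      unfolding volume_change_def
      by (rule tensor_gauss_cong) (simp add: jl[OF that nodes_cube[OF that]] det_pencil del: o_apply)
    then show ?thesis by (simp add: tensor_gauss_add tensor_gauss_scale w_def \<alpha>_def \<beta>_def \<gamma>_def)
  qed
  define \<phi> where "\<phi> r = (\<Sum>e\<in>cells M. quad M e (\<lambda>\<xi>. det (?J e \<xi>) * W_iso M e (mat 1 + r *\<^sub>R ?H e \<xi>))) +
     (\<Sum>e\<in>cells M. kappa M e / (2 * quad_volume M e) * (w e r)\<^sup>2)" for r
  have E: "energy M (\<lambda>X. X + r *\<^sub>R u X) = \<phi> r" for r
    unfolding energy_def \<phi>_def
    by (intro arg_cong2[of _ _ _ _ "(+)"] sum.cong tensor_gauss_cong) (simp_all add: dl nodes_cube vl)
  have "second_deriv0 (\<lambda>r. (w e r)\<^sup>2) (2 * (\<alpha> e)\<^sup>2)" for e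
  proof -
    define w' where "w' r = \<alpha> e + 2 * r * \<beta> e + 3 * r\<^sup>2 * \<gamma> e" for r
    have "second_deriv0 (\<lambda>r. (w e r)\<^sup>2) (2 * (w' 0)\<^sup>2)"
    proof (rule second_deriv0_square)
      show "(w e has_real_derivative w' r) (at r)" for r
        unfolding w_def w'_def by (auto intro!: derivative_eq_intros)
      show "(w' has_real_derivative 2 * \<beta> e) (at 0)"
        unfolding w'_def by (auto intro!: derivative_eq_intros)
    qed (simp add: w_def)
    then show ?thesis by (simp add: w'_def)
  qed
  then have "second_deriv0 \<phi> ((\<Sum>e\<in>cells M. quad M e (\<lambda>\<xi>. det (?J e \<xi>) * ((c1 M e + c2 M e) * dev_form (?H e \<xi>))))
     + (\<Sum>e\<in>cells M. kappa M e / (2 * quad_volume M e) * (2 * (\<alpha> e)\<^sup>2)))"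
    unfolding \<phi>_def
    by (intro second_deriv0_add second_deriv0_sum second_deriv0_cmult second_deriv0_tensor_gauss second_deriv0_W_iso)
  from hessian_radial[OF E this]
  have h: "tangent M (\<lambda>X. X) u u = (\<Sum>e\<in>cells M. quad M e (\<lambda>\<xi>. det (?J e \<xi>) * ((c1 M e + c2 M e) * dev_form (?H e \<xi>))))
     + (\<Sum>e\<in>cells M. kappa M e / (2 * quad_volume M e) * (2 * (\<alpha> e)\<^sup>2))"
    by (simp add: tangent_def)
  show thesis
  proof
    have "quad_volume M e \<ge> 0" if "e \<in> cells M" for e
      unfolding quad_volume_def by (intro quad_nonneg that less_imp_le jac_pos)
    then show "1 / (2 * quad_volume M e) * (2 * (\<alpha> e)\<^sup>2) \<ge> 0" if "e \<in> cells M" for e using that by simp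
  qed (use h in simp)
qed

lemma lifted_tangent_id_ge:
  assumes u: "u \<in> conforming_fields M"
    and kappa: "\<And>e. e \<in> cells M \<Longrightarrow> kappa M e \<ge> 0"
    and c: "\<And>e. e \<in> cells M \<Longrightarrow> c \<le> c1 M e + c2 M e" "0 \<le> c0" "c0 \<le> c"
  shows "lifted_tangent M (\<lambda>X. (2 * c) *\<^sub>R X) (\<lambda>X. X) u u \<ge>
    2 * c0 * (\<Sum>e\<in>cells M. quad M e (\<lambda>\<xi>. det (geo_jac M e \<xi>) * (norm (disp_grad e u \<xi>))\<^sup>2))"
proof -
  let ?J = "geo_jac M" and ?H = "\<lambda>e. disp_grad e u"
  obtain R where R: "\<And>e. e \<in> cells M \<Longrightarrow> R e \<ge> 0"
    "tangent M (\<lambda>X. X) u u =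
      (\<Sum>e\<in>cells M. quad M e (\<lambda>\<xi>. det (?J e \<xi>) * ((c1 M e + c2 M e) * dev_form (?H e \<xi>))))
      + (\<Sum>e\<in>cells M. kappa M e * R e)"
    using tangent_id[OF u] by blast
  have ref: "reference_form M (\<lambda>X. (2 * c) *\<^sub>R X) (\<lambda>X. X) u u =
      (\<Sum>e\<in>cells M. quad M e (\<lambda>\<xi>. det (?J e \<xi>) * (4 * c * trace (cof (?H e \<xi>)))))"
    unfolding reference_form_eq[OF id_conforming u u]
  proof (intro sum.cong refl tensor_gauss_cong)
    fix e \<xi> assume e: "e \<in> cells M" and "\<xi> \<in> tensor_nodes (points M e)"
    then have \<xi>: "\<xi> \<in> cube" by (rule nodes_cube)
    show "frob (jac M e (\<lambda>X. (2 * c) *\<^sub>R X) \<xi>) (mcross (jac M e u \<xi>) (jac M e u \<xi>)) =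
        det (?J e \<xi>) * (4 * c * trace (cof (?H e \<xi>)))"
      unfolding jac_scaled_id[OF e \<xi>] mcross_self disp_grad_mult[OF e \<xi>, of u, symmetric] frob_scale frob_cof_mult by simp
  qed
  have "2 * c0 * (\<Sum>e\<in>cells M. quad M e (\<lambda>\<xi>. det (?J e \<xi>) * (norm (?H e \<xi>))\<^sup>2)) =
     (\<Sum>e\<in>cells M. quad M e (\<lambda>\<xi>. det (?J e \<xi>) * (2 * c0 * (norm (?H e \<xi>))\<^sup>2)))"
    by (simp add: sum_distrib_left tensor_gauss_scale[symmetric] mult_ac)
  also have "\<dots> \<le> (\<Sum>e\<in>cells M. quad M e (\<lambda>\<xi>. det (?J e \<xi>) * ((c1 M e + c2 M e) * dev_form (?H e \<xi>) + 4 * c * trace (cof (?H e \<xi>)))))"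
  proof (intro sum_mono tensor_gauss_mono points_pos mult_left_mono)
    fix e \<xi> assume e: "e \<in> cells M" and "\<xi> \<in> tensor_nodes (points M e)"
    then have \<xi>: "\<xi> \<in> cube" by (auto intro: nodes_cube)
    show "0 \<le> det (?J e \<xi>)" using jac_pos[OF e \<xi>] by simp
    have "2 * c0 * (norm (?H e \<xi>))\<^sup>2 \<le> 2 * c * (norm (?H e \<xi>))\<^sup>2"
      using c by (intro mult_right_mono) auto
    also have "\<dots> \<le> c * (2 / 3 * (trace (?H e \<xi>))\<^sup>2 + 2 * (norm (?H e \<xi>))\<^sup>2)"
      using c by (simp add: algebra_simps)
    \<comment> \<open>The term -4 c tr cof H inside c \<open>dev_form\<close> cancels. This match
      dictates the scaling 2 c of the potential, since \<open>mcross\<close> of a matrix with itself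
      doubles the cofactor once more.\<close>
    also have "\<dots> = c * dev_form (?H e \<xi>) + 4 * c * trace (cof (?H e \<xi>))"
      by (simp add: dev_form_def frob_norm algebra_simps)
    also have "\<dots> \<le> (c1 M e + c2 M e) * dev_form (?H e \<xi>) + 4 * c * trace (cof (?H e \<xi>))"
      using mult_right_mono[OF c(1)[OF e] dev_form_nonneg, of "?H e \<xi>"] by simp
    finally show "2 * c0 * (norm (?H e \<xi>))\<^sup>2 \<le> (c1 M e + c2 M e) * dev_form (?H e \<xi>) + 4 * c * trace (cof (?H e \<xi>))" .
  qed
  also have "\<dots> = lifted_tangent M (\<lambda>X. (2 * c) *\<^sub>R X) (\<lambda>X. X) u u - (\<Sum>e\<in>cells M. kappa M e * R e)"
    by (simp add: lifted_tangent_def R(2) ref distrib_left tensor_gauss_add sum.distrib)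
  also have "\<dots> \<le> lifted_tangent M (\<lambda>X. (2 * c) *\<^sub>R X) (\<lambda>X. X) u u"
    using R(1) kappa by (simp add: sum_nonneg)
  finally show ?thesis .
qed

lemma quad_defect_scaled_geo:
  assumes e: "e \<in> cells M" and "u \<in> tensor_poly (degree_of M e)" "v \<in> tensor_poly (degree_of M e)"
  shows "quad_defect M e (pullback M e (\<lambda>X. c *\<^sub>R X)) u v = 0"
proof -
  obtain U where U: "\<And>k. U k \<in> tpol (\<lambda>_. degree_of M e)" "\<And>\<xi>. \<xi> \<in> cube \<Longrightarrow> u \<xi> = pfield U \<xi>"
    using assms(2) unfolding tensor_poly_pfield by blast
  obtain V where V: "\<And>k. V k \<in> tpol (\<lambda>_. degree_of M e)" "\<And>\<xi>. \<xi> \<in> cube \<Longrightarrow> v \<xi> = pfield V \<xi>"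
    using assms(3) unfolding tensor_poly_pfield by blast
  let ?f = "\<lambda>\<xi>. frob (parent_jac (pullback M e (\<lambda>X. c *\<^sub>R X)) \<xi>) (mcross (parent_jac u \<xi>) (parent_jac v \<xi>))"
  let ?g = "\<lambda>\<xi>. c * frob (pjac (geo_rep e) \<xi>) (mcross (pjac U \<xi>) (pjac V \<xi>))"
  have fg: "?f \<xi> = ?g \<xi>" if "\<xi> \<in> cube" for \<xi>
    using that jac_scaled_id[OF e that, of c] parent_jac_pfield(1)[OF U that] parent_jac_pfield(1)[OF V that]
    by (simp add: geo_rep(3)[OF e] frob_scale)
  have g: "?g \<in> tpol (\<lambda>_. 2 * degree_of M e + 1)"
    using orders[OF e] by (intro tpol_scale tpol_frob_mcross geo_rep[OF e] U V) auto
  have n: "2 * degree_of M e + 1 \<le> 2 * points M e i - 1" for i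
    using gauss_points[OF e, of i] by linarith
  have "quad M e ?f = quad M e ?g"
    by (rule tensor_gauss_cong) (rule fg[OF nodes_cube[OF e]])
  also have "\<dots> = integral cube ?g"
    by (rule tensor_gauss_exact[OF g points_pos[OF e] n])
  also have "\<dots> = integral cube ?f"
    by (rule integral_cong) (use fg in simp)
  finally show ?thesis by (simp add: quad_defect_def Let_def)
qed

lemma quad_norm_jac:
  assumes e: "e \<in> cells M" and u: "u \<in> conforming_fields M"
  shows "quad M e (\<lambda>\<xi>. (norm (jac M e u \<xi>))\<^sup>2) = integral cube (\<lambda>\<xi>. (norm (jac M e u \<xi>))\<^sup>2)"
proof -
  let ?g = "\<lambda>\<xi>. (norm (pjac (field_rep e u) \<xi>))\<^sup>2"
  have n: "degree_of M e + degree_of M e \<le> 2 * points M e i - 1" for i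
    using gauss_points[OF e, of i] by linarith
  have "quad M e (\<lambda>\<xi>. (norm (jac M e u \<xi>))\<^sup>2) = quad M e ?g"
    by (rule tensor_gauss_cong) (use field_rep(3)[OF e u nodes_cube[OF e]] in simp)
  also have "\<dots> = integral cube ?g"
    by (rule tensor_gauss_exact[OF tpol_norm_pjac[OF field_rep(1)[OF e u]] points_pos[OF e] n])
  also have "\<dots> = integral cube (\<lambda>\<xi>. (norm (jac M e u \<xi>))\<^sup>2)"
    by (rule integral_cong) (use field_rep(3)[OF e u] in simp)
  finally show ?thesis .
qed

end

section \<open>Local inverses of the cell maps\<close>

lemma pjac_continuous:
  assumes "\<And>k. U k \<in> tpol (d k)" shows "continuous_on S (pjac U)"
  unfolding pjac_def
  by (intro continuous_on_vec_lambda, rule tpol_continuous, rule tpol_pd, rule assms)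

lemma continuous_on_entry: "continuous_on S A \<Longrightarrow> continuous_on S (\<lambda>x. A x $ i $ j)"
  for A :: "'a::topological_space \<Rightarrow> real^'n^'m"
  by (intro continuous_on_component)

lemma continuous_on_matrixI:
  fixes A :: "'a::topological_space \<Rightarrow> real^'n^'m"
  assumes "\<And>i j. continuous_on S (\<lambda>x. A x $ i $ j)" shows "continuous_on S A"
proof -
  have "continuous_on S (\<lambda>x. A x $ i)" for i
    using continuous_on_vec_lambda[of S "\<lambda>j x. A x $ i $ j"] assms by simp
  then show ?thesis using continuous_on_vec_lambda[of S "\<lambda>i x. A x $ i"] by simp
qed

lemma det3_continuous: "continuous_on S A \<Longrightarrow> continuous_on S (\<lambda>x. det (A x))"
  for A :: "'a::topological_space \<Rightarrow> real^3^3"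
  unfolding det_3
  by (rule continuous_on_add continuous_on_diff continuous_on_mult continuous_on_entry | assumption)+

lemma cof_continuous: "continuous_on S A \<Longrightarrow> continuous_on S (\<lambda>x. cof (A x))"
  by (rule continuous_on_matrixI, unfold cof_nth)
     (rule continuous_on_diff continuous_on_mult continuous_on_entry | assumption)+

lemma transpose_continuous: "continuous_on S A \<Longrightarrow> continuous_on S (\<lambda>x. transpose (A x))"
  for A :: "'a::topological_space \<Rightarrow> real^'n^'m"
  by (rule continuous_on_matrixI) (simp add: transpose_def continuous_on_entry)

lemma matrix_mult_continuous:
  fixes A :: "'a::topological_space \<Rightarrow> real^'n^'m" and B :: "'a \<Rightarrow> real^'k^'n"
  shows "continuous_on S A \<Longrightarrow> continuous_on S B \<Longrightarrow> continuous_on S (\<lambda>x. A x ** B x)"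
  by (rule continuous_on_matrixI)
     (simp add: matrix_matrix_mult_def continuous_on_entry continuous_on_sum continuous_on_mult)

lemma compact_cube: "compact cube"
  by (simp add: cube_cbox compact_cbox)

lemma ocube_subset: "ocube \<subseteq> cube"
  unfolding cube_cbox by (rule box_subset_cbox)

text \<open>The polynomial map is a local diffeomorphism even at boundary points of the cube. A
  local inverse alone does not decide membership in the image of the cube, because far away points
  of the cube might come back; shrinking the neighbourhood excludes this.\<close>

lemma polynomial_chart:
  assumes G: "\<And>k. G k \<in> tpol (d k)" and inj: "inj_on (pfield G) cube"
    and \<xi>: "\<xi> \<in> cube" and det: "det (pjac G \<xi>) \<noteq> 0"
  obtains V \<Phi> where "open V" "pfield G \<xi> \<in> V" "continuous_on V \<Phi>"
    "(\<Phi> has_derivative (\<lambda>h. matrix_inv (pjac G \<xi>) *v h)) (at (pfield G \<xi>))" "\<Phi> (pfield G \<xi>) = \<xi>"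
    "\<And>y. y \<in> V \<Longrightarrow> pfield G (\<Phi> y) = y" "\<And>y. y \<in> V \<Longrightarrow> y \<in> pfield G ` cube \<longleftrightarrow> \<Phi> y \<in> cube"
proof -
  let ?f = "pfield G"
  define f' where "f' x = Blinfun (\<lambda>h. pjac G x *v h)" for x
  have app: "blinfun_apply (f' x) = (\<lambda>h. pjac G x *v h)" for x
    unfolding f'_def by (rule bounded_linear_Blinfun_apply) (rule matrix_vector_mul_bounded_linear)
  have "continuous_on UNIV (\<lambda>x. pjac G x *v h)" for h
    unfolding matrix_vector_mult_def
    by (intro continuous_intros continuous_on_vec_lambda pjac_continuous[of G d] G)
  then have cont: "continuous_on UNIV f'"
    by (intro continuous_on_blinfun_componentwise) (simp add: app)
  define B where "B = Blinfun (\<lambda>h. matrix_inv (pjac G \<xi>) *v h)"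
  have Bapp: "blinfun_apply B = (\<lambda>h. matrix_inv (pjac G \<xi>) *v h)"
    unfolding B_def by (rule bounded_linear_Blinfun_apply) (rule matrix_vector_mul_bounded_linear)
  have inv: "B o\<^sub>L f' \<xi> = id_blinfun"
    by (rule blinfun_eqI) (simp add: Bapp app matrix_vector_mul_assoc matrix_inv_both det)
  have der: "\<And>x. (?f has_derivative blinfun_apply (f' x)) (at x)"
    using pfield_has_derivative[of G d, OF G] by (simp add: app)
  obtain U' V0 g g' where U': "open U'" "U' \<subseteq> UNIV" "\<xi> \<in> U'" "open V0" "?f \<xi> \<in> V0" "homeomorphism U' V0 ?f g"
    and g': "\<And>y. y \<in> V0 \<Longrightarrow> (g has_derivative (g' y)) (at y)"
      "\<And>y. y \<in> V0 \<Longrightarrow> g' y = inv (blinfun_apply (f' (g y)))"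
      "\<And>y. y \<in> V0 \<Longrightarrow> bij (blinfun_apply (f' (g y)))"
    by (rule inverse_function_theorem[OF open_UNIV der cont UNIV_I inv], rule that)
  have gf: "g (?f x) = x" if "x \<in> U'" for x using U'(6) that by (simp add: homeomorphism_def)
  have fg: "?f (g y) = y" "g y \<in> U'" if "y \<in> V0" for y using U'(6) that by (auto simp: homeomorphism_def)
  \<comment> \<open>The part of the cube outside the local neighbourhood has a compact image, and by
    injectivity that image misses the point under consideration.\<close>
  define W where "W = - (?f ` (cube - U'))"
  have "compact (cube - U')" using compact_cube U'(1) by (rule compact_diff)
  moreover have "continuous_on (cube - U') ?f"
    using pfield_has_derivative[of G d, OF G] by (rule has_derivative_continuous_on)
  ultimately have "closed (?f ` (cube - U'))" by (intro compact_imp_closed compact_continuous_image)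
  then have W: "open W" unfolding W_def by (rule open_Compl)
  have \<xi>W: "?f \<xi> \<in> W" using inj \<xi> U'(3) by (auto simp: W_def inj_on_def)
  show thesis
  proof
    show "open (V0 \<inter> W)" using W U' by auto
    show "?f \<xi> \<in> V0 \<inter> W" using \<xi>W U' by auto
    show "continuous_on (V0 \<inter> W) g"
      using U'(6) by (auto simp: homeomorphism_def intro: continuous_on_subset)
    show "g (?f \<xi>) = \<xi>" by (rule gf) fact
    have "inv (\<lambda>h. pjac G \<xi> *v h) = (\<lambda>h. matrix_inv (pjac G \<xi>) *v h)"
      by (rule inv_equality) (simp_all add: matrix_vector_mul_assoc matrix_inv_both det)
    then show "(g has_derivative (\<lambda>h. matrix_inv (pjac G \<xi>) *v h)) (at (?f \<xi>))"
      using g'(1,2)[OF U'(5)] gf[OF U'(3)] by (simp add: app)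
    show "?f (g y) = y" if "y \<in> V0 \<inter> W" for y using that fg by auto
    show "y \<in> ?f ` cube \<longleftrightarrow> g y \<in> cube" if y: "y \<in> V0 \<inter> W" for y
    proof
      assume "y \<in> ?f ` cube"
      then obtain \<eta> where "\<eta> \<in> cube" "y = ?f \<eta>" by auto
      moreover then have "\<eta> \<in> U'" using y by (auto simp: W_def)
      ultimately show "g y \<in> cube" using gf by auto
    next
      assume "g y \<in> cube" then show "y \<in> ?f ` cube" using fg y by (metis IntD1 imageI)
    qed
  qed
qed

context fe_mesh
begin

lemma inj_geo: "e \<in> cells M \<Longrightarrow> inj_on (geo M e) cube"
  using mesh by (simp add: conforming_mesh_def)

lemma geo_continuous: "e \<in> cells M \<Longrightarrow> continuous_on cube (geo M e)"
  by (rule has_derivative_continuous_on) (rule geo_rep(4))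

lemma compact_cell: "e \<in> cells M \<Longrightarrow> compact (geo M e ` cube)"
  by (intro compact_continuous_image geo_continuous compact_cube)

lemma cell_chart:
  assumes e: "e \<in> cells M" and \<xi>: "\<xi> \<in> cube"
  obtains V \<Phi> where "open V" "geo M e \<xi> \<in> V" "continuous_on V \<Phi>"
    "(\<Phi> has_derivative (\<lambda>h. matrix_inv (geo_jac M e \<xi>) *v h)) (at (geo M e \<xi>))" "\<Phi> (geo M e \<xi>) = \<xi>"
    "\<And>y. y \<in> V \<Longrightarrow> \<Phi> y \<in> cube \<Longrightarrow> geo M e (\<Phi> y) = y"
    "\<And>y. y \<in> V \<Longrightarrow> y \<in> geo M e ` cube \<longleftrightarrow> \<Phi> y \<in> cube"
proof -
  note g = geo_rep[OF e]
  have "inj_on (pfield (geo_rep e)) cube" using inj_geo[OF e] by (simp add: inj_on_def g(2))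
  moreover have "det (pjac (geo_rep e) \<xi>) \<noteq> 0" using jac_pos[OF e \<xi>] g(3)[OF \<xi>] by simp
  ultimately obtain V \<Phi> where c: "open V" "pfield (geo_rep e) \<xi> \<in> V" "continuous_on V \<Phi>"
    "(\<Phi> has_derivative (\<lambda>h. matrix_inv (pjac (geo_rep e) \<xi>) *v h)) (at (pfield (geo_rep e) \<xi>))" "\<Phi> (pfield (geo_rep e) \<xi>) = \<xi>"
    "\<And>y. y \<in> V \<Longrightarrow> pfield (geo_rep e) (\<Phi> y) = y" "\<And>y. y \<in> V \<Longrightarrow> y \<in> pfield (geo_rep e) ` cube \<longleftrightarrow> \<Phi> y \<in> cube"
    using polynomial_chart[of "geo_rep e" "\<lambda>_ _. 2" \<xi>] g(1) \<xi> by blast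
  have im: "pfield (geo_rep e) ` cube = geo M e ` cube" by (intro image_cong) (auto simp: g(2))
  show thesis
  proof
    note c' = c[unfolded im, folded g(2)[OF \<xi>] g(3)[OF \<xi>]]
    show "open V" "geo M e \<xi> \<in> V" "continuous_on V \<Phi>"
      "(\<Phi> has_derivative (\<lambda>h. matrix_inv (geo_jac M e \<xi>) *v h)) (at (geo M e \<xi>))" "\<Phi> (geo M e \<xi>) = \<xi>"
      by (fact c')+
    show "y \<in> geo M e ` cube \<longleftrightarrow> \<Phi> y \<in> cube" if "y \<in> V" for y using that by (rule c'(7))
    show "geo M e (\<Phi> y) = y" if "y \<in> V" "\<Phi> y \<in> cube" for y
      by (rule trans[OF g(2)[OF that(2)] c(6)[OF that(1)]])
  qed
qed

lemma cell_derivative: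
  assumes e: "e \<in> cells M" and \<xi>: "\<xi> \<in> cube" and u: "u \<in> conforming_fields M"
  shows "(u has_derivative (\<lambda>h. disp_grad e u \<xi> *v h)) (at (geo M e \<xi>) within geo M e ` cube)"
proof -
  obtain V \<Phi> where c: "open V" "geo M e \<xi> \<in> V"
    "(\<Phi> has_derivative (\<lambda>h. matrix_inv (geo_jac M e \<xi>) *v h)) (at (geo M e \<xi>))" "\<Phi> (geo M e \<xi>) = \<xi>"
    "\<And>y. y \<in> V \<Longrightarrow> \<Phi> y \<in> cube \<Longrightarrow> geo M e (\<Phi> y) = y"
    "\<And>y. y \<in> V \<Longrightarrow> y \<in> geo M e ` cube \<longleftrightarrow> \<Phi> y \<in> cube"
    using cell_chart[OF e \<xi>] by metis
  obtain r where r: "r > 0" "ball (geo M e \<xi>) r \<subseteq> V" using c(1,2) openE by blast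
  have "(pfield (field_rep e u) has_derivative (\<lambda>h. jac M e u \<xi> *v h)) (at (\<Phi> (geo M e \<xi>)))"
    using pfield_has_derivative[of "field_rep e u" "\<lambda>_ _. degree_of M e"] field_rep(1)[OF e u] field_rep(3)[OF e u \<xi>]
    by (simp add: c(4))
  from has_derivative_compose[OF c(3) this]
  have "((\<lambda>y. pfield (field_rep e u) (\<Phi> y)) has_derivative (\<lambda>h. disp_grad e u \<xi> *v h)) (at (geo M e \<xi>) within geo M e ` cube)"
    unfolding disp_grad_def matrix_vector_mul_assoc by (rule has_derivative_at_withinI)
  then show ?thesis
  proof (rule has_derivative_transform_within[OF _ r(1)])
    fix y assume y: "y \<in> geo M e ` cube" "dist y (geo M e \<xi>) < r"
    then have "y \<in> V" using r by (auto simp: dist_commute)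
    moreover from this have "\<Phi> y \<in> cube" using c(6) y(1) by blast
    ultimately show "pfield (field_rep e u) (\<Phi> y) = u y" using field_rep(2)[OF e u, of "\<Phi> y"] c(5) by simp
  qed (use \<xi> in auto)
qed

text \<open>Near the point the closure of the domain is this cell alone. Uniqueness of the
  derivative within that closed set, possibly at a boundary point, is inherited from the cube by
  composing with the cell map.\<close>

lemma grad_eq:
  assumes e: "e \<in> cells M" and \<xi>: "\<xi> \<in> cube" and u: "u \<in> conforming_fields M"
    and V: "open V" "geo M e \<xi> \<in> V" "closure (dom M) \<inter> V \<subseteq> geo M e ` cube"
  shows "grad M u (geo M e \<xi>) = disp_grad e u \<xi>"
proof -
  let ?X = "geo M e \<xi>"
  have sub: "geo M e ` cube \<subseteq> closure (dom M)" using geo_in_closure[OF e] by auto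
  have "at ?X within closure (dom M) = at ?X within geo M e ` cube"
    by (rule at_within_nhd[OF V(2,1)]) (use V(3) sub in blast)
  then have "(u has_derivative (\<lambda>h. disp_grad e u \<xi> *v h)) (at ?X within closure (dom M))"
    using cell_derivative[OF e \<xi> u] by simp
  then have w: "(u has_derivative frechet_derivative u (at ?X within closure (dom M))) (at ?X within closure (dom M))"
    using frechet_derivative_works Derivative.differentiableI by blast
  then have D: "(u has_derivative (\<lambda>h. grad M u ?X *v h)) (at ?X within closure (dom M))"
    unfolding grad_def using w by (simp add: has_derivative_linear[OF w])
  have "(pullback M e u has_derivative (\<lambda>h. grad M u ?X *v h) \<circ> (\<lambda>h. geo_jac M e \<xi> *v h)) (at \<xi> within cube)"
    using diff_chain_within[OF geo_rep(4)[OF e \<xi>] has_derivative_subset[OF D sub]] .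
  then have "jac M e u \<xi> = grad M u ?X ** geo_jac M e \<xi>"
    by (intro parent_jac_eqI \<xi>) (simp add: o_def matrix_vector_mul_assoc)
  then show ?thesis
    using matrix_inv_both(1)[of "geo_jac M e \<xi>"] jac_pos[OF e \<xi>]
    by (simp add: disp_grad_def flip: matrix_mul_assoc)
qed

lemma cell_interior_nhd:
  assumes e: "e \<in> cells M" and \<xi>: "\<xi> \<in> ocube"
  obtains V where "open V" "geo M e \<xi> \<in> V" "V \<subseteq> geo M e ` ocube"
proof -
  have \<xi>': "\<xi> \<in> cube" using \<xi> ocube_subset by auto
  obtain V \<Phi> where c: "open V" "geo M e \<xi> \<in> V" "continuous_on V \<Phi>" "\<Phi> (geo M e \<xi>) = \<xi>"
    "\<And>y. y \<in> V \<Longrightarrow> \<Phi> y \<in> cube \<Longrightarrow> geo M e (\<Phi> y) = y"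
    using cell_chart[OF e \<xi>'] by metis
  show thesis
  proof
    show "open (V \<inter> \<Phi> -` ocube)" by (rule continuous_open_preimage[OF c(3,1) open_box])
    show "V \<inter> \<Phi> -` ocube \<subseteq> geo M e ` ocube"
    proof
      fix y assume "y \<in> V \<inter> \<Phi> -` ocube"
      then have "y = geo M e (\<Phi> y)" "\<Phi> y \<in> ocube" using c(5) ocube_subset by auto
      then show "y \<in> geo M e ` ocube" by blast
    qed
  qed (use c \<xi> in auto)
qed

lemma grad_interior:
  assumes e: "e \<in> cells M" and \<xi>: "\<xi> \<in> ocube" and u: "u \<in> conforming_fields M"
  shows "grad M u (geo M e \<xi>) = disp_grad e u \<xi>"
proof -
  obtain V where "open V" "geo M e \<xi> \<in> V" "V \<subseteq> geo M e ` ocube" using cell_interior_nhd[OF e \<xi>] .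
  moreover have "\<xi> \<in> cube" using \<xi> ocube_subset by auto
  ultimately show ?thesis
    using grad_eq[OF e _ u, of \<xi> V] ocube_subset by (meson image_mono inf_le2 order.trans)
qed

lemma geo_jac_continuous: "e \<in> cells M \<Longrightarrow> continuous_on cube (geo_jac M e)"
  using continuous_on_cong[of cube cube "geo_jac M e" "pjac (geo_rep e)"]
    pjac_continuous[of "geo_rep e" "\<lambda>_ _. 2"] geo_rep by simp

lemma jac_continuous: "e \<in> cells M \<Longrightarrow> u \<in> conforming_fields M \<Longrightarrow> continuous_on cube (jac M e u)"
  using continuous_on_cong[of cube cube "jac M e u" "pjac (field_rep e u)"]
    pjac_continuous[of "field_rep e u" "\<lambda>_ _. degree_of M e"] field_rep by simp

lemma disp_grad_continuous:
  assumes e: "e \<in> cells M" and u: "u \<in> conforming_fields M" shows "continuous_on cube (disp_grad e u)"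
proof -
  have "continuous_on cube (\<lambda>\<xi>. inverse (det (geo_jac M e \<xi>)))"
    by (rule continuous_on_inverse[OF det3_continuous[OF geo_jac_continuous[OF e]]]) (use jac_pos[OF e] in force)
  then have "continuous_on cube (\<lambda>\<xi>. jac M e u \<xi> ** (inverse (det (geo_jac M e \<xi>)) *\<^sub>R transpose (cof (geo_jac M e \<xi>))))"
    by (intro matrix_mult_continuous jac_continuous e u continuous_on_scaleR transpose_continuous cof_continuous geo_jac_continuous)
  moreover have "disp_grad e u \<xi> = jac M e u \<xi> ** (inverse (det (geo_jac M e \<xi>)) *\<^sub>R transpose (cof (geo_jac M e \<xi>)))" if "\<xi> \<in> cube" for \<xi>
    using matrix_inv_cof jac_pos[OF e that] by (simp add: disp_grad_def)
  ultimately show ?thesis by (subst continuous_on_cong) auto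
qed

section \<open>Comparison of the physical and the parent energy of a variation\<close>

lemma grad_integral_cell:
  assumes e: "e \<in> cells M" and u: "u \<in> conforming_fields M"
  shows "(\<lambda>X. (norm (grad M u X))\<^sup>2) absolutely_integrable_on (geo M e ` cube)"
    and "integral (geo M e ` cube) (\<lambda>X. (norm (grad M u X))\<^sup>2) =
      integral cube (\<lambda>\<xi>. det (geo_jac M e \<xi>) * (norm (disp_grad e u \<xi>))\<^sup>2)"
proof -
  \<comment> \<open>The change of variables theorem speaks of functions into \<open>real^'n\<close>,
    hence the detour through \<open>real^1\<close>.\<close>
  let ?f = "\<lambda>X. vec ((norm (grad M u X))\<^sup>2) :: real^1"
  let ?h = "\<lambda>\<xi>. det (geo_jac M e \<xi>) * (norm (disp_grad e u \<xi>))\<^sup>2"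
  let ?g = "\<lambda>\<xi>. \<bar>det (matrix (\<lambda>h. geo_jac M e \<xi> *v h))\<bar> *\<^sub>R ?f (geo M e \<xi>)"
  \<comment> \<open>\<open>grad\<close> is identified on the images of the open cube; the remaining
    faces form a null set.\<close>
  have neg: "negligible (cube - ocube)" unfolding cube_cbox by (rule negligible_frontier_interval)
  have eq: "?g \<xi> $ 1 = ?h \<xi>" if "\<xi> \<in> cube - (cube - ocube)" for \<xi>
    using that grad_interior[OF e _ u, of \<xi>] jac_pos[OF e, of \<xi>] by (simp add: matrix_of_matrix_vector_mul)
  have "continuous_on cube ?h"
    by (intro continuous_on_mult continuous_on_power continuous_on_norm det3_continuous geo_jac_continuous disp_grad_continuous e u)
  then have "?h absolutely_integrable_on cube"
    unfolding cube_cbox by (rule absolutely_integrable_continuous)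
  then have "(\<lambda>\<xi>. ?g \<xi> $ 1) absolutely_integrable_on cube"
    by (rule absolutely_integrable_spike[OF _ neg]) (use eq in auto)
  then have a: "?g absolutely_integrable_on cube" by (subst absolutely_integrable_on_1_iff)
  have i: "integral cube (\<lambda>\<xi>. ?g \<xi> $ 1) = integral cube ?h"
    by (rule integral_spike[OF neg]) (use eq in auto)
  have "?g absolutely_integrable_on cube \<and> integral cube ?g = integral cube ?g
     \<longleftrightarrow> ?f absolutely_integrable_on (geo M e ` cube) \<and> integral (geo M e ` cube) ?f = integral cube ?g"
    by (rule has_absolute_integral_change_of_variables_compact[OF compact_cube geo_rep(4)[OF e] inj_geo[OF e]])
  then have 1: "?f absolutely_integrable_on (geo M e ` cube)" and 2: "integral (geo M e ` cube) ?f = integral cube ?g"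
    using a by auto
  show "(\<lambda>X. (norm (grad M u X))\<^sup>2) absolutely_integrable_on (geo M e ` cube)"
    using 1 by (simp add: absolutely_integrable_on_1_iff)
  show "integral (geo M e ` cube) (\<lambda>X. (norm (grad M u X))\<^sup>2) = integral cube ?h"
    using 2 i unfolding integral_on_1_eq[of _ ?f] integral_on_1_eq[of _ ?g] by (simp add: vec_eq_iff)
qed

lemma open_dom: "open (dom M)" and bounded_dom: "bounded (dom M)"
  using mesh by (auto simp: conforming_mesh_def lipschitz_domain_def)

lemma closure_cells: "closure (dom M) = (\<Union>e\<in>cells M. geo M e ` cube)"
  using mesh by (simp add: conforming_mesh_def)

lemma absolutely_integrable_on_compact:
  fixes f :: "'a::euclidean_space \<Rightarrow> 'b::euclidean_space"
  assumes "compact S" "continuous_on S f" shows "f absolutely_integrable_on S"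
proof -
  have "integrable lborel (\<lambda>x. indicator S x *\<^sub>R f x)" using assms by (rule borel_integrable_compact)
  then show ?thesis
    using integrable_completion[OF borel_measurable_integrable] by (auto simp: set_integrable_def)
qed

text \<open>For a nonnegative integrand subadditivity gives the required direction: overlaps of
  cells are merely counted several times on the right.\<close>

lemma integral_UN_le:
  fixes f :: "real^3 \<Rightarrow> real"
  assumes "finite I" "\<And>i. i \<in> I \<Longrightarrow> f absolutely_integrable_on A i" "\<And>x. f x \<ge> 0"
    "\<And>i. i \<in> I \<Longrightarrow> A i \<in> sets lebesgue"
  shows "f absolutely_integrable_on (\<Union>i\<in>I. A i) \<and> integral (\<Union>i\<in>I. A i) f \<le> (\<Sum>i\<in>I. integral (A i) f)"
  using assms
proof (induction I rule: finite_induct)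
  case (insert i I)
  let ?B = "\<Union>i\<in>I. A i"
  have B: "f absolutely_integrable_on ?B" "integral ?B f \<le> (\<Sum>i\<in>I. integral (A i) f)" using insert by auto
  have A: "f absolutely_integrable_on A i" using insert by auto
  have sets: "A i \<in> sets lebesgue" "?B \<in> sets lebesgue" using insert by auto
  have U: "f absolutely_integrable_on (A i \<union> ?B)" using A B(1) sets by (intro absolutely_integrable_Un)
  have D: "f absolutely_integrable_on (A i - ?B)"
    by (rule set_integrable_subset[OF A]) (use sets in auto)
  have "(A i - ?B) \<inter> ?B = {}" by blast
  then have "integral (A i \<union> ?B) f = integral (A i - ?B) f + integral ?B f"
    using integral_Un[of f "A i - ?B" ?B] D B(1) by (simp add: absolutely_integrable_on_def)
  moreover have "integral (A i - ?B) f \<le> integral (A i) f"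
    by (rule integral_subset_le) (use A D insert.prems(2) in \<open>auto simp: absolutely_integrable_on_def\<close>)
  ultimately show ?case using U B(2) insert.hyps by simp
qed auto

lemma integral_dom_grad_le:
  assumes u: "u \<in> conforming_fields M"
  shows "(\<lambda>X. (norm (grad M u X))\<^sup>2) absolutely_integrable_on (dom M)"
    and "integral (dom M) (\<lambda>X. (norm (grad M u X))\<^sup>2) \<le>
      (\<Sum>e\<in>cells M. integral cube (\<lambda>\<xi>. det (geo_jac M e \<xi>) * (norm (disp_grad e u \<xi>))\<^sup>2))"
proof -
  let ?f = "\<lambda>X. (norm (grad M u X))\<^sup>2"
  have "?f absolutely_integrable_on (\<Union>e\<in>cells M. geo M e ` cube) \<and>
     integral (\<Union>e\<in>cells M. geo M e ` cube) ?f \<le> (\<Sum>e\<in>cells M. integral (geo M e ` cube) ?f)"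
    by (rule integral_UN_le[OF finite_cells grad_integral_cell(1)[OF _ u]])
       (auto intro: lmeasurable_compact[OF compact_cell, THEN fmeasurableD])
  then have c: "?f absolutely_integrable_on (closure (dom M))"
     "integral (closure (dom M)) ?f \<le> (\<Sum>e\<in>cells M. integral (geo M e ` cube) ?f)"
    by (simp_all add: closure_cells)
  show d: "?f absolutely_integrable_on (dom M)"
    by (rule set_integrable_subset[OF c(1)]) (auto simp: open_dom closure_subset)
  have "integral (dom M) ?f \<le> integral (closure (dom M)) ?f"
    by (rule integral_subset_le) (use c d in \<open>auto simp: absolutely_integrable_on_def closure_subset\<close>)
  with c(2) show "integral (dom M) ?f \<le>
      (\<Sum>e\<in>cells M. integral cube (\<lambda>\<xi>. det (geo_jac M e \<xi>) * (norm (disp_grad e u \<xi>))\<^sup>2))"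
    by (simp add: grad_integral_cell(2)[OF _ u])
qed

lemma h1_norm_le:
  assumes u: "u \<in> conforming_fields M" and P: "l2_norm M u \<le> C_P * l2_norm M (grad M u)"
  shows "(h1_norm M u)\<^sup>2 \<le> (1 + C_P\<^sup>2) * integral (dom M) (\<lambda>X. (norm (grad M u X))\<^sup>2)"
proof -
  let ?a = "\<lambda>X. (norm (u X))\<^sup>2" and ?b = "\<lambda>X. (norm (grad M u X))\<^sup>2"
  have "continuous_on (closure (dom M)) ?a"
    using u by (auto simp: conforming_fields_def intro!: continuous_intros)
  then have "?a absolutely_integrable_on (closure (dom M))"
    by (intro absolutely_integrable_on_compact) (simp_all add: compact_closure bounded_dom)
  then have "?a absolutely_integrable_on (dom M)"
    by (rule set_integrable_subset) (auto simp: open_dom closure_subset)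
  then have a: "?a integrable_on dom M" by (simp add: absolutely_integrable_on_def)
  have b: "?b integrable_on dom M" using integral_dom_grad_le(1)[OF u] by (simp add: absolutely_integrable_on_def)
  have nn: "integral (dom M) ?a \<ge> 0" "integral (dom M) ?b \<ge> 0" by (auto intro!: integral_nonneg a b)
  have "(l2_norm M u)\<^sup>2 \<le> (C_P * l2_norm M (grad M u))\<^sup>2"
    by (rule power_mono[OF P]) (simp add: l2_norm_def nn)
  then have "integral (dom M) ?a \<le> C_P\<^sup>2 * integral (dom M) ?b"
    using nn by (simp add: l2_norm_def power_mult_distrib)
  moreover have "(h1_norm M u)\<^sup>2 = integral (dom M) ?a + integral (dom M) ?b"
    using nn by (simp add: h1_norm_def integral_add[OF a b])
  ultimately show ?thesis by (simp add: algebra_simps)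
qed

text \<open>The physical density is rational in \<xi>, so the rule is exact not for it but for the
  polynomial |D u|^2 on the parent cell. Passing there and back uses (a h)^3 / (b h)^2 from below at
  the nodes and (b h)^3 / (a h)^2 from above under the integral; h cancels in the quotient, which is
  (a/b)^5.\<close>

lemma quad_grad_ge:
  assumes e: "e \<in> cells M" and u: "u \<in> conforming_fields M" and ab: "0 < a" "a \<le> b" "h > 0"
    and jb: "\<And>\<xi>. \<xi> \<in> cube \<Longrightarrow> spectral_norm (geo_jac M e \<xi>) \<le> b * h"
    and jib: "\<And>\<xi>. \<xi> \<in> cube \<Longrightarrow> spectral_norm (matrix_inv (geo_jac M e \<xi>)) \<le> inverse (a * h)"
  shows "(a / b) ^ 5 * integral cube (\<lambda>\<xi>. det (geo_jac M e \<xi>) * (norm (disp_grad e u \<xi>))\<^sup>2)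
    \<le> quad M e (\<lambda>\<xi>. det (geo_jac M e \<xi>) * (norm (disp_grad e u \<xi>))\<^sup>2)"
proof -
  let ?J = "geo_jac M e" and ?H = "disp_grad e u" and ?U = "jac M e u"
  have pos: "a * h > 0" "b * h > 0" using ab by auto
  have det: "(a * h) ^ 3 \<le> det (?J \<xi>)" "det (?J \<xi>) \<le> (b * h) ^ 3" if \<xi>: "\<xi> \<in> cube" for \<xi>
  proof -
    have d: "det (?J \<xi>) > 0" using jac_pos[OF e \<xi>] .
    show "det (?J \<xi>) \<le> (b * h) ^ 3"
      using det_le_spectral[of "?J \<xi>"] power_mono[OF jb[OF \<xi>] spectral_norm_nonneg, of 3] by linarith
    \<comment> \<open>The lower bound is the upper bound for the inverse matrix, turned
      over.\<close>
    have "det (?J \<xi>) * det (matrix_inv (?J \<xi>)) = 1"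
      using matrix_inv_both(1)[of "?J \<xi>"] d by (metis det_I det_mul less_irrefl)
    then have "det (matrix_inv (?J \<xi>)) = inverse (det (?J \<xi>))" using d by (metis inverse_unique)
    then have "inverse (det (?J \<xi>)) \<le> spectral_norm (matrix_inv (?J \<xi>)) ^ 3"
      using det_le_spectral[of "matrix_inv (?J \<xi>)"] by linarith
    also have "\<dots> \<le> inverse (a * h) ^ 3" by (intro power_mono jib \<xi> spectral_norm_nonneg)
    finally have "inverse (det (?J \<xi>)) \<le> inverse ((a * h) ^ 3)" unfolding power_inverse .
    then show "(a * h) ^ 3 \<le> det (?J \<xi>)" by (rule inverse_le_imp_le) (rule d)
  qed
  have lower: "(a * h) ^ 3 / (b * h)\<^sup>2 * (norm (?U \<xi>))\<^sup>2 \<le> det (?J \<xi>) * (norm (?H \<xi>))\<^sup>2" if \<xi>: "\<xi> \<in> cube" for \<xi>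
  proof -
    have "norm (?U \<xi>) \<le> norm (?H \<xi>) * (b * h)"
      using norm_mult_spectral[of "?H \<xi>" "?J \<xi>"] mult_left_mono[OF jb[OF \<xi>] norm_ge_zero[of "?H \<xi>"]]
      by (simp add: disp_grad_mult[OF e \<xi>])
    then have "(norm (?U \<xi>))\<^sup>2 \<le> (norm (?H \<xi>))\<^sup>2 * (b * h)\<^sup>2"
      by (metis norm_ge_zero power_mono power_mult_distrib)
    then have "(norm (?U \<xi>))\<^sup>2 / (b * h)\<^sup>2 \<le> (norm (?H \<xi>))\<^sup>2" using pos by (simp add: divide_le_eq)
    then have "(a * h) ^ 3 * ((norm (?U \<xi>))\<^sup>2 / (b * h)\<^sup>2) \<le> det (?J \<xi>) * (norm (?H \<xi>))\<^sup>2"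
      using det(1)[OF \<xi>] pos by (intro mult_mono) (auto simp: jac_pos[OF e \<xi>] less_imp_le)
    then show ?thesis by simp
  qed
  have upper: "det (?J \<xi>) * (norm (?H \<xi>))\<^sup>2 \<le> (b * h) ^ 3 / (a * h)\<^sup>2 * (norm (?U \<xi>))\<^sup>2" if \<xi>: "\<xi> \<in> cube" for \<xi>
  proof -
    have "norm (?H \<xi>) \<le> norm (?U \<xi>) * inverse (a * h)"
      using norm_mult_spectral[of "?U \<xi>" "matrix_inv (?J \<xi>)"] mult_left_mono[OF jib[OF \<xi>] norm_ge_zero[of "?U \<xi>"]]
      by (simp add: disp_grad_def)
    then have "(norm (?H \<xi>))\<^sup>2 \<le> (norm (?U \<xi>))\<^sup>2 / (a * h)\<^sup>2"
      by (metis divide_inverse norm_ge_zero power_mono power_mult_distrib power_inverse)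
    then have "det (?J \<xi>) * (norm (?H \<xi>))\<^sup>2 \<le> (b * h) ^ 3 * ((norm (?U \<xi>))\<^sup>2 / (a * h)\<^sup>2)"
      using det(2)[OF \<xi>] pos by (intro mult_mono) auto
    then show ?thesis by simp
  qed
  let ?I = "integral cube (\<lambda>\<xi>. (norm (?U \<xi>))\<^sup>2)"
  have ci: "continuous_on cube (\<lambda>\<xi>. (norm (?U \<xi>))\<^sup>2)"
    by (intro continuous_on_power continuous_on_norm jac_continuous e u)
  have ch: "continuous_on cube (\<lambda>\<xi>. det (?J \<xi>) * (norm (?H \<xi>))\<^sup>2)"
    by (intro continuous_on_mult continuous_on_power continuous_on_norm det3_continuous geo_jac_continuous disp_grad_continuous e u)
  have "integral cube (\<lambda>\<xi>. det (?J \<xi>) * (norm (?H \<xi>))\<^sup>2) \<le> integral cube (\<lambda>\<xi>. (b * h) ^ 3 / (a * h)\<^sup>2 * (norm (?U \<xi>))\<^sup>2)"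
    by (intro integral_le cube_integrable ch continuous_intros ci upper)
  also have "\<dots> = (b * h) ^ 3 / (a * h)\<^sup>2 * ?I" by simp
  finally have "(a / b) ^ 5 * integral cube (\<lambda>\<xi>. det (?J \<xi>) * (norm (?H \<xi>))\<^sup>2) \<le> (a / b) ^ 5 * ((b * h) ^ 3 / (a * h)\<^sup>2 * ?I)"
    using ab by (intro mult_left_mono) auto
  also have "\<dots> = (a * h) ^ 3 / (b * h)\<^sup>2 * ?I"
  proof -
    have "(a / b) ^ 5 * ((b * h) ^ 3 / (a * h)\<^sup>2) = (a * h) ^ 3 / (b * h)\<^sup>2"
      using ab by (simp add: field_simps eval_nat_numeral)
    from arg_cong[OF this, of "\<lambda>x. x * ?I"] show ?thesis by (simp only: mult.assoc)
  qed
  also have "\<dots> = quad M e (\<lambda>\<xi>. (a * h) ^ 3 / (b * h)\<^sup>2 * (norm (?U \<xi>))\<^sup>2)"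
    by (simp only: tensor_gauss_scale quad_norm_jac[OF e u])
  also have "\<dots> \<le> quad M e (\<lambda>\<xi>. det (?J \<xi>) * (norm (?H \<xi>))\<^sup>2)"
    by (intro tensor_gauss_mono points_pos e lower nodes_cube[OF e])
  finally show ?thesis .
qed

end

section \<open>Boundary points of Lipschitz domains\<close>

text \<open>An exterior cone. In the local frame the domain lies above a Lipschitz graph, and
  directions close to straight down descend faster than the graph can.\<close>

lemma lipschitz_frontier_cone:
  assumes S: "lipschitz_domain S" and x: "x \<in> frontier S"
  obtains d0 \<delta> where "\<delta> > 0" "\<And>d. norm (d - d0) < \<delta> \<Longrightarrow> \<forall>\<^sub>F t in at_right 0. x + t *\<^sub>R d \<notin> closure S"
proof -
  obtain r L and A :: "real^3 \<Rightarrow> real^3" and \<gamma> :: "real^2 \<Rightarrow> real" where r: "r > 0" and A: "orthogonal_transformation A" and L: "L-lipschitz_on UNIV \<gamma>"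
    and loc: "\<And>y. y \<in> ball x r \<Longrightarrow> y \<in> S \<longleftrightarrow> \<gamma> (vector [A y $ 1, A y $ 2]) < A y $ 3"
    using S x unfolding lipschitz_domain_def by meson
  have lin: "linear A" using A by (rule orthogonal_transformation_linear)
  have L0: "L \<ge> 0" using L by (rule lipschitz_on_nonneg)
  define w :: "real^3 \<Rightarrow> real^2" where "w y = vector [A y $ 1, A y $ 2]" for y
  have wlin: "w (y + t *\<^sub>R d) = w y + t *\<^sub>R w d" for y d t
    by (simp add: w_def vec_eq_iff forall_2 vector_2 linear_add[OF lin] linear_scale[OF lin])
  have contA: "continuous_on UNIV A" using lin by (rule linear_continuous_on[OF linear_conv_bounded_linear[THEN iffD1]])
  have contw: "continuous_on UNIV w"
  proof -
    have "continuous_on UNIV (\<lambda>y. w y $ i)" for i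
      using exhaust_2[of i] continuous_on_component[OF contA]
      by (auto simp: w_def vector_2)
    then show ?thesis using continuous_on_vec_lambda[of UNIV "\<lambda>i y. w y $ i"] by simp
  qed
  have cont\<gamma>: "continuous_on UNIV \<gamma>" using L by (rule lipschitz_on_continuous_on)
  have "x \<notin> S" using x S by (simp add: lipschitz_domain_def frontier_def interior_open)
  then have x\<gamma>: "\<gamma> (w x) \<ge> A x $ 3" using loc[of x] r by (simp add: w_def)
  obtain d0 where d0: "A d0 = axis 3 (-1)"
    using orthogonal_transformation_surj[OF A] by (metis surjD)
  \<comment> \<open>The descent is at least 1 - \<delta> per unit, while the graph falls by at most
    2 L \<delta> along the horizontal part; this choice keeps the sum 2 L \<delta> + \<delta> below
    1.\<close>
  define \<delta> where "\<delta> = 1 / (2 * L + 2)"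
  have \<delta>: "\<delta> > 0" "2 * L * \<delta> + \<delta> < 1" using L0 by (auto simp: \<delta>_def field_simps)
  show thesis
  proof
    show "\<delta> > 0" by fact
    fix d assume d: "norm (d - d0) < \<delta>"
    have c: "\<bar>A d $ i - A d0 $ i\<bar> < \<delta>" for i
    proof -
      have "norm (A d - A d0) = norm (d - d0)"
        using orthogonal_transformation_norm[OF A] by (simp add: linear_diff[OF lin, symmetric])
      then show ?thesis using component_le_norm_cart[of "A d - A d0" i] d by simp
    qed
    have "norm (w d) \<le> \<bar>A d $ 1\<bar> + \<bar>A d $ 2\<bar>"
      using norm_le_l1_cart[of "w d"] by (simp add: sum_2 w_def vector_2)
    also have "\<dots> \<le> 2 * \<delta>" using c[of 1] c[of 2] by (simp add: d0 axis_def)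
    finally have wd: "L * norm (w d) \<le> 2 * L * \<delta>" using L0 mult_left_mono[of "norm (w d)" "2 * \<delta>" L] by simp
    have d3: "A d $ 3 < -1 + \<delta>" using c[of 3] by (simp add: d0 axis_def)
    have out: "x + t *\<^sub>R d \<notin> closure S" if t: "t > 0" "x + t *\<^sub>R d \<in> ball x r" for t
    proof -
      let ?y = "x + t *\<^sub>R d"
      have "dist (\<gamma> (w ?y)) (\<gamma> (w x)) \<le> L * dist (w ?y) (w x)"
        using L by (rule lipschitz_onD) auto
      then have "\<gamma> (w ?y) \<ge> \<gamma> (w x) - L * (t * norm (w d))"
        using t by (simp add: wlin dist_norm abs_le_iff)
      moreover have "L * (t * norm (w d)) \<le> t * (2 * L * \<delta>)"
        using mult_left_mono[OF wd, of t] t by (simp add: mult_ac)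
      moreover have "A ?y $ 3 = A x $ 3 + t * (A d $ 3)"
        by (simp add: linear_add[OF lin] linear_scale[OF lin])
      moreover have "t * (A d $ 3) + t * (2 * L * \<delta>) < 0"
        using d3 \<delta>(2) t by (simp add: mult_pos_neg flip: distrib_left)
      ultimately have y: "A ?y $ 3 < \<gamma> (w ?y)" using x\<gamma> by linarith
      \<comment> \<open>A whole open neighbourhood lies strictly below the graph, so the point
        avoids not only the domain but also its closure.\<close>
      define N where "N = ball x r \<inter> {y. A y $ 3 < \<gamma> (w y)}"
      have "open N" unfolding N_def
        by (intro open_Int open_ball open_Collect_less continuous_on_component contA
            continuous_on_compose2[OF cont\<gamma> contw]) auto
      moreover have "?y \<in> N" using y t by (simp add: N_def)
      moreover have "N \<inter> S = {}" using loc by (force simp: N_def w_def)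
      ultimately show ?thesis by (meson disjoint_iff open_Int_closure_eq_empty)
    qed
    have "((\<lambda>t. x + t *\<^sub>R d) \<longlongrightarrow> x + 0 *\<^sub>R d) (at_right 0)" by (intro tendsto_intros)
    then have "\<forall>\<^sub>F t in at_right 0. x + t *\<^sub>R d \<in> ball x r"
      using r by (intro topological_tendstoD) auto
    moreover have "\<forall>\<^sub>F t in at_right (0::real). t > 0" by (rule eventually_at_right_less)
    ultimately show "\<forall>\<^sub>F t in at_right 0. x + t *\<^sub>R d \<notin> closure S"
      by eventually_elim (rule out)
  qed
qed

text \<open>A Lipschitz domain has no slits or punctures: a frontier point interior to the closure
  would contradict the exterior cone.\<close>

lemma lipschitz_interior_closure:
  assumes S: "lipschitz_domain S" and V: "open V" "x \<in> V" "V \<subseteq> closure S"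
  shows "x \<in> S"
proof (rule ccontr)
  assume "x \<notin> S"
  then have "x \<in> frontier S" using V S by (auto simp: frontier_def lipschitz_domain_def interior_open)
  then obtain d0 \<delta> where d: "\<delta> > 0" "\<And>d. norm (d - d0) < \<delta> \<Longrightarrow> \<forall>\<^sub>F t in at_right 0. x + t *\<^sub>R d \<notin> closure S"
    using lipschitz_frontier_cone[OF S] by metis
  have "((\<lambda>t. x + t *\<^sub>R d0) \<longlongrightarrow> x + 0 *\<^sub>R d0) (at_right 0)" by (intro tendsto_intros)
  then have "\<forall>\<^sub>F t in at_right 0. x + t *\<^sub>R d0 \<in> V" using V by (intro topological_tendstoD) auto
  moreover have "\<forall>\<^sub>F t in at_right 0. x + t *\<^sub>R d0 \<notin> closure S" using d(2)[of d0] d(1) by simp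
  ultimately have "\<forall>\<^sub>F t::real in at_right 0. False" by eventually_elim (use V(3) in auto)
  then show False by simp
qed

lemma outward_normal_eqI:
  assumes 1: "norm \<nu> = 1"
    and "\<And>\<epsilon>. \<epsilon> > 0 \<Longrightarrow> \<forall>\<^sub>F y in at x.
        ((y - x) \<bullet> \<nu> > \<epsilon> * norm (y - x) \<longrightarrow> y \<notin> S) \<and> ((y - x) \<bullet> \<nu> < - \<epsilon> * norm (y - x) \<longrightarrow> y \<in> S)"
  shows "outward_normal S x = \<nu>"
proof -
  let ?P = "\<lambda>\<nu>. norm \<nu> = 1 \<and> (\<forall>\<epsilon>>0. \<forall>\<^sub>F y in at x.
        ((y - x) \<bullet> \<nu> > \<epsilon> * norm (y - x) \<longrightarrow> y \<notin> S) \<and> ((y - x) \<bullet> \<nu> < - \<epsilon> * norm (y - x) \<longrightarrow> y \<in> S))"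
  have P: "?P \<nu>" using assms by auto
  have uq: "\<mu> = \<nu>" if Q: "?P \<mu>" for \<mu>
  proof (rule ccontr)
    assume ne: "\<mu> \<noteq> \<nu>"
    \<comment> \<open>The difference of two candidate normals points outward for one and, by the
      same amount, inward for the other, so a short ray along it would be both outside and
      inside.\<close>
    define d where "d = \<mu> - \<nu>"
    have n: "\<mu> \<bullet> \<mu> = 1" "\<nu> \<bullet> \<nu> = 1" using P Q by (auto simp: norm_eq_1)
    define a where "a = d \<bullet> \<mu>"
    have "d \<bullet> d = 2 * a" using n by (simp add: a_def d_def inner_diff inner_commute)
    moreover have "d \<bullet> d > 0" using ne by (simp add: d_def)
    ultimately have a: "a > 0" by simp
    have dn: "d \<bullet> \<nu> = - a" using n by (simp add: a_def d_def inner_diff inner_commute)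
    define \<epsilon> where "\<epsilon> = a / (2 * norm d)"
    have d0: "d \<noteq> 0" using ne by (simp add: d_def)
    have \<epsilon>: "\<epsilon> > 0" "\<epsilon> * norm d < a" using a d0 by (auto simp: \<epsilon>_def)
    have lim: "filterlim (\<lambda>t. x + t *\<^sub>R d) (at x) (at_right 0)"
    proof (rule filterlim_atI)
      have "((\<lambda>t. x + t *\<^sub>R d) \<longlongrightarrow> x + 0 *\<^sub>R d) (at_right 0)" by (intro tendsto_intros)
      then show "((\<lambda>t. x + t *\<^sub>R d) \<longlongrightarrow> x) (at_right 0)" by simp
      show "\<forall>\<^sub>F t in at_right 0. x + t *\<^sub>R d \<noteq> x"
        using eventually_at_right_less[of "0::real"] by eventually_elim (use d0 in auto)
    qed
    have "\<forall>\<^sub>F t in at_right (0::real). t > 0" by (rule eventually_at_right_less)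
    moreover have "\<forall>\<^sub>F t in at_right 0. (t *\<^sub>R d) \<bullet> \<mu> > \<epsilon> * norm (t *\<^sub>R d) \<longrightarrow> x + t *\<^sub>R d \<notin> S"
      by (rule eventually_mono[OF eventually_compose_filterlim[OF conjunct2[OF Q, rule_format, OF \<epsilon>(1)] lim]]) simp
    moreover have "\<forall>\<^sub>F t in at_right 0. (t *\<^sub>R d) \<bullet> \<nu> < - \<epsilon> * norm (t *\<^sub>R d) \<longrightarrow> x + t *\<^sub>R d \<in> S"
      by (rule eventually_mono[OF eventually_compose_filterlim[OF conjunct2[OF P, rule_format, OF \<epsilon>(1)] lim]]) simp
    ultimately have "\<forall>\<^sub>F t in at_right (0::real). False"
    proof eventually_elim
      case (elim t)
      have "t * (\<epsilon> * norm d) < t * a" using elim(1) \<epsilon>(2) by simp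
      then show ?case using elim dn by (simp add: a_def[symmetric] mult_ac)
    qed
    then show False by simp
  qed
  show ?thesis unfolding outward_normal_def by (rule the_equality, rule P, rule uq)
qed

section \<open>Signed permutations preserving the cube\<close>

text \<open>Linear maps preserving the cube are isometries of the maximum norm. The matrix
  \<open>A\<close> and its inverse \<open>B\<close> have rows of l1-norm at most 1, and the unit
  diagonal of \<open>A ** B\<close> forces equality: an entry \<open>A $ i $ j\<close> that is not 0
  leaves \<open>B\<close> in row j only the entry at i, of modulus 1.\<close>

lemma cube_signed_perm:
  assumes lin: "linear (g :: real^3 \<Rightarrow> real^3)" and img: "g ` cube = cube"
  obtains \<pi> \<epsilon> where "bij \<pi>" "\<And>i. \<bar>\<epsilon> i\<bar> = 1" "\<And>\<xi> i. g \<xi> $ i = \<epsilon> i * \<xi> $ \<pi> i"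
proof -
  have surj: "surj g"
  proof -
    have "\<exists>x. y = g x" for y
    proof -
      define c where "c = inverse (norm y + 1)"
      \<comment> \<open>Any vector can be scaled into the cube, so surjectivity on the cube extends
        to the whole space.\<close>
      have c: "c > 0" by (simp add: c_def add_pos_nonneg add_nonneg_pos)
      have "c *\<^sub>R y \<in> cube"
      proof -
        have "\<bar>(c *\<^sub>R y) $ i\<bar> \<le> 1" for i
        proof -
          have "\<bar>(c *\<^sub>R y) $ i\<bar> \<le> norm (c *\<^sub>R y)" by (rule component_le_norm_cart)
          also have "\<dots> \<le> 1" by (simp add: c_def field_simps add_pos_nonneg)
          finally show ?thesis .
        qed
        then show ?thesis by (simp add: cube_def)
      qed
      then obtain x where "g x = c *\<^sub>R y" using img by (metis imageE)
      then have "y = g (inverse c *\<^sub>R x)" using c by (simp add: linear_scale[OF lin])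
      then show ?thesis by blast
    qed
    then show ?thesis by (simp add: surj_def)
  qed
  obtain h where hlin: "linear h" and hg: "\<And>x. h (g x) = x" and gh: "\<And>x. g (h x) = x"
    using linear_surjective_isomorphism[OF lin surj] by blast
  have "h ` (g ` cube) = cube" by (simp add: image_image hg)
  then have himg: "h ` cube = cube" by (simp only: img)
  define A where "A = matrix g"
  define B where "B = matrix h"
  have gA: "g x = A *v x" for x by (simp add: A_def matrix_works lin)
  have hB: "h x = B *v x" for x by (simp add: B_def matrix_works hlin)
  have AB: "A ** B = mat 1" unfolding matrix_eq by (simp add: gA[symmetric] hB[symmetric] gh flip: matrix_vector_mul_assoc)
  have row: "(\<Sum>j\<in>UNIV. \<bar>C $ i $ j\<bar>) \<le> 1" if C: "\<And>x. x \<in> cube \<Longrightarrow> C *v x \<in> cube" for C :: "real^3^3" and i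
  proof -
    \<comment> \<open>The vertex whose signs match the row attains its l1-norm.\<close>
    define x :: "real^3" where "x = (\<chi> j. if C $ i $ j \<ge> 0 then 1 else -1)"
    have "x \<in> cube" by (auto simp: x_def cube_def)
    then have "\<bar>(C *v x) $ i\<bar> \<le> 1" using C by (simp add: cube_def)
    moreover have "(C *v x) $ i = (\<Sum>j\<in>UNIV. \<bar>C $ i $ j\<bar>)"
      unfolding matrix_vector_mult_def x_def by (auto intro!: sum.cong)
    ultimately show ?thesis by linarith
  qed
  have rA: "(\<Sum>j\<in>UNIV. \<bar>A $ i $ j\<bar>) \<le> 1" for i by (rule row) (use img gA in \<open>metis imageI\<close>)
  have rB: "(\<Sum>j\<in>UNIV. \<bar>B $ i $ j\<bar>) \<le> 1" for i by (rule row) (use himg hB in \<open>metis imageI\<close>)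
  have B1: "\<bar>B $ j $ i\<bar> \<le> 1" for i j
    using rB[of j] member_le_sum[of i UNIV "\<lambda>i. \<bar>B $ j $ i\<bar>"] by simp
  have diag: "(\<Sum>j\<in>UNIV. A $ i $ j * B $ j $ i) = 1" for i
  proof -
    have "(A ** B) $ i $ i = 1" using AB by (simp add: mat_def)
    then show ?thesis by (simp add: matrix_matrix_mult_def)
  qed
  have Bone: "\<bar>B $ j $ i\<bar> = 1 \<and> (\<forall>l. l \<noteq> i \<longrightarrow> B $ j $ l = 0)" if nz: "A $ i $ j \<noteq> 0" for i j
  proof -
    have "(\<Sum>j\<in>UNIV. \<bar>A $ i $ j\<bar> * (1 - \<bar>B $ j $ i\<bar>)) \<le> 0"
    proof -
      have "1 \<le> (\<Sum>j\<in>UNIV. \<bar>A $ i $ j\<bar> * \<bar>B $ j $ i\<bar>)"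
        using sum_mono[of UNIV "\<lambda>j. A $ i $ j * B $ j $ i" "\<lambda>j. \<bar>A $ i $ j\<bar> * \<bar>B $ j $ i\<bar>"] diag[of i]
        by (simp add: abs_mult[symmetric])
      then show ?thesis using rA[of i] by (simp add: right_diff_distrib sum_subtractf)
    qed
    then have "\<bar>A $ i $ j\<bar> * (1 - \<bar>B $ j $ i\<bar>) = 0"
      using sum_nonneg_0[of UNIV "\<lambda>j. \<bar>A $ i $ j\<bar> * (1 - \<bar>B $ j $ i\<bar>)" j] B1
      by (simp add: sum_nonneg antisym)
    then have b: "\<bar>B $ j $ i\<bar> = 1" using nz by simp
    have "B $ j $ l = 0" if "l \<noteq> i" for l
    proof -
      have "(\<Sum>k\<in>{i, l}. \<bar>B $ j $ k\<bar>) \<le> (\<Sum>k\<in>UNIV. \<bar>B $ j $ k\<bar>)" by (rule sum_mono2) auto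
      then show ?thesis using rB[of j] b that by simp
    qed
    then show ?thesis using b by auto
  qed
  have ex: "\<exists>j. A $ i $ j \<noteq> 0" for i
  proof (rule ccontr)
    assume "\<not> ?thesis" then show False using diag[of i] by simp
  qed
  have uniq: "j = l" if j: "A $ i $ j \<noteq> 0" and l: "A $ i $ l \<noteq> 0" for i j l
  proof (rule ccontr)
    assume jl: "j \<noteq> l"
    \<comment> \<open>Rows j and l of \<open>B\<close> are supported at the same column i, hence are
      proportional; this is the dependence relation, impossible for an invertible matrix.\<close>
    define x :: "real^3" where "x = axis j (B $ l $ i) - axis l (B $ j $ i)"
    have "x \<bullet> row k (transpose B) = 0" for k
    proof -
      have "B $ j $ k * B $ l $ i = B $ l $ k * B $ j $ i"
        using Bone[OF j] Bone[OF l] by (cases "k = i") auto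
      then show ?thesis
        by (simp add: x_def inner_diff_left inner_axis' row_def transpose_def mult.commute)
    qed
    then have "transpose B *v x = 0"
      by (simp add: vec_eq_iff matrix_vector_mult_def inner_vec_def row_def mult.commute)
    moreover have "transpose A ** transpose B = mat 1"
    proof -
      have "B ** A = mat 1" using AB by (rule matrix_left_right_inverse[THEN iffD1])
      then show ?thesis by (metis matrix_transpose_mul transpose_mat)
    qed
    ultimately have "x = 0"
      by (metis matrix_vector_mul_assoc matrix_vector_mul_lid matrix_vector_mult_0_right)
    then have "x $ j = 0" by simp
    then show False using jl Bone[OF l] by (simp add: x_def axis_def)
  qed
  define \<pi> where "\<pi> i = (SOME j. A $ i $ j \<noteq> 0)" for i
  have \<pi>: "A $ i $ \<pi> i \<noteq> 0" for i unfolding \<pi>_def using ex[of i] by (rule someI_ex)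
  have zero: "A $ i $ j = 0" if "j \<noteq> \<pi> i" for i j using uniq[OF \<pi>, of i j] that by auto
  define \<epsilon> where "\<epsilon> i = A $ i $ \<pi> i" for i
  have comp: "g \<xi> $ i = \<epsilon> i * \<xi> $ \<pi> i" for \<xi> i
  proof -
    have "g \<xi> $ i = (\<Sum>j\<in>UNIV. A $ i $ j * \<xi> $ j)" by (simp add: gA matrix_vector_mult_def)
    also have "\<dots> = (\<Sum>j\<in>UNIV. if j = \<pi> i then \<epsilon> i * \<xi> $ \<pi> i else 0)"
      by (intro sum.cong) (auto simp: zero \<epsilon>_def)
    finally show ?thesis by simp
  qed
  have eps: "\<bar>\<epsilon> i\<bar> = 1" for i
  proof -
    have "(\<Sum>j\<in>UNIV. A $ i $ j * B $ j $ i) = (\<Sum>j\<in>UNIV. if j = \<pi> i then \<epsilon> i * B $ \<pi> i $ i else 0)"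
      by (intro sum.cong) (auto simp: zero \<epsilon>_def)
    then have "\<epsilon> i * B $ \<pi> i $ i = 1" using diag[of i] by simp
    then have "\<bar>\<epsilon> i\<bar> * \<bar>B $ \<pi> i $ i\<bar> = 1" by (metis abs_mult abs_one)
    then show ?thesis using Bone[OF \<pi>[of i]] by simp
  qed
  have "inj \<pi>"
  proof (rule injI)
    fix i j assume e: "\<pi> i = \<pi> j"
    have "\<bar>B $ \<pi> i $ j\<bar> = 1" using Bone[OF \<pi>[of j]] e by simp
    then show "i = j" using Bone[OF \<pi>[of i]] by (metis abs_zero zero_neq_one)
  qed
  then have "bij \<pi>" by (simp add: bij_def finite_UNIV_inj_surj)
  then show thesis using that comp eps by blast
qed

section \<open>Faces of the cells\<close>

definition face_int :: "3 \<Rightarrow> real \<Rightarrow> (real^3) set" where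
  "face_int k s = {\<xi>. \<xi> $ k = s \<and> (\<forall>j. j \<noteq> k \<longrightarrow> \<bar>\<xi> $ j\<bar> < 1)}"

lemma face_int_cube: "\<bar>s\<bar> = 1 \<Longrightarrow> \<xi> \<in> face_int k s \<Longrightarrow> \<xi> \<in> cube"
  unfolding face_int_def cube_def by clarsimp (metis less_eq_real_def)

lemma face_int_face: "\<bar>s\<bar> = 1 \<Longrightarrow> \<xi> \<in> face_int k s \<Longrightarrow> \<xi> \<in> cube_face {k} (\<lambda>_. s)"
  using face_int_cube by (auto simp: cube_face_def face_int_def)

lemma ocube_not_face:
  assumes "\<xi> \<in> ocube" "I \<noteq> {}" "\<And>i. i \<in> I \<Longrightarrow> \<bar>\<sigma> i\<bar> = 1" shows "\<xi> \<notin> cube_face I \<sigma>"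
proof
  assume f: "\<xi> \<in> cube_face I \<sigma>"
  obtain i where "i \<in> I" using assms(2) by auto
  then have "\<bar>\<xi> $ i\<bar> = 1" using assms(3) f by (auto simp: cube_face_def)
  moreover have "\<bar>\<xi> $ i\<bar> < 1" using assms(1) unfolding ocube_iff by blast
  ultimately show False by simp
qed

lemma line_at_right: "((\<lambda>t. x + t *\<^sub>R d) \<longlongrightarrow> x) (at_right 0)" for x d :: "'a::real_normed_vector"
proof -
  have "((\<lambda>t. x + t *\<^sub>R d) \<longlongrightarrow> x + 0 *\<^sub>R d) (at_right 0)" by (intro tendsto_intros)
  then show ?thesis by simp
qed

context fe_mesh
begin

text \<open>Nanson's area vector of the face: outward directed because det J > 0, with the surface
  density of the face parametrization as its length.\<close>

definition face_normal :: "'e \<Rightarrow> 3 \<Rightarrow> real \<Rightarrow> real^3 \<Rightarrow> real^3" where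
  "face_normal e k s \<xi> = s *\<^sub>R column k (cof (geo_jac M e \<xi>))"

lemma face_normal_nonzero:
  assumes "e \<in> cells M" "\<xi> \<in> cube" "\<bar>s\<bar> = 1" shows "face_normal e k s \<xi> \<noteq> 0"
proof
  assume "face_normal e k s \<xi> = 0"
  then have "column k (cof (geo_jac M e \<xi>)) = 0" using assms(3) by (auto simp: face_normal_def)
  then have "det (geo_jac M e \<xi>) = 0"
    by (simp add: det_cross3[of _ k] cof_column)
  then show False using jac_pos[OF assms(1,2)] by simp
qed

text \<open>Close to the point only the condition s \<Phi>_k \<le> 1 of the cube is at stake, and
  its gradient is the face normal divided by det J. On the inner side points even come from the open
  cube, which later rules out other cells.\<close>

lemma face_halfspace:
  assumes e: "e \<in> cells M" and s: "\<bar>s\<bar> = 1" and \<xi>: "\<xi> \<in> face_int k s" and "\<epsilon> > 0"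
  defines "X \<equiv> geo M e \<xi>" and "n \<equiv> face_normal e k s \<xi>"
  shows "\<forall>\<^sub>F y in at X. ((y - X) \<bullet> n > \<epsilon> * norm (y - X) \<longrightarrow> y \<notin> geo M e ` cube) \<and>
    ((y - X) \<bullet> n < - \<epsilon> * norm (y - X) \<longrightarrow> y \<in> geo M e ` ocube)"
proof -
  let ?J = "geo_jac M e \<xi>"
  have \<xi>c: "\<xi> \<in> cube" using face_int_cube[OF s \<xi>] .
  define D where "D = det ?J"
  have D: "D > 0" using jac_pos[OF e \<xi>c] by (simp add: D_def)
  obtain V \<Phi> where c: "open V" "X \<in> V" "continuous_on V \<Phi>"
    "(\<Phi> has_derivative (\<lambda>h. matrix_inv ?J *v h)) (at X)" "\<Phi> X = \<xi>"
    "\<And>y. y \<in> V \<Longrightarrow> \<Phi> y \<in> cube \<Longrightarrow> geo M e (\<Phi> y) = y"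
    "\<And>y. y \<in> V \<Longrightarrow> y \<in> geo M e ` cube \<longleftrightarrow> \<Phi> y \<in> cube"
    using cell_chart[OF e \<xi>c] unfolding X_def by metis
  have ss: "s * s = 1" using s by (metis abs_mult_self_eq mult.right_neutral)
  have nd: "D * (s * (matrix_inv ?J *v v) $ k) = v \<bullet> n" for v
  proof -
    have "(matrix_inv ?J *v v) $ k = inverse D * (column k (cof ?J) \<bullet> v)"
      using D unfolding D_def
      by (simp add: matrix_inv_cof matrix_vector_mult_def transpose_def column_def inner_vec_def sum_distrib_left mult.assoc)
    then show ?thesis using D by (simp add: n_def face_normal_def inner_commute)
  qed
  have "\<forall>\<^sub>F y in at X. norm (\<Phi> y - \<Phi> X - matrix_inv ?J *v (y - X)) \<le> (\<epsilon> / D) * norm (y - X)"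
  proof -
    have "\<epsilon> / D > 0" using D \<open>\<epsilon> > 0\<close> by simp
    then obtain d where "d > 0" "\<And>y. norm (y - X) < d \<Longrightarrow> norm (\<Phi> y - \<Phi> X - matrix_inv ?J *v (y - X)) \<le> (\<epsilon> / D) * norm (y - X)"
      using c(4) unfolding has_derivative_at_alt by blast
    then show ?thesis unfolding eventually_at by (auto simp: dist_norm)
  qed
  moreover have "\<forall>\<^sub>F y in at X. y \<in> V"
    using c(1,2) by (auto intro: eventually_at_in_open')
  moreover have tend: "(\<Phi> \<longlongrightarrow> \<xi>) (at X)"
    using c(1,2,3,5) by (metis at_within_open continuous_on_def)
  have "\<forall>\<^sub>F y in at X. \<forall>j. (j \<noteq> k \<longrightarrow> \<bar>\<Phi> y $ j\<bar> < 1) \<and> (j = k \<longrightarrow> s * \<Phi> y $ k > -1)"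
  proof (rule eventually_all_finite)
    fix j
    have t: "((\<lambda>y. \<Phi> y $ j) \<longlongrightarrow> \<xi> $ j) (at X)" using tend by (rule tendsto_vec_nth)
    show "\<forall>\<^sub>F y in at X. (j \<noteq> k \<longrightarrow> \<bar>\<Phi> y $ j\<bar> < 1) \<and> (j = k \<longrightarrow> s * \<Phi> y $ k > -1)"
    proof (cases "j = k")
      case True
      have "((\<lambda>y. s * \<Phi> y $ k) \<longlongrightarrow> s * \<xi> $ k) (at X)" using tendsto_mult[OF tendsto_const[of s] t] True by simp
      moreover have "s * \<xi> $ k > -1" using \<xi> ss by (simp add: face_int_def)
      ultimately show ?thesis using True by (auto dest: order_tendstoD(1))
    next
      case False
      have "((\<lambda>y. \<bar>\<Phi> y $ j\<bar>) \<longlongrightarrow> \<bar>\<xi> $ j\<bar>) (at X)" using t by (rule tendsto_rabs)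
      moreover have "\<bar>\<xi> $ j\<bar> < 1" using \<xi> False by (simp add: face_int_def)
      ultimately show ?thesis using False by (auto dest: order_tendstoD(2))
    qed
  qed
  ultimately show ?thesis
  proof eventually_elim
    case (elim y)
    have "\<bar>(\<Phi> y - \<xi> - matrix_inv ?J *v (y - X)) $ k\<bar> \<le> (\<epsilon> / D) * norm (y - X)"
      using elim(1) c(5) component_le_norm_cart order.trans by metis
    then have "\<bar>s * (\<Phi> y - \<xi> - matrix_inv ?J *v (y - X)) $ k\<bar> \<le> (\<epsilon> / D) * norm (y - X)"
      using s by (simp only: abs_mult mult_1)
    then have "D * \<bar>s * (\<Phi> y - \<xi> - matrix_inv ?J *v (y - X)) $ k\<bar> \<le> D * ((\<epsilon> / D) * norm (y - X))"
      using D by (intro mult_left_mono) auto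
    then have "\<bar>D * (s * (\<Phi> y - \<xi> - matrix_inv ?J *v (y - X)) $ k)\<bar> \<le> \<epsilon> * norm (y - X)"
      using D by (simp add: abs_mult)
    moreover have "D * (s * (\<Phi> y - \<xi> - matrix_inv ?J *v (y - X)) $ k) = D * (s * \<Phi> y $ k - 1) - (y - X) \<bullet> n"
      using \<xi> ss nd[of "y - X"] by (simp add: face_int_def algebra_simps)
    ultimately have est: "\<bar>D * (s * \<Phi> y $ k - 1) - (y - X) \<bullet> n\<bar> \<le> \<epsilon> * norm (y - X)" by simp
    show ?case
    proof (intro conjI impI)
      assume "(y - X) \<bullet> n > \<epsilon> * norm (y - X)"
      then have "D * (s * \<Phi> y $ k - 1) > 0" using est by linarith
      then have "s * \<Phi> y $ k > 1" using D by (simp add: zero_less_mult_iff)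
      then have "\<bar>s\<bar> * \<bar>\<Phi> y $ k\<bar> > 1" by (metis abs_ge_self abs_mult less_le_trans)
      then have "\<Phi> y \<notin> cube" using s by (auto simp: cube_def not_le)
      then show "y \<notin> geo M e ` cube" using c(7)[OF elim(2)] by simp
    next
      assume "(y - X) \<bullet> n < - \<epsilon> * norm (y - X)"
      then have "D * (s * \<Phi> y $ k - 1) < 0" using est by linarith
      then have "s * \<Phi> y $ k < 1" using D by (simp add: mult_less_0_iff)
      then have "\<bar>s * \<Phi> y $ k\<bar> < 1" using elim(3) by (simp add: abs_less_iff)
      then have "\<bar>\<Phi> y $ k\<bar> < 1" using s by (simp add: abs_mult)
      then have o: "\<Phi> y \<in> ocube" using elim(3) unfolding ocube_iff by metis
      then have "geo M e (\<Phi> y) = y" using c(6)[OF elim(2)] ocube_subset by auto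
      then show "y \<in> geo M e ` ocube" using o by force
    qed
  qed
qed

lemma face_direction:
  assumes e: "e \<in> cells M" and s: "\<bar>s\<bar> = 1" and \<xi>: "\<xi> \<in> face_int k s"
  shows "d \<bullet> face_normal e k s \<xi> < 0 \<Longrightarrow> \<forall>\<^sub>F t in at_right 0. geo M e \<xi> + t *\<^sub>R d \<in> geo M e ` ocube"
    and "d \<bullet> face_normal e k s \<xi> > 0 \<Longrightarrow> \<forall>\<^sub>F t in at_right 0. geo M e \<xi> + t *\<^sub>R d \<notin> geo M e ` cube"
proof -
  let ?n = "face_normal e k s \<xi>" and ?X = "geo M e \<xi>"
  have main: "\<forall>\<^sub>F t in at_right 0. (d \<bullet> ?n < 0 \<longrightarrow> ?X + t *\<^sub>R d \<in> geo M e ` ocube) \<and>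
     (d \<bullet> ?n > 0 \<longrightarrow> ?X + t *\<^sub>R d \<notin> geo M e ` cube)" if ne: "d \<bullet> ?n \<noteq> 0"
  proof -
    have d: "d \<noteq> 0" using ne by auto
    \<comment> \<open>Half the slope of the ray against the normal, so that the ray clears the
      tolerance in \<open>face_halfspace\<close>.\<close>
    define \<epsilon> where "\<epsilon> = \<bar>d \<bullet> ?n\<bar> / (2 * norm d)"
    have \<epsilon>: "\<epsilon> > 0" "\<epsilon> * norm d < \<bar>d \<bullet> ?n\<bar>" using ne d by (auto simp: \<epsilon>_def)
    have lim: "filterlim (\<lambda>t. ?X + t *\<^sub>R d) (at ?X) (at_right 0)"
    proof (rule filterlim_atI[OF line_at_right])
      show "\<forall>\<^sub>F t in at_right 0. ?X + t *\<^sub>R d \<noteq> ?X"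
        using eventually_at_right_less[of "0::real"] by eventually_elim (use d in auto)
    qed
    have "\<forall>\<^sub>F t in at_right (0::real). t > 0" by (rule eventually_at_right_less)
    with eventually_compose_filterlim[OF face_halfspace[OF e s \<xi> \<epsilon>(1)] lim] show ?thesis
    proof eventually_elim
      case (elim t)
      have "t * (\<epsilon> * norm d) < t * \<bar>d \<bullet> ?n\<bar>" using \<epsilon>(2) elim(2) by simp
      moreover have v: "(?X + t *\<^sub>R d - ?X) \<bullet> ?n = t * (d \<bullet> ?n)" "\<epsilon> * norm (?X + t *\<^sub>R d - ?X) = t * (\<epsilon> * norm d)"
        using elim(2) by simp_all
      ultimately have "d \<bullet> ?n < 0 \<Longrightarrow> (?X + t *\<^sub>R d - ?X) \<bullet> ?n < - \<epsilon> * norm (?X + t *\<^sub>R d - ?X)"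
        "d \<bullet> ?n > 0 \<Longrightarrow> (?X + t *\<^sub>R d - ?X) \<bullet> ?n > \<epsilon> * norm (?X + t *\<^sub>R d - ?X)"
        unfolding mult_minus_left v by simp_all
      then show ?case using elim(1) by blast
    qed
  qed
  show "d \<bullet> ?n < 0 \<Longrightarrow> \<forall>\<^sub>F t in at_right 0. ?X + t *\<^sub>R d \<in> geo M e ` ocube"
    using main by (auto elim: eventually_mono)
  show "d \<bullet> ?n > 0 \<Longrightarrow> \<forall>\<^sub>F t in at_right 0. ?X + t *\<^sub>R d \<notin> geo M e ` cube"
    using main by (auto elim: eventually_mono)
qed

lemma cells_meet:
  assumes "e \<in> cells M" "e' \<in> cells M" "e \<noteq> e'" "geo M e ` cube \<inter> geo M e' ` cube \<noteq> {}"
  obtains I \<sigma> g where "I \<noteq> {}" "\<And>i. i \<in> I \<Longrightarrow> \<bar>\<sigma> i\<bar> = 1" "linear g" "g ` cube = cube"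
    "geo M e ` cube \<inter> geo M e' ` cube = geo M e ` cube_face I \<sigma>"
    "\<And>\<xi>. \<xi> \<in> cube_face I \<sigma> \<Longrightarrow> geo M e' (g \<xi>) = geo M e \<xi>"
proof -
  have "\<forall>e\<in>cells M. \<forall>e'\<in>cells M. e \<noteq> e' \<longrightarrow> geo M e ` cube \<inter> geo M e' ` cube \<noteq> {} \<longrightarrow>
        (\<exists>I \<sigma> g. I \<noteq> {} \<and> (\<forall>i\<in>I. \<bar>\<sigma> i\<bar> = 1) \<and> linear g \<and> g ` cube = cube \<and>
           geo M e ` cube \<inter> geo M e' ` cube = geo M e ` cube_face I \<sigma> \<and>
           (\<forall>\<xi>\<in>cube_face I \<sigma>. geo M e' (g \<xi>) = geo M e \<xi>))"
    using mesh unfolding conforming_mesh_def by (elim conjE)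
  from this[rule_format, OF assms] show thesis
    by (elim exE conjE) (rule that; blast)
qed

lemma ocube_image_disjoint:
  assumes "e \<in> cells M" "e' \<in> cells M" "e \<noteq> e'" "\<eta> \<in> ocube"
  shows "geo M e \<eta> \<notin> geo M e' ` cube"
proof
  assume "geo M e \<eta> \<in> geo M e' ` cube"
  then have m: "geo M e \<eta> \<in> geo M e ` cube \<inter> geo M e' ` cube" using assms(4) ocube_subset by auto
  then obtain I \<sigma> g where c: "I \<noteq> {}" "\<And>i. i \<in> I \<Longrightarrow> \<bar>\<sigma> i\<bar> = 1"
     "geo M e ` cube \<inter> geo M e' ` cube = geo M e ` cube_face I \<sigma>"
    using cells_meet[OF assms(1-3)] by (metis empty_iff)
  then obtain \<zeta> where "\<zeta> \<in> cube_face I \<sigma>" "geo M e \<eta> = geo M e \<zeta>" using m by auto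
  moreover then have "\<eta> = \<zeta>"
    using inj_geo[OF assms(1)] assms(4) ocube_subset by (auto simp: inj_on_def cube_face_def)
  ultimately show False using ocube_not_face[OF assms(4) c(1), of \<sigma>] c(2) by auto
qed

lemma dom_lipschitz: "lipschitz_domain (dom M)"
  using mesh by (simp add: conforming_mesh_def)

lemma ocube_image_dom:
  assumes "e \<in> cells M" "\<eta> \<in> ocube" shows "geo M e \<eta> \<in> dom M"
proof -
  obtain V where V: "open V" "geo M e \<eta> \<in> V" "V \<subseteq> geo M e ` ocube" using cell_interior_nhd[OF assms] .
  have "geo M e ` ocube \<subseteq> closure (dom M)" using geo_in_closure[OF assms(1)] ocube_subset by blast
  then show ?thesis using lipschitz_interior_closure[OF dom_lipschitz V(1,2)] V(3) by auto
qed

text \<open>Inside a face only the coordinate k has modulus 1, so the index set of the common face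
  can be nothing but {k}: a single common point there forces the whole face to be common.\<close>

lemma shared_face:
  assumes e: "e \<in> cells M" "e' \<in> cells M" "e \<noteq> e'" and s: "\<bar>s\<bar> = 1"
    and \<xi>: "\<xi> \<in> face_int k s" and m: "geo M e \<xi> \<in> geo M e' ` cube"
  obtains g where "linear g" "g ` cube = cube"
    "geo M e ` cube \<inter> geo M e' ` cube = geo M e ` cube_face {k} (\<lambda>_. s)"
    "\<And>\<eta>. \<eta> \<in> cube_face {k} (\<lambda>_. s) \<Longrightarrow> geo M e' (g \<eta>) = geo M e \<eta>"
proof -
  have \<xi>c: "\<xi> \<in> cube" using face_int_cube[OF s \<xi>] .
  then have mm: "geo M e \<xi> \<in> geo M e ` cube \<inter> geo M e' ` cube" using m by auto
  then obtain I \<sigma> g where c: "I \<noteq> {}" "\<And>i. i \<in> I \<Longrightarrow> \<bar>\<sigma> i\<bar> = 1" "linear g" "g ` cube = cube"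
    "geo M e ` cube \<inter> geo M e' ` cube = geo M e ` cube_face I \<sigma>"
    "\<And>\<xi>. \<xi> \<in> cube_face I \<sigma> \<Longrightarrow> geo M e' (g \<xi>) = geo M e \<xi>"
    using cells_meet[OF e] by (metis empty_iff)
  obtain \<zeta> where z: "\<zeta> \<in> cube_face I \<sigma>" "geo M e \<xi> = geo M e \<zeta>" using mm c(5) by auto
  then have "\<xi> = \<zeta>" using inj_geo[OF e(1)] \<xi>c by (auto simp: inj_on_def cube_face_def)
  then have f: "\<And>i. i \<in> I \<Longrightarrow> \<xi> $ i = \<sigma> i" using z by (simp add: cube_face_def)
  have I: "I \<subseteq> {k}" using f c(2) \<xi> by (force simp: face_int_def)
  then have I: "I = {k}" using c(1) by blast
  then have "\<sigma> k = s" using f[of k] \<xi> by (simp add: face_int_def)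
  then have "cube_face I \<sigma> = cube_face {k} (\<lambda>_. s)" by (auto simp: cube_face_def I)
  then show thesis using that[OF c(3,4)] c(5,6) by simp
qed

lemma unshared_nhd:
  assumes e: "e \<in> cells M" and u: "\<And>e'. e' \<in> cells M \<Longrightarrow> e' \<noteq> e \<Longrightarrow> X \<notin> geo M e' ` cube"
  obtains V where "open V" "X \<in> V" "closure (dom M) \<inter> V \<subseteq> geo M e ` cube"
proof
  let ?K = "\<Union>e'\<in>cells M - {e}. geo M e' ` cube"
  have "closed ?K" using finite_cells by (intro closed_UN) (auto intro: compact_imp_closed compact_cell)
  then show "open (- ?K)" by (rule open_Compl)
  show "X \<in> - ?K" using u by auto
  show "closure (dom M) \<inter> - ?K \<subseteq> geo M e ` cube" unfolding closure_cells by auto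
qed

text \<open>Were the point in the open domain, a short step along the normal would stay in the
  domain while leaving the only cell nearby.\<close>

lemma unshared_frontier:
  assumes e: "e \<in> cells M" and s: "\<bar>s\<bar> = 1" and \<xi>: "\<xi> \<in> face_int k s"
    and u: "\<And>e'. e' \<in> cells M \<Longrightarrow> e' \<noteq> e \<Longrightarrow> geo M e \<xi> \<notin> geo M e' ` cube"
  shows "geo M e \<xi> \<in> frontier (dom M)"
proof (rule ccontr)
  let ?n = "face_normal e k s \<xi>" and ?X = "geo M e \<xi>"
  assume "?X \<notin> frontier (dom M)"
  then have X: "?X \<in> dom M"
    using geo_in_closure[OF e face_int_cube[OF s \<xi>]] open_dom by (simp add: frontier_def interior_open)
  obtain V where V: "open V" "?X \<in> V" "closure (dom M) \<inter> V \<subseteq> geo M e ` cube" using unshared_nhd[OF e u] by blast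
  have "\<forall>\<^sub>F t in at_right 0. ?X + t *\<^sub>R ?n \<in> V \<inter> dom M"
    using V X open_dom by (intro topological_tendstoD[OF line_at_right]) auto
  moreover have "\<forall>\<^sub>F t in at_right 0. ?X + t *\<^sub>R ?n \<notin> geo M e ` cube"
    using face_normal_nonzero[OF e face_int_cube[OF s \<xi>] s, of k]
    by (intro face_direction(2)[OF e s \<xi>, of ?n]) simp
  ultimately have "\<forall>\<^sub>F t::real in at_right 0. False"
    by eventually_elim (use V closure_subset in blast)
  then show False by simp
qed

text \<open>With equal normals the inward ray would run through the open parts of both cells, which
  are disjoint.\<close>

lemma shared_normals:
  assumes e: "e \<in> cells M" "e' \<in> cells M" "e \<noteq> e'" and s: "\<bar>s\<bar> = 1" "\<bar>s'\<bar> = 1"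
    and \<xi>: "\<xi> \<in> face_int k s" "\<xi>' \<in> face_int k' s'" and m: "geo M e \<xi> = geo M e' \<xi>'"
  shows "face_normal e k s \<xi> \<noteq> face_normal e' k' s' \<xi>'"
proof
  let ?n = "face_normal e k s \<xi>" and ?X = "geo M e \<xi>"
  assume eq: "?n = face_normal e' k' s' \<xi>'"
  have neg: "(- ?n) \<bullet> ?n < 0"
    using face_normal_nonzero[OF e(1) face_int_cube[OF s(1) \<xi>(1)] s(1)] by simp
  then have "(- ?n) \<bullet> face_normal e' k' s' \<xi>' < 0" by (simp add: eq)
  with face_direction(1)[OF e(1) s(1) \<xi>(1) neg] face_direction(1)[OF e(2) s(2) \<xi>(2), of "- ?n"]
  have "\<forall>\<^sub>F t in at_right 0. ?X + t *\<^sub>R (- ?n) \<in> geo M e ` ocube"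
    "\<forall>\<^sub>F t in at_right 0. ?X + t *\<^sub>R (- ?n) \<in> geo M e' ` ocube" using m by simp_all
  then have "\<forall>\<^sub>F t::real in at_right 0. False"
  proof eventually_elim
    case (elim t)
    from elim(1) obtain \<eta> where "?X + t *\<^sub>R (- ?n) = geo M e \<eta>" "\<eta> \<in> ocube" by (rule imageE)
    moreover have "?X + t *\<^sub>R (- ?n) \<in> geo M e' ` cube" using elim(2) image_mono[OF ocube_subset] by (rule subsetD[rotated])
    ultimately show ?case using ocube_image_disjoint[OF e] by metis
  qed
  then show False by simp
qed

text \<open>Two cells on opposite sides of a common face fill up a neighbourhood except for the tangent
  plane, whereas a Lipschitz domain leaves an open cone of directions free at a boundary point.\<close>

lemma shared_not_frontier:
  assumes e: "e \<in> cells M" "e' \<in> cells M" and s: "\<bar>s\<bar> = 1" "\<bar>s'\<bar> = 1"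
    and \<xi>: "\<xi> \<in> face_int k s" "\<xi>' \<in> face_int k' s'" and m: "geo M e \<xi> = geo M e' \<xi>'"
    and n: "face_normal e' k' s' \<xi>' = - face_normal e k s \<xi>"
  shows "geo M e \<xi> \<notin> frontier (dom M)"
proof
  let ?n = "face_normal e k s \<xi>" and ?X = "geo M e \<xi>"
  assume "?X \<in> frontier (dom M)"
  then obtain d0 \<delta> where d0: "\<delta> > 0" "\<And>d. norm (d - d0) < \<delta> \<Longrightarrow> \<forall>\<^sub>F t in at_right 0. ?X + t *\<^sub>R d \<notin> closure (dom M)"
    using lipschitz_frontier_cone[OF dom_lipschitz] by blast
  have nz: "?n \<noteq> 0" using face_normal_nonzero[OF e(1) face_int_cube[OF s(1) \<xi>(1)] s(1)] .
  obtain d where d: "norm (d - d0) < \<delta>" "d \<bullet> ?n \<noteq> 0"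
  proof (cases "d0 \<bullet> ?n = 0")
    case False then show ?thesis using that[of d0] d0(1) by simp
  next
    case True
    have "norm (d0 + (\<delta> / (2 * norm ?n)) *\<^sub>R ?n - d0) < \<delta>" using d0(1) nz by simp
    moreover have "(d0 + (\<delta> / (2 * norm ?n)) *\<^sub>R ?n) \<bullet> ?n \<noteq> 0"
      using True d0(1) nz by (simp add: inner_add_left)
    ultimately show ?thesis by (rule that)
  qed
  have sub: "geo M e ` ocube \<subseteq> closure (dom M)" "geo M e' ` ocube \<subseteq> closure (dom M)"
    using geo_in_closure e ocube_subset by blast+
  have "\<forall>\<^sub>F t in at_right 0. ?X + t *\<^sub>R d \<in> closure (dom M)"
  proof (cases "d \<bullet> ?n < 0")
    case True
    show ?thesis using face_direction(1)[OF e(1) s(1) \<xi>(1) True] by eventually_elim (use sub in blast)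
  next
    case False
    then have "d \<bullet> face_normal e' k' s' \<xi>' < 0" using n d(2) by simp
    from face_direction(1)[OF e(2) s(2) \<xi>(2) this] show ?thesis
      unfolding m by eventually_elim (use sub in blast)
  qed
  with d0(2)[OF d(1)] have "\<forall>\<^sub>F t::real in at_right 0. False" by eventually_elim auto
  then show False by simp
qed

text \<open>Values on a face determine the tangential derivatives: differentiate along a coordinate
  segment contained in the face.\<close>

lemma face_column_eq:
  fixes f f' :: "real^3 \<Rightarrow> real^3"
  assumes s: "\<bar>s\<bar> = 1" and \<xi>: "\<xi> \<in> face_int k s" and j: "j \<noteq> k"
    and f: "(f has_derivative (\<lambda>h. A *v h)) (at \<xi> within cube)"
    and f': "(f' has_derivative (\<lambda>h. A' *v h)) (at \<xi> within cube)"
    and eq: "\<And>\<eta>. \<eta> \<in> cube_face {k} (\<lambda>_. s) \<Longrightarrow> f \<eta> = f' \<eta>"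
  shows "column j A = column j A'"
proof -
  define r where "r = 1 - \<bar>\<xi> $ j\<bar>"
  have r: "r > 0" using \<xi> j by (simp add: r_def face_int_def)
  let ?T = "{-r<..<r}"
  define p where "p t = \<xi> + t *\<^sub>R axis j 1" for t :: real
  have pf: "p t \<in> cube_face {k} (\<lambda>_. s)" if "t \<in> ?T" for t
  proof -
    have "\<bar>p t $ i\<bar> \<le> 1" for i
    proof (cases "i = j")
      case True
      then have "\<bar>p t $ i\<bar> \<le> \<bar>\<xi> $ j\<bar> + \<bar>t\<bar>" by (simp add: p_def axis_def abs_triangle_ineq)
      then show ?thesis using that by (auto simp: r_def)
    next
      case False
      then show ?thesis using face_int_cube[OF s \<xi>] by (simp add: p_def axis_def cube_def)
    qed
    then show ?thesis using \<xi> j by (simp add: cube_face_def cube_def face_int_def p_def axis_def)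
  qed
  then have sub: "p ` ?T \<subseteq> cube" by (auto simp: cube_face_def)
  have p0: "p 0 = \<xi>" by (simp add: p_def)
  have dp: "(p has_derivative (\<lambda>t. t *\<^sub>R axis j 1)) (at 0 within ?T)"
    unfolding p_def by (auto intro!: derivative_eq_intros)
  have chain: "((\<lambda>t. h (p t)) has_derivative (\<lambda>t. t *\<^sub>R column j B)) (at 0)"
    if "(h has_derivative (\<lambda>h. B *v h)) (at \<xi> within cube)" for h B
  proof -
    have "(h has_derivative (\<lambda>h. B *v h)) (at (p 0) within p ` ?T)"
      unfolding p0 by (rule has_derivative_subset[OF that sub])
    from diff_chain_within[OF dp this]
    have "((\<lambda>t. h (p t)) has_derivative (\<lambda>t. t *\<^sub>R column j B)) (at 0 within ?T)"
      by (simp add: o_def matrix_vector_mult_basis matrix_vector_mult_scaleR)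
    then show ?thesis using r by (simp add: at_within_open[of 0 ?T])
  qed
  have "((\<lambda>t. f' (p t)) has_derivative (\<lambda>t. t *\<^sub>R column j A)) (at 0)"
    by (rule has_derivative_transform_within_open[OF chain[OF f], of ?T]) (use r pf eq in auto)
  from has_derivative_unique[OF this chain[OF f']]
  have "(\<lambda>t::real. t *\<^sub>R column j A) = (\<lambda>t. t *\<^sub>R column j A')" .
  from fun_cong[OF this, of 1] show ?thesis by simp
qed

end

section \<open>Gluing of faces\<close>

lemma column_matrix_mult: "column k (A ** B) = A *v column k B"
  by (simp add: column_def matrix_matrix_mult_def matrix_vector_mult_def)

text \<open>The matrix is orthogonal, so its inverse is its transpose and the cofactor formula for
  the inverse yields the first identity.\<close>

lemma signed_perm_cof:
  fixes g :: "real^3 \<Rightarrow> real^3"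
  assumes lin: "linear g" and g: "\<And>\<xi> i. g \<xi> $ i = \<epsilon> i * \<xi> $ \<pi> i" "bij \<pi>" "\<And>i. \<bar>\<epsilon> i\<bar> = 1"
  shows "cof (matrix g) = det (matrix g) *\<^sub>R matrix g" "\<bar>det (matrix g)\<bar> = 1"
    "\<pi> k' = k \<Longrightarrow> column k (matrix g) = \<epsilon> k' *\<^sub>R axis k' 1"
proof -
  let ?G = "matrix g"
  have ent: "?G $ i $ j = (if j = \<pi> i then \<epsilon> i else 0)" for i j
    by (simp add: matrix_def g axis_def)
  have ee: "\<epsilon> i * \<epsilon> i = 1" for i using g(3)[of i] by (metis abs_mult_self_eq mult.right_neutral)
  have inj: "\<pi> i = \<pi> j \<longleftrightarrow> i = j" for i j using g(2) by (meson bij_def inj_eq)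
  have GT: "?G ** transpose ?G = mat 1"
  proof -
    have "(\<Sum>j\<in>UNIV. ?G $ i $ j * ?G $ l $ j) = (if i = l then 1 else 0)" for i l
    proof -
      have "(\<Sum>j\<in>UNIV. ?G $ i $ j * ?G $ l $ j) = (\<Sum>j\<in>UNIV. if j = \<pi> i then \<epsilon> i * ?G $ l $ \<pi> i else 0)"
        by (intro sum.cong) (auto simp: ent)
      then show ?thesis by (simp add: ent inj ee)
    qed
    then show ?thesis by (simp add: vec_eq_iff matrix_matrix_mult_def transpose_def mat_def)
  qed
  have "orthogonal_matrix ?G" using GT by (simp add: orthogonal_matrix_def matrix_left_right_inverse)
  then show "\<bar>det ?G\<bar> = 1" using det_orthogonal_matrix by force
  have "transpose (cof ?G) = (transpose (cof ?G) ** ?G) ** transpose ?G"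
    by (simp add: GT flip: matrix_mul_assoc)
  also have "\<dots> = det ?G *\<^sub>R transpose ?G"
    unfolding cof_transpose_mult by (simp flip: scalar_matrix_assoc)
  finally have "transpose (transpose (cof ?G)) = transpose (det ?G *\<^sub>R transpose ?G)" by simp
  then show "cof ?G = det ?G *\<^sub>R ?G" by (simp add: vec_eq_iff transpose_def)
  show "column k ?G = \<epsilon> k' *\<^sub>R axis k' 1" if "\<pi> k' = k"
    using inj that by (auto simp: column_def vec_eq_iff ent axis_def)
qed

lemma axis_face_int: "axis k s \<in> face_int k s"
  by (simp add: face_int_def axis_def)

lemma face_proj_face_int: "\<xi> \<in> ocube \<Longrightarrow> face_proj k s \<xi> \<in> face_int k s"
  unfolding ocube_iff by (simp add: face_int_def face_proj_def)

lemma tpol_face_proj: "f \<in> tpol d \<Longrightarrow> (\<lambda>\<xi>. f (face_proj k s \<xi>)) \<in> tpol d"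
proof (induction rule: tpol.induct)
  case (tpol_monom \<alpha> c)
  have "(\<lambda>\<xi>. (c * s ^ \<alpha> k) * monom3 (\<alpha>(k := 0)) \<xi>) \<in> tpol d"
    using tpol_monom by (intro tpol.tpol_monom) (auto simp: le_fun_def)
  then show ?case by (simp add: monom3_face mult.assoc)
next
  case (tpol_add f g)
  then show ?case using tpol.tpol_add by simp
qed

context fe_mesh
begin

text \<open>\<open>g\<close> carries the face \<open>(k, s)\<close> of \<open>e\<close> to the face \<open>(k', s')\<close> of \<open>e'\<close>; \<open>\<pi>\<close> and \<open>\<epsilon>\<close> are the
  permutation and the signs of \<open>g\<close>.\<close>

definition glued :: "'e \<Rightarrow> 3 \<Rightarrow> real \<Rightarrow> 'e \<Rightarrow> 3 \<Rightarrow> real \<Rightarrow> (real^3 \<Rightarrow> real^3) \<Rightarrow> (3 \<Rightarrow> 3) \<Rightarrow> (3 \<Rightarrow> real) \<Rightarrow> bool" where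
  "glued e k s e' k' s' g \<pi> \<epsilon> \<longleftrightarrow> e \<in> cells M \<and> e' \<in> cells M \<and> e \<noteq> e' \<and> \<bar>s\<bar> = 1 \<and> linear g \<and> g ` cube = cube \<and>
     bij \<pi> \<and> (\<forall>i. \<bar>\<epsilon> i\<bar> = 1) \<and> (\<forall>\<xi> i. g \<xi> $ i = \<epsilon> i * \<xi> $ \<pi> i) \<and> \<pi> k' = k \<and> s' = \<epsilon> k' * s \<and>
     (\<forall>\<eta>\<in>cube_face {k} (\<lambda>_. s). geo M e' (g \<eta>) = geo M e \<eta>)"

lemma glued_exists:
  assumes e: "e \<in> cells M" and s: "\<bar>s\<bar> = 1" and nb: "\<not> geo M e ` cube_face {k} (\<lambda>_. s) \<subseteq> frontier (dom M)"
  shows "\<exists>e' k' s' g \<pi> \<epsilon>. glued e k s e' k' s' g \<pi> \<epsilon>"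
proof -
  obtain \<zeta> where z: "\<zeta> \<in> cube_face {k} (\<lambda>_. s)" "geo M e \<zeta> \<notin> frontier (dom M)" using nb by auto
  have zc: "\<zeta> \<in> cube" "\<zeta> $ k = s" using z(1) by (auto simp: cube_face_def)
  have zd: "geo M e \<zeta> \<in> dom M"
    using z(2) geo_in_closure[OF e zc(1)] open_dom by (simp add: frontier_def interior_open)
  \<comment> \<open>The point off the frontier may lie on an edge. It is moved towards the centre of
    the face; openness of the domain keeps it off the frontier for small t.\<close>
  define p where "p t = \<zeta> + t *\<^sub>R (axis k s - \<zeta>)" for t :: real
  have pf: "p t \<in> face_int k s" if "0 < t" "t < 1" for t
  proof -
    have "\<bar>p t $ j\<bar> < 1" if j: "j \<noteq> k" for j
    proof -
      have "p t $ j = (1 - t) * \<zeta> $ j" using j by (simp add: p_def axis_def algebra_simps)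
      then have "\<bar>p t $ j\<bar> = (1 - t) * \<bar>\<zeta> $ j\<bar>" using \<open>t < 1\<close> by (simp add: abs_mult)
      also have "\<dots> \<le> (1 - t) * 1" using zc(1) \<open>t < 1\<close> by (intro mult_left_mono) (auto simp: cube_def)
      finally show ?thesis using \<open>0 < t\<close> by simp
    qed
    then show ?thesis using zc(2) by (simp add: face_int_def p_def axis_def)
  qed
  have t01: "\<forall>\<^sub>F t in at_right (0::real). 0 < t \<and> t < 1"
    by (rule eventually_at_right_real[of 0 1, THEN eventually_mono]) auto
  \<comment> \<open>The second case occurs when \<zeta> is already the centre: the path is constant
    and does not converge in the punctured sense.\<close>
  have "filterlim p (at \<zeta> within cube) (at_right 0) \<or> (\<exists>t. 0 < t \<and> t < 1 \<and> p t = \<zeta>)"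
  proof (cases "\<exists>t. 0 < t \<and> t < 1 \<and> p t = \<zeta>")
    case False
    have "\<forall>\<^sub>F t in at_right 0. p t \<in> cube \<and> p t \<noteq> \<zeta>"
      using t01 by eventually_elim (use False pf face_int_cube[OF s] in auto)
    then show ?thesis unfolding filterlim_at using line_at_right[of \<zeta> "axis k s - \<zeta>"] by (auto simp: p_def[abs_def] elim: eventually_mono)
  qed auto
  then obtain t where t: "0 < t" "t < 1" "geo M e (p t) \<in> dom M"
  proof
    assume f: "filterlim p (at \<zeta> within cube) (at_right 0)"
    have "(geo M e \<longlongrightarrow> geo M e \<zeta>) (at \<zeta> within cube)" using geo_continuous[OF e] zc(1) by (simp add: continuous_on_def)
    then have "\<forall>\<^sub>F y in at \<zeta> within cube. geo M e y \<in> dom M" by (rule topological_tendstoD) (auto simp: open_dom zd)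
    from eventually_compose_filterlim[OF this f] t01
    have "\<forall>\<^sub>F t in at_right 0. geo M e (p t) \<in> dom M \<and> 0 < t \<and> t < 1" by eventually_elim auto
    then have "\<exists>t. geo M e (p t) \<in> dom M \<and> 0 < t \<and> t < 1"
      by (rule eventually_happens'[rotated]) simp
    then show ?thesis using that by (elim exE conjE)
  next
    assume "\<exists>t. 0 < t \<and> t < 1 \<and> p t = \<zeta>" then show ?thesis using that zd by auto
  qed
  have nf: "geo M e (p t) \<notin> frontier (dom M)" using t(3) open_dom by (simp add: frontier_def interior_open)
  have pt: "p t \<in> face_int k s" using pf t by auto
  obtain e' where e': "e' \<in> cells M" "e' \<noteq> e" "geo M e (p t) \<in> geo M e' ` cube"
    using unshared_frontier[OF e s pt] nf by blast
  obtain g where g: "linear g" "g ` cube = cube" "\<And>\<eta>. \<eta> \<in> cube_face {k} (\<lambda>_. s) \<Longrightarrow> geo M e' (g \<eta>) = geo M e \<eta>"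
    using shared_face[OF e e'(1) e'(2)[symmetric] s pt e'(3)] by metis
  obtain \<pi> \<epsilon> where p: "bij \<pi>" "\<And>i. \<bar>\<epsilon> i\<bar> = 1" "\<And>\<xi> i. g \<xi> $ i = \<epsilon> i * \<xi> $ \<pi> i"
    using cube_signed_perm[OF g(1,2)] by metis
  \<comment> \<open>Component i of g reads coordinate \<pi> i, so the constant coordinate k
    reappears at position \<open>inv \<pi> k\<close> with its sign.\<close>
  have "glued e k s e' (inv \<pi> k) (\<epsilon> (inv \<pi> k) * s) g \<pi> \<epsilon>"
    unfolding glued_def using e s e' g p by (simp add: surj_f_inv_f bij_is_surj)
  then show ?thesis by blast
qed

lemma gluedD:
  assumes "glued e k s e' k' s' g \<pi> \<epsilon>"
  shows "e \<in> cells M" "e' \<in> cells M" "e \<noteq> e'" "\<bar>s\<bar> = 1" "linear g" "g ` cube = cube"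
     "bij \<pi>" "\<And>i. \<bar>\<epsilon> i\<bar> = 1" "\<And>\<xi> i. g \<xi> $ i = \<epsilon> i * \<xi> $ \<pi> i" "\<pi> k' = k" "s' = \<epsilon> k' * s"
     "\<And>\<eta>. \<eta> \<in> cube_face {k} (\<lambda>_. s) \<Longrightarrow> geo M e' (g \<eta>) = geo M e \<eta>"
     "\<bar>s'\<bar> = 1" "\<And>j. \<pi> j = k \<longleftrightarrow> j = k'"
  using assms unfolding glued_def by (auto simp: abs_mult dest: bij_is_inj inj_eq)

lemma glued_face_int:
  assumes "glued e k s e' k' s' g \<pi> \<epsilon>" "\<eta> \<in> face_int k s" shows "g \<eta> \<in> face_int k' s'"
proof -
  note g = gluedD[OF assms(1)]
  have "g \<eta> $ k' = s'" using assms(2) g(9)[of \<eta> k'] g(10,11) by (simp add: face_int_def)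
  moreover have "\<bar>g \<eta> $ j\<bar> < 1" if "j \<noteq> k'" for j
    using assms(2) that by (simp add: face_int_def abs_mult g(8,9,14))
  ultimately show ?thesis by (simp add: face_int_def)
qed

lemma glued_column:
  fixes f f' :: "real^3 \<Rightarrow> real^3"
  assumes G: "glued e k s e' k' s' g \<pi> \<epsilon>" and \<eta>: "\<eta> \<in> face_int k s" and j: "j \<noteq> k"
    and f: "(f has_derivative (\<lambda>h. A *v h)) (at \<eta> within cube)"
    and f': "(f' has_derivative (\<lambda>h. A' *v h)) (at (g \<eta>) within cube)"
    and eq: "\<And>\<eta>. \<eta> \<in> cube_face {k} (\<lambda>_. s) \<Longrightarrow> f' (g \<eta>) = f \<eta>"
  shows "column j (A' ** matrix g) = column j A"
proof (rule face_column_eq[where f = "f' \<circ> g" and f' = f, OF gluedD(4)[OF G] \<eta> j])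
  note g = gluedD[OF G]
  have "(g has_derivative g) (at \<eta> within cube)"
    by (rule bounded_linear_imp_has_derivative) (use g(5) linear_conv_bounded_linear in auto)
  moreover have "(f' has_derivative (\<lambda>h. A' *v h)) (at (g \<eta>) within g ` cube)" using f' g(6) by simp
  ultimately have "(f' \<circ> g has_derivative (\<lambda>h. A' *v h) \<circ> g) (at \<eta> within cube)" by (rule diff_chain_within)
  moreover have "(\<lambda>h. A' *v h) \<circ> g = (\<lambda>h. (A' ** matrix g) *v h)"
    using g(5) by (simp add: fun_eq_iff matrix_works flip: matrix_vector_mul_assoc)
  ultimately show "(f' \<circ> g has_derivative (\<lambda>h. (A' ** matrix g) *v h)) (at \<eta> within cube)" by simp
qed (use f eq in auto)

text \<open>The face flux vector transforms by the cofactor of the gluing matrix G. As cof G = det G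
  G, whose k-th column is a signed axis vector, only the factor det G is left beside the signs of
  the faces.\<close>

lemma glued_mcross:
  assumes G: "glued e k s e' k' s' g \<pi> \<epsilon>"
    and A: "\<And>j. j \<noteq> k \<Longrightarrow> column j (A' ** matrix g) = column j A"
    and B: "\<And>j. j \<noteq> k \<Longrightarrow> column j (B' ** matrix g) = column j B"
  shows "s' *\<^sub>R column k' (mcross A' B') = (det (matrix g) * s) *\<^sub>R column k (mcross A B)"
proof -
  note g = gluedD[OF G]
  note c = signed_perm_cof[OF g(5) g(9) g(7) g(8)]
  let ?d = "det (matrix g)"
  have dd: "?d * ?d = 1" using c(2) by (metis abs_mult_self_eq mult.right_neutral)
  have "column k (mcross A B) = column k (mcross (A' ** matrix g) (B' ** matrix g))"
    by (rule mcross_column_cong) (simp_all add: A B)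
  also have "\<dots> = mcross A' B' *v (?d *\<^sub>R (\<epsilon> k' *\<^sub>R axis k' 1))"
  proof -
    have "column k (?d *\<^sub>R matrix g) = ?d *\<^sub>R column k (matrix g)" by (simp add: column_def vec_eq_iff)
    then show ?thesis by (simp only: mcross_mult column_matrix_mult c(1) c(3)[OF g(10)])
  qed
  also have "\<dots> = (?d * \<epsilon> k') *\<^sub>R column k' (mcross A' B')"
    by (simp add: matrix_vector_mult_scaleR matrix_vector_mult_basis)
  finally have "(?d * s) *\<^sub>R column k (mcross A B) = (?d * ?d) *\<^sub>R (\<epsilon> k' * s) *\<^sub>R column k' (mcross A' B')"
    by (simp add: mult_ac)
  then show ?thesis using g(11) dd by simp
qed

lemma glued_geo_column:
  assumes G: "glued e k s e' k' s' g \<pi> \<epsilon>" and \<eta>: "\<eta> \<in> face_int k s" and j: "j \<noteq> k"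
  shows "column j (geo_jac M e' (g \<eta>) ** matrix g) = column j (geo_jac M e \<eta>)"
proof -
  note g = gluedD[OF G]
  have "g \<eta> \<in> cube" using face_int_cube[OF g(13) glued_face_int[OF G \<eta>]] .
  then show ?thesis
    using glued_column[OF G \<eta> j geo_rep(4)[OF g(1) face_int_cube[OF g(4) \<eta>]] geo_rep(4)[OF g(2)]] g(12) by blast
qed

lemma glued_jac_column:
  assumes G: "glued e k s e' k' s' g \<pi> \<epsilon>" and \<eta>: "\<eta> \<in> face_int k s" and j: "j \<noteq> k"
    and u: "u \<in> conforming_fields M"
  shows "column j (jac M e' u (g \<eta>) ** matrix g) = column j (jac M e u \<eta>)"
proof -
  note g = gluedD[OF G]
  have "g \<eta> \<in> cube" using face_int_cube[OF g(13) glued_face_int[OF G \<eta>]] .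
  then show ?thesis
    by (rule glued_column[OF G \<eta> j field_rep(4)[OF g(1) u face_int_cube[OF g(4) \<eta>]] field_rep(4)[OF g(2) u]])
       (simp add: g(12))
qed

text \<open>The same transformation law applied to the geometry itself, since the mixed cofactor of
  a matrix with itself is twice its cofactor.\<close>

lemma glued_normal_det:
  assumes G: "glued e k s e' k' s' g \<pi> \<epsilon>" and \<eta>: "\<eta> \<in> face_int k s"
  shows "face_normal e' k' s' (g \<eta>) = det (matrix g) *\<^sub>R face_normal e k s \<eta>"
proof -
  have "s' *\<^sub>R column k' (mcross (geo_jac M e' (g \<eta>)) (geo_jac M e' (g \<eta>))) =
     (det (matrix g) * s) *\<^sub>R column k (mcross (geo_jac M e \<eta>) (geo_jac M e \<eta>))"
    by (rule glued_mcross[OF G]) (rule glued_geo_column[OF G \<eta>], assumption)+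
  moreover have "column j (2 *\<^sub>R A) = 2 *\<^sub>R column j A" for j and A :: "real^3^3" by (simp add: column_def vec_eq_iff)
  ultimately have "2 *\<^sub>R face_normal e' k' s' (g \<eta>) = 2 *\<^sub>R (det (matrix g) *\<^sub>R face_normal e k s \<eta>)"
    by (simp add: mcross_self face_normal_def mult_ac)
  then show ?thesis by (simp only: scaleR_cancel_left) simp
qed

lemma glued_point: "glued e k s e' k' s' g \<pi> \<epsilon> \<Longrightarrow> \<eta> \<in> face_int k s \<Longrightarrow> geo M e \<eta> = geo M e' (g \<eta>)"
  using gluedD(4,12) face_int_face by metis

text \<open>Glued cells lie on opposite sides of their common face, so the gluing map reverses
  orientation.\<close>

lemma glued_det:
  assumes G: "glued e k s e' k' s' g \<pi> \<epsilon>" shows "det (matrix g) = -1"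
proof -
  note g = gluedD[OF G]
  note \<eta> = axis_face_int[of k s]
  have "det (matrix g) \<noteq> 1"
    using shared_normals[OF g(1,2,3,4,13) \<eta> glued_face_int[OF G \<eta>] glued_point[OF G \<eta>]] glued_normal_det[OF G \<eta>] by auto
  moreover have "\<bar>det (matrix g)\<bar> = 1" using signed_perm_cof(2)[OF g(5) g(9) g(7) g(8)] .
  ultimately show ?thesis by linarith
qed

lemma glued_normal:
  "glued e k s e' k' s' g \<pi> \<epsilon> \<Longrightarrow> \<eta> \<in> face_int k s \<Longrightarrow> face_normal e' k' s' (g \<eta>) = - face_normal e k s \<eta>"
  using glued_normal_det glued_det by simp

lemma glued_not_frontier:
  assumes G: "glued e k s e' k' s' g \<pi> \<epsilon>" and \<eta>: "\<eta> \<in> face_int k s"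
  shows "geo M e \<eta> \<notin> frontier (dom M)"
  by (rule shared_not_frontier[OF gluedD(1,2)[OF G] gluedD(4,13)[OF G] \<eta> glued_face_int[OF G \<eta>] glued_point[OF G \<eta>] glued_normal[OF G \<eta>]])

lemma glued_axis:
  assumes G: "glued e k s e' k' s' g \<pi> \<epsilon>" shows "g (axis k s) = axis k' s'"
  using gluedD[OF G] by (simp add: vec_eq_iff axis_def)

text \<open>Two cells glued to the same face of \<open>e'\<close> would both lie opposite to
  \<open>e'\<close>, hence on the same side with equal normals, which \<open>shared_normals\<close>
  forbids. The face centres serve as test points.\<close>

lemma glued_unique:
  assumes 1: "glued e1 k1 s1 e' k' s' g1 \<pi>1 \<epsilon>1" and 2: "glued e2 k2 s2 e' k' s' g2 \<pi>2 \<epsilon>2"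
  shows "e1 = e2 \<and> k1 = k2 \<and> s1 = s2"
proof -
  note \<eta>1 = axis_face_int[of k1 s1] and \<eta>2 = axis_face_int[of k2 s2]
  note g1 = gluedD[OF 1] and g2 = gluedD[OF 2]
  have pt: "geo M e1 (axis k1 s1) = geo M e2 (axis k2 s2)"
    using glued_point[OF 1 \<eta>1] glued_point[OF 2 \<eta>2] by (simp add: glued_axis[OF 1] glued_axis[OF 2])
  have "face_normal e1 k1 s1 (axis k1 s1) = face_normal e2 k2 s2 (axis k2 s2)"
    using glued_normal[OF 1 \<eta>1] glued_normal[OF 2 \<eta>2] by (simp add: glued_axis[OF 1] glued_axis[OF 2])
  then have e: "e1 = e2" using shared_normals[OF g1(1) g2(1) _ g1(4) g2(4) \<eta>1 \<eta>2 pt] by blast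
  then have "axis k1 s1 = axis k2 s2"
    using pt inj_geo[OF g1(1)] face_int_cube[OF g1(4) \<eta>1] face_int_cube[OF g2(4) \<eta>2] by (simp add: inj_on_def)
  then show ?thesis using e g1(4) by (auto simp: axis_eq_axis)
qed

section \<open>Fluxes through the faces\<close>

definition flux_density :: "(real^3 \<Rightarrow> real^3) \<Rightarrow> (real^3 \<Rightarrow> real^3) \<Rightarrow> 'e \<Rightarrow> 3 \<Rightarrow> real^3 \<Rightarrow> real" where
  "flux_density u v e k \<xi> = pfield (geo_rep e) \<xi> \<bullet> column k (mcross (pjac (field_rep e u) \<xi>) (pjac (field_rep e v) \<xi>))"

text \<open>Averaged over the cube, this is twice the outward flux of the position vector potential
  through the face; the halves in the later formulas compensate for it.\<close>

definition flux :: "(real^3 \<Rightarrow> real^3) \<Rightarrow> (real^3 \<Rightarrow> real^3) \<Rightarrow> 'e \<times> 3 \<times> real \<Rightarrow> real" where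
  "flux u v = (\<lambda>(e, k, s). s * integral cube (\<lambda>\<xi>. flux_density u v e k (face_proj k s \<xi>)))"

lemma flux_density_sum:
  "flux_density u v e k = (\<lambda>\<xi>. \<Sum>i\<in>UNIV. geo_rep e i \<xi> *
     ((pd (k+1) (field_rep e u (i+1)) \<xi> * pd (k+2) (field_rep e v (i+2)) \<xi> - pd (k+2) (field_rep e u (i+1)) \<xi> * pd (k+1) (field_rep e v (i+2)) \<xi>)
    + (pd (k+1) (field_rep e v (i+1)) \<xi> * pd (k+2) (field_rep e u (i+2)) \<xi> - pd (k+2) (field_rep e v (i+1)) \<xi> * pd (k+1) (field_rep e u (i+2)) \<xi>)))"
  by (simp add: fun_eq_iff flux_density_def inner_vec_def pfield_def column_def mcross_nth pjac_def)

lemma tpol_flux_density: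
  assumes e: "e \<in> cells M" and u: "u \<in> conforming_fields M" and v: "v \<in> conforming_fields M"
  shows "flux_density u v e k \<in> tpol (\<lambda>i. 2 + (degree_of M e + degree_of M e))"
  unfolding flux_density_sum
  by (intro tpol_sum tpol_mult tpol_add tpol_diff tpol_pd' geo_rep[OF e] field_rep[OF e u] field_rep[OF e v])

lemma flux_density_eq:
  assumes e: "e \<in> cells M" and u: "u \<in> conforming_fields M" and v: "v \<in> conforming_fields M" and \<xi>: "\<xi> \<in> cube"
  shows "flux_density u v e k \<xi> = geo M e \<xi> \<bullet> column k (mcross (jac M e u \<xi>) (jac M e v \<xi>))"
  by (simp only: flux_density_def geo_rep(2)[OF e \<xi>] field_rep(3)[OF e u \<xi>] field_rep(3)[OF e v \<xi>])

lemma integral_cube_ocube: "integral cube f = integral ocube f" for f :: "real^3 \<Rightarrow> real"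
  unfolding cube_cbox by (rule integral_open_interval[symmetric])

lemma flux_glued:
  assumes G: "glued e k s e' k' s' g \<pi> \<epsilon>" and u: "u \<in> conforming_fields M" and v: "v \<in> conforming_fields M"
  shows "flux u v (e', k', s') = - flux u v (e, k, s)"
proof -
  note g = gluedD[OF G]
  let ?q = "\<lambda>e k s \<xi>. flux_density u v e k (face_proj k s \<xi>)"
  have "integral cube (?q e' k' s') = integral cube (\<lambda>\<xi>. ?q e' k' s' (g \<xi>))"
    by (rule integral_cube_signed_perm[OF tpol_face_proj[OF tpol_flux_density[OF g(2) u v]] g(9,7,8), symmetric])
       (use g(5) in \<open>simp add: linear_continuous_on linear_conv_bounded_linear\<close>)
  \<comment> \<open>Projecting the open cube hits only relative interiors of faces, where the
    tangential columns are known to agree.\<close>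
  then have "flux u v (e', k', s') = integral ocube (\<lambda>\<xi>. s' * ?q e' k' s' (g \<xi>))"
    by (simp add: flux_def integral_cube_ocube)
  also have "\<dots> = integral ocube (\<lambda>\<xi>. - s * ?q e k s \<xi>)"
  proof (rule integral_cong)
    fix \<xi> :: "real^3" assume "\<xi> \<in> ocube"
    then have \<eta>: "face_proj k s \<xi> \<in> face_int k s" by (rule face_proj_face_int)
    let ?\<eta> = "face_proj k s \<xi>"
    have p: "face_proj k' s' (g \<xi>) = g ?\<eta>"
      using g(9,11,14) by (auto simp: face_proj_def vec_eq_iff)
    have c: "?\<eta> \<in> cube" "g ?\<eta> \<in> cube"
      using face_int_cube[OF g(4) \<eta>] face_int_cube[OF g(13) glued_face_int[OF G \<eta>]] by auto
    have "s' *\<^sub>R column k' (mcross (jac M e' u (g ?\<eta>)) (jac M e' v (g ?\<eta>))) =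
      (det (matrix g) * s) *\<^sub>R column k (mcross (jac M e u ?\<eta>) (jac M e v ?\<eta>))"
      by (rule glued_mcross[OF G]) (rule glued_jac_column[OF G \<eta> _ u] glued_jac_column[OF G \<eta> _ v], assumption)+
    then have "geo M e ?\<eta> \<bullet> (s' *\<^sub>R column k' (mcross (jac M e' u (g ?\<eta>)) (jac M e' v (g ?\<eta>)))) =
      geo M e ?\<eta> \<bullet> ((- s) *\<^sub>R column k (mcross (jac M e u ?\<eta>) (jac M e v ?\<eta>)))"
      by (simp only: glued_det[OF G] mult_minus_left mult_1)
    then show "s' * ?q e' k' s' (g \<xi>) = - s * ?q e k s \<xi>"
      unfolding p flux_density_eq[OF g(2) u v c(2)] flux_density_eq[OF g(1) u v c(1)] glued_point[OF G \<eta>, symmetric]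
      by (simp only: inner_scaleR_right)
  qed
  also have "\<dots> = - flux u v (e, k, s)" by (simp add: flux_def integral_cube_ocube)
  finally show ?thesis .
qed

definition all_faces :: "('e \<times> 3 \<times> real) set" where
  "all_faces = cells M \<times> UNIV \<times> {-1, 1}"

lemma finite_all_faces: "finite all_faces"
  by (simp add: all_faces_def finite_cells)

lemma boundary_faces_subset: "boundary_faces M \<subseteq> all_faces"
  by (auto simp: boundary_faces_def all_faces_def)

text \<open>Passing to the glued partner is an injective self-map of a finite set, hence a
  permutation, and it changes the sign of every flux; the sum equals its own negative.\<close>

lemma flux_interior_zero:
  assumes u: "u \<in> conforming_fields M" and v: "v \<in> conforming_fields M"
  shows "(\<Sum>f\<in>all_faces - boundary_faces M. flux u v f) = 0"
proof -
  let ?N = "all_faces - boundary_faces M"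
  define R where "R f f' \<longleftrightarrow> (case f of (e, k, s) \<Rightarrow> case f' of (e', k', s') \<Rightarrow> \<exists>g \<pi> \<epsilon>. glued e k s e' k' s' g \<pi> \<epsilon>)"
    for f f' :: "'e \<times> 3 \<times> real"
  have "\<exists>f'. R f f'" if f: "f \<in> ?N" for f
  proof -
    obtain e k s where fe: "f = (e, k, s)" by (cases f) auto
    have "e \<in> cells M" "s \<in> {-1, 1}" using f by (auto simp: all_faces_def fe)
    moreover from this have "\<not> geo M e ` cube_face {k} (\<lambda>_. s) \<subseteq> frontier (dom M)"
      using f by (auto simp: boundary_faces_def fe)
    ultimately obtain e' k' s' g \<pi> \<epsilon> where "glued e k s e' k' s' g \<pi> \<epsilon>" using glued_exists[of e s k] by fastforce
    then have "R f (e', k', s')" unfolding R_def fe by auto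
    then show ?thesis ..
  qed
  then obtain P where P: "\<And>f. f \<in> ?N \<Longrightarrow> R f (P f)" by metis
  have inj: "inj_on P ?N"
  proof (rule inj_onI)
    fix f1 f2 assume "f1 \<in> ?N" "f2 \<in> ?N" "P f1 = P f2"
    then have "R f1 (P f1)" "R f2 (P f1)" using P by metis+
    then show "f1 = f2" unfolding R_def using glued_unique by (fastforce split: prod.splits)
  qed
  \<comment> \<open>The partner is again an interior face because its centre is a glued point and
    therefore off the frontier.\<close>
  have "P f \<in> ?N" if f: "f \<in> ?N" for f
  proof -
    obtain e k s e' k' s' g \<pi> \<epsilon> where fe: "f = (e, k, s)" "P f = (e', k', s')" and G: "glued e k s e' k' s' g \<pi> \<epsilon>"
      using P[OF f] unfolding R_def by (auto split: prod.splits)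
    note g = gluedD[OF G]
    have "geo M e (axis k s) = geo M e' (axis k' s')"
      using glued_point[OF G axis_face_int] by (simp add: glued_axis[OF G])
    then have "geo M e' (axis k' s') \<notin> frontier (dom M)" using glued_not_frontier[OF G axis_face_int] by simp
    moreover have "axis k' s' \<in> cube_face {k'} (\<lambda>_. s')" using face_int_face[OF g(13) axis_face_int] .
    ultimately have "(e', k', s') \<notin> boundary_faces M" by (auto simp: boundary_faces_def)
    moreover have "s' \<in> {-1, 1}" using g(13) by (auto simp: abs_if split: if_splits)
    ultimately show ?thesis using g(2) unfolding fe(2) by (simp add: all_faces_def)
  qed
  then have "P ` ?N = ?N" using inj finite_all_faces by (intro endo_inj_surj) auto
  then have "(\<Sum>f\<in>?N. flux u v f) = (\<Sum>f\<in>?N. flux u v (P f))"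
    using sum.reindex[OF inj, of "flux u v"] by simp
  also have "\<dots> = (\<Sum>f\<in>?N. - flux u v f)"
  proof (rule sum.cong)
    fix f assume f: "f \<in> ?N"
    obtain e k s e' k' s' g \<pi> \<epsilon> where fe: "f = (e, k, s)" "P f = (e', k', s')" and G: "glued e k s e' k' s' g \<pi> \<epsilon>"
      using P[OF f] unfolding R_def by (auto split: prod.splits)
    show "flux u v (P f) = - flux u v f" unfolding fe(2) unfolding fe(1) by (rule flux_glued[OF G u v])
  qed simp
  finally show ?thesis by (simp add: sum_negf)
qed

end

text \<open>The divergence of the cross product of two gradients vanishes because second derivatives
  commute.\<close>

lemma piola_identity:
  assumes a: "a \<in> tpol d" and b: "b \<in> tpol d"
  shows "(\<Sum>k\<in>UNIV. pd k (\<lambda>\<xi>. pd (k+1) a \<xi> * pd (k+2) b \<xi> - pd (k+2) a \<xi> * pd (k+1) b \<xi>) \<xi>) = 0"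
proof -
  have p: "pd k (\<lambda>\<xi>. pd i a \<xi> * pd j b \<xi> - pd j a \<xi> * pd i b \<xi>) \<xi> =
     pd i a \<xi> * pd k (pd j b) \<xi> + pd k (pd i a) \<xi> * pd j b \<xi> - (pd j a \<xi> * pd k (pd i b) \<xi> + pd k (pd j a) \<xi> * pd i b \<xi>)" for i j k
    by (simp add: pd_diff[OF tpol_mult[OF tpol_pd'[OF a] tpol_pd'[OF b]] tpol_mult[OF tpol_pd'[OF a] tpol_pd'[OF b]]]
        pd_mult[OF tpol_pd'[OF a] tpol_pd'[OF b]])
  show ?thesis unfolding p
    by (simp add: sum_3 numeral_3_mod pd_commute[OF a, of 2 1] pd_commute[OF a, of 3 1] pd_commute[OF a, of 3 2]
        pd_commute[OF b, of 2 1] pd_commute[OF b, of 3 1] pd_commute[OF b, of 3 2] algebra_simps)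
qed

section \<open>Divergence theorem for the mixed cofactor integrand\<close>

context fe_mesh
begin

lemma flux_divergence:
  assumes e: "e \<in> cells M" and u: "u \<in> conforming_fields M" and v: "v \<in> conforming_fields M"
  shows "2 * integral cube (\<lambda>\<xi>. frob (pjac (geo_rep e) \<xi>) (mcross (pjac (field_rep e u) \<xi>) (pjac (field_rep e v) \<xi>))) =
    (\<Sum>(k, s)\<in>UNIV \<times> {-1, 1}. flux u v (e, k, s))"
proof -
  let ?G = "geo_rep e" and ?U = "field_rep e u" and ?V = "field_rep e v"
  note t = geo_rep(1)[OF e] field_rep(1)[OF e u] field_rep(1)[OF e v]
  define m where "m a b k = (\<lambda>\<xi>. pd (k+1) a \<xi> * pd (k+2) b \<xi> - pd (k+2) a \<xi> * pd (k+1) b \<xi>)"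
    for a b :: "real^3 \<Rightarrow> real" and k :: 3
  have tm: "m a b k \<in> tpol (\<lambda>i. degree_of M e + degree_of M e)"
    if "a \<in> tpol (\<lambda>_. degree_of M e)" "b \<in> tpol (\<lambda>_. degree_of M e)" for a b k
    unfolding m_def by (intro tpol_diff tpol_mult tpol_pd' that)
  \<comment> \<open>The entry (i, k) of the mixed cofactor; each of its rows is a sum of two cross
    products of gradients and thus free of divergence.\<close>
  define w where "w i k = (\<lambda>\<xi>. m (?U (i+1)) (?V (i+2)) k \<xi> + m (?V (i+1)) (?U (i+2)) k \<xi>)" for i k
  have tw: "w i k \<in> tpol (\<lambda>i. degree_of M e + degree_of M e)" for i k
    unfolding w_def by (intro tpol_add tm t)
  have fd: "flux_density u v e k = (\<lambda>\<xi>. \<Sum>i\<in>UNIV. ?G i \<xi> * w i k \<xi>)" for k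
    by (simp add: flux_density_sum w_def m_def)
  have tgw: "(\<lambda>\<xi>. ?G i \<xi> * w i k \<xi>) \<in> tpol (\<lambda>i. 2 + (degree_of M e + degree_of M e))" for i k
    by (intro tpol_mult t tw)
  have pdsum: "pd k (flux_density u v e k) \<xi> = (\<Sum>i\<in>UNIV. ?G i \<xi> * pd k (w i k) \<xi> + pd k (?G i) \<xi> * w i k \<xi>)" for k \<xi>
    unfolding fd sum_3
    by (simp add: pd_add[OF tpol_add[OF tgw tgw] tgw] pd_add[OF tgw tgw] pd_mult[OF t(1) tw])
  have piola: "(\<Sum>k\<in>UNIV. pd k (w i k) \<xi>) = 0" for i \<xi>
  proof -
    have "pd k (w i k) \<xi> = pd k (m (?U (i+1)) (?V (i+2)) k) \<xi> + pd k (m (?V (i+1)) (?U (i+2)) k) \<xi>" for k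
      unfolding w_def by (simp add: pd_add[OF tm[OF t(2) t(3)] tm[OF t(3) t(2)]])
    then show ?thesis
      by (simp add: sum.distrib m_def piola_identity[OF t(2) t(3)] piola_identity[OF t(3) t(2)])
  qed
  have "frob (pjac ?G \<xi>) (mcross (pjac ?U \<xi>) (pjac ?V \<xi>)) = (\<Sum>k\<in>UNIV. pd k (flux_density u v e k) \<xi>)" for \<xi>
  proof -
    have "(\<Sum>k\<in>UNIV. pd k (flux_density u v e k) \<xi>) = (\<Sum>i\<in>UNIV. ?G i \<xi> * (\<Sum>k\<in>UNIV. pd k (w i k) \<xi>)) + (\<Sum>i\<in>UNIV. \<Sum>k\<in>UNIV. pd k (?G i) \<xi> * w i k \<xi>)"
      unfolding pdsum by (subst sum.swap) (simp add: sum.distrib sum_distrib_left)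
    also have "\<dots> = (\<Sum>i\<in>UNIV. \<Sum>k\<in>UNIV. pd k (?G i) \<xi> * w i k \<xi>)" by (simp add: piola)
    also have "\<dots> = frob (pjac ?G \<xi>) (mcross (pjac ?U \<xi>) (pjac ?V \<xi>))"
      by (simp add: frob_sum mcross_nth pjac_def w_def m_def)
    finally show ?thesis by simp
  qed
  then have "2 * integral cube (\<lambda>\<xi>. frob (pjac ?G \<xi>) (mcross (pjac ?U \<xi>) (pjac ?V \<xi>))) =
     (\<Sum>k\<in>UNIV. 2 * integral cube (pd k (flux_density u v e k)))"
    by (simp add: integral_sum tpol_integrable[OF tpol_pd'[OF tpol_flux_density[OF e u v]]] sum_distrib_left)
  also have "\<dots> = (\<Sum>k\<in>UNIV. flux u v (e, k, -1) + flux u v (e, k, 1))"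
    by (simp add: integral_cube_pd[OF tpol_flux_density[OF e u v]] flux_def)
  also have "\<dots> = (\<Sum>(k, s)\<in>UNIV \<times> {-1, 1}. flux u v (e, k, s))"
    unfolding sum.cartesian_product[symmetric] by simp
  finally show ?thesis .
qed

lemma reference_form_flux:
  assumes y: "y \<in> conforming_fields M" and u: "u \<in> conforming_fields M" and v: "v \<in> conforming_fields M"
  shows "reference_form M (\<lambda>X. c *\<^sub>R X) y u v = c / 2 * (\<Sum>f\<in>boundary_faces M. flux u v f)"
proof -
  have cell: "quad M e (\<lambda>\<xi>. frob (jac M e (\<lambda>X. c *\<^sub>R X) \<xi>) (mcross (jac M e u \<xi>) (jac M e v \<xi>))) =
     c / 2 * (\<Sum>(k, s)\<in>UNIV \<times> {-1, 1}. flux u v (e, k, s))" (is "quad M e ?f = _") if e: "e \<in> cells M" for e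
  proof -
    \<comment> \<open>The vanishing quadrature defect is what admits the divergence theorem for a
      quadrature sum.\<close>
    have "quad M e ?f = integral cube ?f"
      using quad_defect_scaled_geo[OF e, of "pullback M e u" "pullback M e v" c] u v e
      by (simp add: quad_defect_def Let_def conforming_fields_def)
    also have "\<dots> = integral cube (\<lambda>\<xi>. c * frob (pjac (geo_rep e) \<xi>) (mcross (pjac (field_rep e u) \<xi>) (pjac (field_rep e v) \<xi>)))"
      by (rule integral_cong)
         (simp only: jac_scaled_id[OF e] frob_scale geo_rep(3)[OF e] field_rep(3)[OF e u] field_rep(3)[OF e v])
    also have "\<dots> = c / 2 * (2 * integral cube (\<lambda>\<xi>. frob (pjac (geo_rep e) \<xi>) (mcross (pjac (field_rep e u) \<xi>) (pjac (field_rep e v) \<xi>))))"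
      by simp
    finally show ?thesis unfolding flux_divergence[OF e u v] .
  qed
  have "reference_form M (\<lambda>X. c *\<^sub>R X) y u v = (\<Sum>e\<in>cells M. c / 2 * (\<Sum>(k, s)\<in>UNIV \<times> {-1, 1}. flux u v (e, k, s)))"
    unfolding reference_form_eq[OF y u v] by (intro sum.cong cell refl)
  also have "\<dots> = c / 2 * (\<Sum>f\<in>all_faces. flux u v f)"
    unfolding all_faces_def sum_distrib_left[symmetric]
    by (subst sum.cartesian_product) (simp add: case_prod_unfold)
  also have "(\<Sum>f\<in>all_faces. flux u v f) = (\<Sum>f\<in>boundary_faces M. flux u v f)"
    using sum.subset_diff[OF boundary_faces_subset finite_all_faces, of "flux u v"] flux_interior_zero[OF u v] by simp
  finally show ?thesis .
qed

end

section \<open>The boundary functional\<close>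

abbreviation square :: "(real \<times> real) set" where "square \<equiv> cbox (-1, -1) (1, 1)"

lemma square_interior: "q \<in> box (-1, -1) (1, 1) \<longleftrightarrow> \<bar>fst q\<bar> < 1 \<and> \<bar>snd q\<bar> < 1" for q :: "real \<times> real"
proof (cases q)
  case (Pair x y)
  then show ?thesis by (simp add: mem_box ball_Un Basis_prod_def abs_less_iff) linarith
qed

lemma face_point_face_int: "q \<in> box (-1, -1) (1, 1) \<Longrightarrow> face_point k s q \<in> face_int k s"
  using UNIV_3_cyclic[of k] unfolding square_interior by (auto simp: face_int_def face_point_def)

lemma face_point_cube: "q \<in> square \<Longrightarrow> \<bar>s\<bar> = 1 \<Longrightarrow> face_point k s q \<in> cube"
  by (cases q) (auto simp: cube_def face_point_def mem_box Basis_prod_def abs_le_iff)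

context fe_mesh
begin

text \<open>The common shape of the boundary functional and of its Hessian after pullback, with the
  cofactor replaced by an arbitrary cellwise matrix field so that linearity can be used.\<close>

definition boundary_form :: "real \<Rightarrow> ('e \<Rightarrow> real^3 \<Rightarrow> real^3^3) \<Rightarrow> real" where
  "boundary_form c A = (\<Sum>(e, k, s)\<in>boundary_faces M. s * c *
     integral square (\<lambda>q. geo M e (face_point k s q) \<bullet> column k (A e (face_point k s q))))"

lemma boundary_facesD:
  assumes "(e, k, s) \<in> boundary_faces M"
  shows "e \<in> cells M" "\<bar>s\<bar> = 1" "\<And>\<eta>. \<eta> \<in> cube_face {k} (\<lambda>_. s) \<Longrightarrow> geo M e \<eta> \<in> frontier (dom M)"
  using assms by (auto simp: boundary_faces_def)

lemma boundary_form_cong: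
  assumes "\<And>e k s \<eta>. (e, k, s) \<in> boundary_faces M \<Longrightarrow> \<eta> \<in> face_int k s \<Longrightarrow> column k (A e \<eta>) = column k (B e \<eta>)"
  shows "boundary_form c A = boundary_form c B"
  unfolding boundary_form_def
proof (rule sum.cong[OF refl], clarify)
  fix e k s assume f: "(e, k, s) \<in> boundary_faces M"
  have "integral (box (-1, -1) (1, 1)) (\<lambda>q. geo M e (face_point k s q) \<bullet> column k (A e (face_point k s q))) =
     integral (box (-1, -1) (1, 1)) (\<lambda>q. geo M e (face_point k s q) \<bullet> column k (B e (face_point k s q)))"
    by (rule integral_cong) (simp only: assms[OF f face_point_face_int])
  then show "s * c * integral square (\<lambda>q. geo M e (face_point k s q) \<bullet> column k (A e (face_point k s q))) =
     s * c * integral square (\<lambda>q. geo M e (face_point k s q) \<bullet> column k (B e (face_point k s q)))"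
    by (simp only: integral_open_interval)
qed

lemma boundary_form_scale: "boundary_form c (\<lambda>e \<xi>. r *\<^sub>R A e \<xi>) = r * boundary_form c A"
proof -
  have "column k (r *\<^sub>R B) = r *\<^sub>R column k B" for k and B :: "real^3^3" by (simp add: column_def vec_eq_iff)
  then show ?thesis
    unfolding boundary_form_def sum_distrib_left by (intro sum.cong) (auto simp: mult_ac)
qed

lemma boundary_form_add:
  assumes A: "\<And>e. e \<in> cells M \<Longrightarrow> continuous_on cube (A e)" and B: "\<And>e. e \<in> cells M \<Longrightarrow> continuous_on cube (B e)"
  shows "boundary_form c (\<lambda>e \<xi>. A e \<xi> + B e \<xi>) = boundary_form c A + boundary_form c B"
  unfolding boundary_form_def sum.distrib[symmetric]
proof (rule sum.cong[OF refl], clarify)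
  fix e k s assume "(e, k, s) \<in> boundary_faces M"
  note f = boundary_facesD(1,2)[OF this]
  have i: "(\<lambda>q. geo M e (face_point k s q) \<bullet> column k (C e (face_point k s q))) integrable_on square"
    if "continuous_on cube (C e)" for C
  proof (rule integrable_continuous)
    have fp: "face_point k s ` square \<subseteq> cube" using face_point_cube f(2) by blast
    have "continuous_on square (\<lambda>q. C e (face_point k s q))"
      by (rule continuous_on_compose2[OF that face_point_continuous fp])
    then have "continuous_on square (\<lambda>q. column k (C e (face_point k s q)))"
      unfolding column_def by (intro continuous_on_vec_lambda continuous_on_entry)
    moreover have "continuous_on square (\<lambda>q. geo M e (face_point k s q))"
      by (rule continuous_on_compose2[OF geo_continuous[OF f(1)] face_point_continuous fp])
    ultimately show "continuous_on square (\<lambda>q. geo M e (face_point k s q) \<bullet> column k (C e (face_point k s q)))"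
      by (intro continuous_on_inner)
  qed
  have c: "column k (X + Y) = column k X + column k Y" for X Y :: "real^3^3" by (simp add: column_def vec_eq_iff)
  show "s * c * integral square (\<lambda>q. geo M e (face_point k s q) \<bullet> column k (A e (face_point k s q) + B e (face_point k s q))) =
      s * c * integral square (\<lambda>q. geo M e (face_point k s q) \<bullet> column k (A e (face_point k s q))) +
      s * c * integral square (\<lambda>q. geo M e (face_point k s q) \<bullet> column k (B e (face_point k s q)))"
    unfolding c inner_add_right integral_add[OF i[of A, OF A[OF f(1)]] i[of B, OF B[OF f(1)]]] distrib_left ..
qed

lemma boundary_form_sum:
  assumes "\<And>i e. e \<in> cells M \<Longrightarrow> continuous_on cube (A i e)"
  shows "boundary_form c (\<lambda>e \<xi>. \<Sum>i<m. r i *\<^sub>R A i e \<xi>) = (\<Sum>i<(m::nat). r i * boundary_form c (A i))"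
proof (induction m)
  case 0
  show ?case using boundary_form_scale[of c 0 "\<lambda>_ _. 0"] by simp
next
  case (Suc m)
  have "boundary_form c (\<lambda>e \<xi>. (\<Sum>i<m. r i *\<^sub>R A i e \<xi>) + r m *\<^sub>R A m e \<xi>) =
      boundary_form c (\<lambda>e \<xi>. \<Sum>i<m. r i *\<^sub>R A i e \<xi>) + boundary_form c (\<lambda>e \<xi>. r m *\<^sub>R A m e \<xi>)"
    by (intro boundary_form_add continuous_on_sum continuous_on_scaleR continuous_on_const assms)
  then show ?case by (simp add: Suc.IH boundary_form_scale)
qed

lemma mcross_continuous:
  "continuous_on S A \<Longrightarrow> continuous_on S B \<Longrightarrow> continuous_on S (\<lambda>x. mcross (A x) (B x))"
  unfolding mcross_def by (intro continuous_on_diff cof_continuous continuous_on_add)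

lemma boundary_form_flux:
  assumes u: "u \<in> conforming_fields M" and v: "v \<in> conforming_fields M"
  shows "boundary_form c (\<lambda>e \<xi>. mcross (jac M e u \<xi>) (jac M e v \<xi>)) = c / 2 * (\<Sum>f\<in>boundary_faces M. flux u v f)"
  unfolding boundary_form_def sum_distrib_left
proof (rule sum.cong[OF refl], clarify)
  fix e k s assume "(e, k, s) \<in> boundary_faces M"
  note f = boundary_facesD(1,2)[OF this]
  have "integral square (\<lambda>q. geo M e (face_point k s q) \<bullet> column k (mcross (jac M e u (face_point k s q)) (jac M e v (face_point k s q)))) =
     integral square (\<lambda>q. flux_density u v e k (face_point k s q))"
    by (rule integral_cong) (simp only: flux_density_eq[OF f(1) u v face_point_cube[OF _ f(2)]])
  then show "s * c * integral square (\<lambda>q. geo M e (face_point k s q) \<bullet> column k (mcross (jac M e u (face_point k s q)) (jac M e v (face_point k s q)))) =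
      c / 2 * flux u v (e, k, s)"
    using integral_square_face[OF tpol_flux_density[OF f(1) u v, of k], of k s] by (simp add: flux_def)
qed

text \<open>A second cell at such a point would be glued along the face, and glued points are off
  the frontier.\<close>

lemma boundary_face_unshared:
  assumes f: "(e, k, s) \<in> boundary_faces M" and \<eta>: "\<eta> \<in> face_int k s" and e': "e' \<in> cells M" "e' \<noteq> e"
  shows "geo M e \<eta> \<notin> geo M e' ` cube"
proof
  note b = boundary_facesD[OF f]
  assume m: "geo M e \<eta> \<in> geo M e' ` cube"
  obtain g where g: "linear g" "g ` cube = cube" "\<And>\<eta>. \<eta> \<in> cube_face {k} (\<lambda>_. s) \<Longrightarrow> geo M e' (g \<eta>) = geo M e \<eta>"
    using shared_face[OF b(1) e'(1) e'(2)[symmetric] b(2) \<eta> m] by metis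
  obtain \<pi> \<epsilon> where p: "bij \<pi>" "\<And>i. \<bar>\<epsilon> i\<bar> = 1" "\<And>\<xi> i. g \<xi> $ i = \<epsilon> i * \<xi> $ \<pi> i"
    using cube_signed_perm[OF g(1,2)] by metis
  have "glued e k s e' (inv \<pi> k) (\<epsilon> (inv \<pi> k) * s) g \<pi> \<epsilon>"
    unfolding glued_def using b e' g p by (simp add: surj_f_inv_f bij_is_surj)
  then show False using glued_not_frontier \<eta> b(3) face_int_face[OF b(2) \<eta>] by blast
qed

text \<open>Near the point the closure of the domain is the single cell, so the half-space property
  passes from cell to domain: outside because nothing else is there, inside because images of open
  cubes lie in the domain.\<close>

lemma boundary_normal:
  assumes f: "(e, k, s) \<in> boundary_faces M" and \<eta>: "\<eta> \<in> face_int k s"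
  shows "outward_normal (dom M) (geo M e \<eta>) = inverse (norm (face_normal e k s \<eta>)) *\<^sub>R face_normal e k s \<eta>"
proof (rule outward_normal_eqI)
  note b = boundary_facesD[OF f]
  let ?n = "face_normal e k s \<eta>" and ?X = "geo M e \<eta>"
  have nz: "?n \<noteq> 0" using face_normal_nonzero[OF b(1) face_int_cube[OF b(2) \<eta>] b(2)] .
  then show "norm (inverse (norm ?n) *\<^sub>R ?n) = 1" by simp
  fix \<epsilon> :: real assume "\<epsilon> > 0"
  \<comment> \<open>The area vector is not a unit vector, so the tolerance is rescaled by its
    length.\<close>
  then have "\<epsilon> * norm ?n > 0" using nz by simp
  from face_halfspace[OF b(1,2) \<eta> this]
  have h: "\<forall>\<^sub>F y in at ?X. ((y - ?X) \<bullet> ?n > \<epsilon> * norm ?n * norm (y - ?X) \<longrightarrow> y \<notin> geo M e ` cube) \<and>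
    ((y - ?X) \<bullet> ?n < - (\<epsilon> * norm ?n) * norm (y - ?X) \<longrightarrow> y \<in> geo M e ` ocube)" .
  obtain V where V: "open V" "?X \<in> V" "closure (dom M) \<inter> V \<subseteq> geo M e ` cube"
    using unshared_nhd[OF b(1) boundary_face_unshared[OF f \<eta>]] by metis
  have "\<forall>\<^sub>F y in at ?X. y \<in> V" using V(1,2) by (rule eventually_at_in_open')
  with h show "\<forall>\<^sub>F y in at ?X. ((y - ?X) \<bullet> (inverse (norm ?n) *\<^sub>R ?n) > \<epsilon> * norm (y - ?X) \<longrightarrow> y \<notin> dom M) \<and>
    ((y - ?X) \<bullet> (inverse (norm ?n) *\<^sub>R ?n) < - \<epsilon> * norm (y - ?X) \<longrightarrow> y \<in> dom M)"
  proof eventually_elim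
    case (elim y)
    have n: "norm ?n > 0" using nz by simp
    show ?case
    proof (intro conjI impI)
      assume "(y - ?X) \<bullet> (inverse (norm ?n) *\<^sub>R ?n) > \<epsilon> * norm (y - ?X)"
      then have "(y - ?X) \<bullet> ?n > \<epsilon> * norm ?n * norm (y - ?X)" using n by (simp add: field_simps)
      then have "y \<notin> geo M e ` cube" using elim(1) by blast
      then show "y \<notin> dom M" using V(3) elim(2) closure_subset by blast
    next
      assume "(y - ?X) \<bullet> (inverse (norm ?n) *\<^sub>R ?n) < - \<epsilon> * norm (y - ?X)"
      then have "(y - ?X) \<bullet> ?n < - (\<epsilon> * norm ?n) * norm (y - ?X)" using n by (simp add: field_simps)
      then have "y \<in> geo M e ` ocube" using elim(1) by blast
      then show "y \<in> dom M" using ocube_image_dom[OF b(1)] by blast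
    qed
  qed
qed

text \<open>Nanson's formula: the length of the area vector cancels between normal and surface
  element, and multiplicativity of the cofactor merges the physical gradient with the geometry
  Jacobian.\<close>

lemma boundary_functional_eq:
  assumes y: "y \<in> conforming_fields M"
  shows "boundary_functional M (\<lambda>X. c *\<^sub>R X) y = boundary_form c (\<lambda>e \<xi>. cof (jac M e y \<xi>))"
  unfolding boundary_functional_def boundary_integral_def boundary_form_def
proof (rule sum.cong[OF refl], clarify)
  fix e k s assume f: "(e, k, s) \<in> boundary_faces M"
  note b = boundary_facesD[OF f]
  let ?p = "face_point k s"
  have pt: "(c *\<^sub>R geo M e \<eta>) \<bullet> (cof (grad M y (geo M e \<eta>)) *v outward_normal (dom M) (geo M e \<eta>)) *
      norm (cross3 (column (k + 1) (geo_jac M e \<eta>)) (column (k + 2) (geo_jac M e \<eta>))) =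
     s * c * (geo M e \<eta> \<bullet> column k (cof (jac M e y \<eta>)))" if \<eta>: "\<eta> \<in> face_int k s" for \<eta>
  proof -
    have \<eta>c: "\<eta> \<in> cube" using face_int_cube[OF b(2) \<eta>] .
    let ?n = "face_normal e k s \<eta>"
    have nz: "norm ?n > 0" using face_normal_nonzero[OF b(1) \<eta>c b(2)] by simp
    obtain V where V: "open V" "geo M e \<eta> \<in> V" "closure (dom M) \<inter> V \<subseteq> geo M e ` cube"
      using unshared_nhd[OF b(1) boundary_face_unshared[OF f \<eta>]] by metis
    have g: "grad M y (geo M e \<eta>) = disp_grad e y \<eta>" by (rule grad_eq[OF b(1) \<eta>c y V])
    have nn: "norm (cross3 (column (k + 1) (geo_jac M e \<eta>)) (column (k + 2) (geo_jac M e \<eta>))) = norm ?n"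
      using b(2) by (simp add: face_normal_def cof_column)
    have "cof (disp_grad e y \<eta>) *v ?n = s *\<^sub>R column k (cof (disp_grad e y \<eta> ** geo_jac M e \<eta>))"
      by (simp add: face_normal_def matrix_vector_mult_scaleR cof_mult column_matrix_mult)
    also have "\<dots> = s *\<^sub>R column k (cof (jac M e y \<eta>))" by (simp only: disp_grad_mult[OF b(1) \<eta>c])
    finally show ?thesis
      unfolding g boundary_normal[OF f \<eta>] nn using nz by (simp add: matrix_vector_mult_scaleR)
  qed
  have "integral (box (-1, -1) (1, 1)) (\<lambda>q. (c *\<^sub>R geo M e (?p q)) \<bullet> (cof (grad M y (geo M e (?p q))) *v outward_normal (dom M) (geo M e (?p q))) *
      norm (cross3 (column (k + 1) (geo_jac M e (?p q))) (column (k + 2) (geo_jac M e (?p q))))) =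
     integral (box (-1, -1) (1, 1)) (\<lambda>q. s * c * (geo M e (?p q) \<bullet> column k (cof (jac M e y (?p q)))))"
    by (rule integral_cong) (rule pt[OF face_point_face_int])
  then show "integral square (\<lambda>q. (c *\<^sub>R geo M e (?p q)) \<bullet> (cof (grad M y (geo M e (?p q))) *v outward_normal (dom M) (geo M e (?p q))) *
      norm (cross3 (column (k + 1) (geo_jac M e (?p q))) (column (k + 2) (geo_jac M e (?p q))))) =
      s * c * integral square (\<lambda>q. geo M e (?p q) \<bullet> column k (cof (jac M e y (?p q))))"
    unfolding integral_open_interval by (simp only: integral_mult_right)
qed

lemma hessian_boundary_functional:
  assumes y: "y \<in> conforming_fields M" and u: "u \<in> conforming_fields M" and v: "v \<in> conforming_fields M"
  shows "hessian (boundary_functional M (\<lambda>X. c *\<^sub>R X)) y u v =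
    boundary_form c (\<lambda>e \<xi>. mcross (jac M e u \<xi>) (jac M e v \<xi>))"
proof (rule hessian_quadratic)
  fix s t
  let ?b = "boundary_form c"
  note cj = jac_continuous[OF _ y] jac_continuous[OF _ u] jac_continuous[OF _ v]
  have "boundary_functional M (\<lambda>X. c *\<^sub>R X) (\<lambda>X. y X + s *\<^sub>R u X + t *\<^sub>R v X) =
    ?b (\<lambda>e \<xi>. cof (jac M e (\<lambda>X. y X + s *\<^sub>R u X + t *\<^sub>R v X) \<xi>))"
    by (intro boundary_functional_eq conforming_comb y u v)
  also have "\<dots> = ?b (\<lambda>e \<xi>. cof (jac M e y \<xi> + s *\<^sub>R jac M e u \<xi> + t *\<^sub>R jac M e v \<xi>))"
  proof (rule boundary_form_cong)
    fix e k s' \<eta> assume f: "(e, k, s') \<in> boundary_faces M" "\<eta> \<in> face_int k s'"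
    note b = boundary_facesD[OF f(1)]
    have \<eta>: "\<eta> \<in> cube" using face_int_cube[OF b(2) f(2)] .
    show "column k (cof (jac M e (\<lambda>X. y X + s *\<^sub>R u X + t *\<^sub>R v X) \<eta>)) = column k (cof (jac M e y \<eta> + s *\<^sub>R jac M e u \<eta> + t *\<^sub>R jac M e v \<eta>))"
      by (simp only: jac_comb[OF b(1) conforming_comb[OF y u] v \<eta>] jac_comb[OF b(1) y u \<eta>])
  qed
  also have "\<dots> = ?b (\<lambda>e \<xi>. cof (jac M e y \<xi>)) + s * ?b (\<lambda>e \<xi>. mcross (jac M e y \<xi>) (jac M e u \<xi>))
     + t * ?b (\<lambda>e \<xi>. mcross (jac M e y \<xi>) (jac M e v \<xi>)) + s * t * ?b (\<lambda>e \<xi>. mcross (jac M e u \<xi>) (jac M e v \<xi>))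
     + s\<^sup>2 * ?b (\<lambda>e \<xi>. cof (jac M e u \<xi>)) + t\<^sup>2 * ?b (\<lambda>e \<xi>. cof (jac M e v \<xi>))"
    unfolding cof_polar boundary_form_scale[symmetric]
    by (subst boundary_form_add, (intro continuous_on_add continuous_on_scaleR continuous_on_const mcross_continuous cof_continuous cj; assumption)+)+ (rule refl)
  finally show "boundary_functional M (\<lambda>X. c *\<^sub>R X) (\<lambda>X. y X + s *\<^sub>R u X + t *\<^sub>R v X) =
    ?b (\<lambda>e \<xi>. cof (jac M e y \<xi>)) + s * ?b (\<lambda>e \<xi>. mcross (jac M e y \<xi>) (jac M e u \<xi>))
     + t * ?b (\<lambda>e \<xi>. mcross (jac M e y \<xi>) (jac M e v \<xi>)) + s * t * ?b (\<lambda>e \<xi>. mcross (jac M e u \<xi>) (jac M e v \<xi>))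
     + s\<^sup>2 * ?b (\<lambda>e \<xi>. cof (jac M e u \<xi>)) + t\<^sup>2 * ?b (\<lambda>e \<xi>. cof (jac M e v \<xi>))" .
qed

lemma reference_form_boundary:
  assumes "y \<in> conforming_fields M" "u \<in> conforming_fields M" "v \<in> conforming_fields M"
  shows "reference_form M (\<lambda>X. c *\<^sub>R X) y u v = hessian (boundary_functional M (\<lambda>X. c *\<^sub>R X)) y u v"
  by (simp only: hessian_boundary_functional[OF assms] boundary_form_flux[OF assms(2,3)] reference_form_flux[OF assms])

section \<open>Trace coordinates and the boundary matrix\<close>

lemma conforming_sum:
  assumes "\<And>i. i < m \<Longrightarrow> \<tau> i \<in> conforming_fields M"
  shows "(\<lambda>X. \<Sum>i<m. r i *\<^sub>R \<tau> i X) \<in> conforming_fields M \<and>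
    (\<forall>e\<in>cells M. \<forall>\<xi>\<in>cube. jac M e (\<lambda>X. \<Sum>i<m. r i *\<^sub>R \<tau> i X) \<xi> = (\<Sum>i<(m::nat). r i *\<^sub>R jac M e (\<tau> i) \<xi>))"
  using assms
proof (induction m)
  case 0
  \<comment> \<open>The empty sum is the zero field, written as the identity minus itself to reuse
    the rules for combinations.\<close>
  have "(\<lambda>X. X + (-1) *\<^sub>R X) \<in> conforming_fields M" by (rule conforming_comb[OF id_conforming id_conforming])
  moreover have "jac M e (\<lambda>X. X + (-1) *\<^sub>R X) \<xi> = 0" if "e \<in> cells M" "\<xi> \<in> cube" for e \<xi>
    using jac_comb[OF that(1) id_conforming id_conforming that(2), of "-1"] by simp
  ultimately show ?case by simp
next
  case (Suc m)
  have IH0: "(\<lambda>X. \<Sum>i<m. r i *\<^sub>R \<tau> i X) \<in> conforming_fields M \<and>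
    (\<forall>e\<in>cells M. \<forall>\<xi>\<in>cube. jac M e (\<lambda>X. \<Sum>i<m. r i *\<^sub>R \<tau> i X) \<xi> = (\<Sum>i<m. r i *\<^sub>R jac M e (\<tau> i) \<xi>))"
    by (rule Suc.IH) (use Suc.prems in auto)
  then have IH: "(\<lambda>X. \<Sum>i<m. r i *\<^sub>R \<tau> i X) \<in> conforming_fields M"
    "\<And>e \<xi>. e \<in> cells M \<Longrightarrow> \<xi> \<in> cube \<Longrightarrow> jac M e (\<lambda>X. \<Sum>i<m. r i *\<^sub>R \<tau> i X) \<xi> = (\<Sum>i<m. r i *\<^sub>R jac M e (\<tau> i) \<xi>)"
    by blast+
  have \<tau>: "\<tau> m \<in> conforming_fields M" using Suc.prems by simp
  have s: "(\<lambda>X. \<Sum>i<Suc m. r i *\<^sub>R \<tau> i X) = (\<lambda>X. (\<Sum>i<m. r i *\<^sub>R \<tau> i X) + r m *\<^sub>R \<tau> m X)" by simp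
  show ?case
    unfolding s using conforming_comb[OF IH(1) \<tau>] jac_comb[OF _ IH(1) \<tau>] IH(2) by (simp del: o_apply)
qed

text \<open>Only the tangential derivatives of a variation enter the boundary form, so it depends on the
  boundary trace alone.\<close>

lemma boundary_form_trace:
  assumes \<tau>: "\<And>i. i < m \<Longrightarrow> \<tau> i \<in> conforming_fields M" and u: "u \<in> conforming_fields M" and v: "v \<in> conforming_fields M"
    and eq: "\<And>X. X \<in> frontier (dom M) \<Longrightarrow> u X = (\<Sum>i<(m::nat). r i *\<^sub>R \<tau> i X)"
  shows "boundary_form c (\<lambda>e \<xi>. mcross (jac M e u \<xi>) (jac M e v \<xi>)) =
    (\<Sum>i<m. r i * boundary_form c (\<lambda>e \<xi>. mcross (jac M e (\<tau> i) \<xi>) (jac M e v \<xi>)))"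
proof -
  define w where "w = (\<lambda>X. \<Sum>i<m. r i *\<^sub>R \<tau> i X)"
  have w: "w \<in> conforming_fields M" "\<And>e \<xi>. e \<in> cells M \<Longrightarrow> \<xi> \<in> cube \<Longrightarrow> jac M e w \<xi> = (\<Sum>i<m. r i *\<^sub>R jac M e (\<tau> i) \<xi>)"
    using conforming_sum[of m \<tau> r, OF \<tau>] unfolding w_def by blast+
  \<comment> \<open>Indices from m on get the identity as a dummy, because
    \<open>boundary_form_sum\<close> asks for continuity at every index.\<close>
  define \<tau>' where "\<tau>' i = (if i < m then \<tau> i else (\<lambda>X. X))" for i
  have \<tau>': "\<tau>' i \<in> conforming_fields M" for i using \<tau> id_conforming by (simp add: \<tau>'_def)
  have "boundary_form c (\<lambda>e \<xi>. mcross (jac M e u \<xi>) (jac M e v \<xi>)) =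
     boundary_form c (\<lambda>e \<xi>. \<Sum>i<m. r i *\<^sub>R mcross (jac M e (\<tau>' i) \<xi>) (jac M e v \<xi>))"
  proof (rule boundary_form_cong)
    fix e k s \<eta> assume f: "(e, k, s) \<in> boundary_faces M" and \<eta>: "\<eta> \<in> face_int k s"
    note b = boundary_facesD[OF f]
    have \<eta>c: "\<eta> \<in> cube" using face_int_cube[OF b(2) \<eta>] .
    have "column j (jac M e u \<eta>) = column j (jac M e w \<eta>)" if "j \<noteq> k" for j
      by (rule face_column_eq[OF b(2) \<eta> that field_rep(4)[OF b(1) u \<eta>c] field_rep(4)[OF b(1) w(1) \<eta>c]])
         (simp add: eq[OF b(3)] w_def)
    then have "column k (mcross (jac M e u \<eta>) (jac M e v \<eta>)) = column k (mcross (jac M e w \<eta>) (jac M e v \<eta>))"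
      by (intro mcross_column_cong) auto
    also have "mcross (jac M e w \<eta>) (jac M e v \<eta>) = (\<Sum>i<m. r i *\<^sub>R mcross (jac M e (\<tau>' i) \<eta>) (jac M e v \<eta>))"
      by (simp add: w(2)[OF b(1) \<eta>c] mcross_sum mcross_scale \<tau>'_def)
    finally show "column k (mcross (jac M e u \<eta>) (jac M e v \<eta>)) =
       column k (\<Sum>i<m. r i *\<^sub>R mcross (jac M e (\<tau>' i) \<eta>) (jac M e v \<eta>))" .
  qed
  also have "\<dots> = (\<Sum>i<m. r i * boundary_form c (\<lambda>e \<xi>. mcross (jac M e (\<tau>' i) \<xi>) (jac M e v \<xi>)))"
    by (rule boundary_form_sum) (intro mcross_continuous jac_continuous \<tau>' v)
  also have "\<dots> = (\<Sum>i<m. r i * boundary_form c (\<lambda>e \<xi>. mcross (jac M e (\<tau> i) \<xi>) (jac M e v \<xi>)))"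
    by (intro sum.cong) (auto simp: \<tau>'_def)
  finally show ?thesis .
qed

lemma variations_conforming: "u \<in> variations M \<Longrightarrow> u \<in> conforming_fields M"
  by (simp add: variations_def)

text \<open>The matrix consists of the values of the boundary form on the trace basis. Trace
  dependence expands the first argument, and symmetry of the mixed cofactor then expands the
  second.\<close>

lemma boundary_matrix_exists:
  assumes R: "trace_extraction M m \<tau> R"
  shows "\<exists>B. boundary_matrix M m R (\<lambda>X. c *\<^sub>R X) B"
proof -
  define \<Phi> where "\<Phi> u v = boundary_form c (\<lambda>e \<xi>. mcross (jac M e u \<xi>) (jac M e v \<xi>))" for u v
  have sym: "\<Phi> u v = \<Phi> v u" for u v unfolding \<Phi>_def by (subst mcross_commute) (rule refl)
  have \<tau>: "\<And>i. i < m \<Longrightarrow> \<tau> i \<in> conforming_fields M"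
    and Ru: "\<And>u X. u \<in> variations M \<Longrightarrow> X \<in> frontier (dom M) \<Longrightarrow> u X = (\<Sum>i<m. R u i *\<^sub>R \<tau> i X)"
    using R variations_conforming unfolding trace_extraction_def by auto
  have exp: "\<Phi> u v = (\<Sum>i<m. R u i * \<Phi> (\<tau> i) v)" if "u \<in> variations M" "v \<in> conforming_fields M" for u v
    unfolding \<Phi>_def
    by (rule boundary_form_trace) (use \<tau> Ru that variations_conforming in auto)
  have "boundary_matrix M m R (\<lambda>X. c *\<^sub>R X) (\<lambda>i j. \<Phi> (\<tau> i) (\<tau> j))"
    unfolding boundary_matrix_def
  proof (intro conjI ballI allI impI)
    show "\<Phi> (\<tau> i) (\<tau> j) = \<Phi> (\<tau> j) (\<tau> i)" for i j by (rule sym)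
    fix y u v assume y: "y \<in> conforming_fields M" and u: "u \<in> variations M" and v: "v \<in> variations M"
    have "\<Phi> u v = (\<Sum>i<m. R u i * (\<Sum>j<m. R v j * \<Phi> (\<tau> j) (\<tau> i)))"
      unfolding exp[OF u variations_conforming[OF v]]
      by (intro sum.cong refl arg_cong2[of _ _ _ _ "(*)"]) (subst sym, rule exp[OF v], simp add: \<tau>)
    also have "\<dots> = trace_form m R (\<lambda>i j. \<Phi> (\<tau> i) (\<tau> j)) u v"
      unfolding trace_form_def sum_distrib_left
      by (intro sum.cong refl) (simp add: sym mult_ac)
    finally show "hessian (boundary_functional M (\<lambda>X. c *\<^sub>R X)) y u v = trace_form m R (\<lambda>i j. \<Phi> (\<tau> i) (\<tau> j)) u v"
      using hessian_boundary_functional[OF y variations_conforming[OF u] variations_conforming[OF v]] by (simp add: \<Phi>_def)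
  qed
  then show ?thesis by blast
qed

end

theorem theorem16:
  fixes M :: "'e discretization"
    and Z :: "(real^3 \<Rightarrow> real^3) set"
    and h :: "'e \<Rightarrow> real"
    and a b C_P c_star c0 :: real
  assumes mesh: "conforming_mesh M"
    and geometry: "\<And>e. e \<in> cells M \<Longrightarrow> geo M e \<in> tensor_poly 2"
    and orders: "\<And>e. e \<in> cells M \<Longrightarrow> degree_of M e \<ge> 2"
    and gauss_points: "\<And>e i. e \<in> cells M \<Longrightarrow> points M e i \<ge> degree_of M e + 1"
    and potentials: "potential_space M Z" "(\<lambda>X. X) \<in> Z"
    and ab: "0 < a" "a \<le> b"
    and sizes: "\<And>e. e \<in> cells M \<Longrightarrow> h e > 0"
    and jac_bound: "\<And>e \<xi>. e \<in> cells M \<Longrightarrow> \<xi> \<in> cube \<Longrightarrow>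
          spectral_norm (geo_jac M e \<xi>) \<le> b * h e"
    and jac_inv_bound: "\<And>e \<xi>. e \<in> cells M \<Longrightarrow> \<xi> \<in> cube \<Longrightarrow>
          spectral_norm (matrix_inv (geo_jac M e \<xi>)) \<le> inverse (a * h e)"
    and jac_pos: "\<And>e \<xi>. e \<in> cells M \<Longrightarrow> \<xi> \<in> cube \<Longrightarrow> det (geo_jac M e \<xi>) > 0"
    and poincare: "\<And>u. u \<in> variations M \<Longrightarrow> l2_norm M u \<le> C_P * l2_norm M (grad M u)"
    and moduli: "\<And>e. e \<in> cells M \<Longrightarrow> c1 M e \<ge> 0" "\<And>e. e \<in> cells M \<Longrightarrow> c2 M e \<ge> 0"
      "\<And>e. e \<in> cells M \<Longrightarrow> kappa M e \<ge> 0"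
    and c_star: "c0 > 0" "c_star \<ge> c0" "\<And>e. e \<in> cells M \<Longrightarrow> c_star \<le> c1 M e + c2 M e"
  shows "let z = (\<lambda>X. (2 * c_star) *\<^sub>R X) in
      z \<in> exact_potentials M Z \<and>
      (\<forall>u\<in>variations M.
         lifted_tangent M z (\<lambda>X. X) u u \<ge> 2 * c0 / (1 + C_P\<^sup>2) * (a / b) ^ 5 * (h1_norm M u)\<^sup>2) \<and>
      (\<forall>m \<tau> R. trace_extraction M m \<tau> R \<longrightarrow>
         (\<exists>B. boundary_matrix M m R z B) \<and>
         (\<forall>B. boundary_matrix M m R z B \<longrightarrow>
            (\<forall>y\<in>deformations M. \<forall>u\<in>variations M. \<forall>v\<in>variations M.
               tangent M y u v = lifted_tangent M z y u v - trace_form m R B u v)))"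
proof -
  interpret fe_mesh M by unfold_locales (fact mesh geometry orders gauss_points jac_pos)+
  let ?z = "\<lambda>X::real^3. (2 * c_star) *\<^sub>R X"
  have "?z \<in> exact_potentials M Z"
    using potentials quad_defect_scaled_geo by (auto simp: exact_potentials_def potential_space_def)
  moreover have "lifted_tangent M ?z (\<lambda>X. X) u u \<ge> 2 * c0 / (1 + C_P\<^sup>2) * (a / b) ^ 5 * (h1_norm M u)\<^sup>2"
    if "u \<in> variations M" for u
  proof -
    have u: "u \<in> conforming_fields M" using that by (rule variations_conforming)
    let ?f = "\<lambda>e \<xi>. det (geo_jac M e \<xi>) * (norm (disp_grad e u \<xi>))\<^sup>2"
    let ?I = "integral (dom M) (\<lambda>X. (norm (grad M u X))\<^sup>2)"
    have P: "1 + C_P\<^sup>2 > 0" by (simp add: add_pos_nonneg)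
    have r: "(a / b) ^ 5 \<ge> 0" using ab by simp
    have "2 * c0 / (1 + C_P\<^sup>2) * (a / b) ^ 5 * (h1_norm M u)\<^sup>2
       \<le> 2 * c0 / (1 + C_P\<^sup>2) * (a / b) ^ 5 * ((1 + C_P\<^sup>2) * ?I)"
      using h1_norm_le[OF u poincare[OF that]] c_star(1) r by (intro mult_left_mono mult_nonneg_nonneg) auto
    also have "\<dots> = 2 * c0 * ((a / b) ^ 5 * ?I)"
    proof -
      have "2 * c0 / D * r * (D * I) = 2 * c0 * (r * I)" if "D > 0" for D r I :: real using that by simp
      then show ?thesis using P .
    qed
    also have "\<dots> \<le> 2 * c0 * ((a / b) ^ 5 * (\<Sum>e\<in>cells M. integral cube (?f e)))"
      using c_star(1) r integral_dom_grad_le(2)[OF u] by (intro mult_left_mono) auto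
    also have "\<dots> \<le> 2 * c0 * (\<Sum>e\<in>cells M. quad M e (?f e))"
      unfolding sum_distrib_left[of "(a / b) ^ 5"] using c_star(1)
      by (intro mult_left_mono sum_mono quad_grad_ge[OF _ u ab sizes jac_bound jac_inv_bound]) auto
    also have "\<dots> \<le> lifted_tangent M ?z (\<lambda>X. X) u u"
      using c_star by (intro lifted_tangent_id_ge u moduli) auto
    finally show ?thesis .
  qed
  moreover have "tangent M y u v = lifted_tangent M ?z y u v - trace_form m R B u v"
    if "boundary_matrix M m R ?z B" "y \<in> deformations M" "u \<in> variations M" "v \<in> variations M" for m R B y u v
  proof -
    have y: "y \<in> conforming_fields M" using that(2) by (simp add: deformations_def)
    \<comment> \<open>Both sides are Hessians that do not depend on y, so the identity for the
      tangent holds at every admissible deformation and not just at the identity.\<close>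
    have "reference_form M ?z y u v = trace_form m R B u v"
      using that y reference_form_boundary[OF y variations_conforming variations_conforming]
      by (simp add: boundary_matrix_def)
    then show ?thesis by (simp add: lifted_tangent_def)
  qed
  ultimately show ?thesis
    unfolding Let_def using boundary_matrix_exists by blast
qed

end
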